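(* Let $n\ge 4$ and let $q$ be a prime power. If $C$ is an EKR-set of maximal flags in (the oriflamme complex of) the hyperbolic quadric of rank $n$ over $\mathbb{F}_q$, then $$|C|\le\frac{\prod_{i=1}^{n-1}(q^i+1)\left[{n\atop 1}\right]_q\cdots\left[{1\atop 1}\right]_q}{1+q^{n-1}}=\prod_{i=1}^{n-2}(q^i+1)\left[{n\atop 1}\right]_q\cdots\left[{1\atop 1}\right]_q.$$
   Context: $\left[{k\atop 1}\right]_q=(q^k-1)/(q-1)$. The hyperbolic quadric of rank $n$ is the polar space of nonzero totally singular subspaces of a nondegenerate hyperbolic quadratic form on $\mathbb{F}_q^{2n}$. Its $n$-dimensional subspaces (generators) fall into two classes, $N_1,N_2$ being in the same class iff $\dim(N_1\cap N_2)\equiv n\pmod2$. The oriflamme complex has as elements the totally singular subspaces of dimension $i$ (type $i$) for $1\le i\le n-2$, and the generators of the two classes (types $n$ and $n'$). Incidence is inclusion, except that generators of types $n$ and $n'$ are incident if they meet in an $(n-1)$-dimensional subspace. A maximal flag is a set of pairwise incident elements, one of each type in $\{1,\dots,n-2,n,n'\}$. Two points are collinear if they span a totally singular subspace; a polar frame is a set of $2n$ points $\{e_{-n},\dots,e_{-1},e_1,\dots,e_n\}$ with each $e_i$ collinear with all points of the set except $e_{-i}$. Fix a polar frame and the maximal flag $F=\{\langle e_1\rangle,\dots,\langle e_1,\dots,e_{n-2}\rangle,\langle e_1,\dots,e_{n-1},e_n\rangle,\langle e_1,\dots,e_{n-1},e_{-n}\rangle\}$. Let $G=\mathrm{PGO}^+(2n,q)$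 acting on the oriflamme complex type-preservingly (preserving both classes of generators), and $B$ the stabilizer of $F$; $G$ is transitive on maximal flags. The Weyl group of type $D_n$ is the group of permutations of $\{\pm1,\dots,\pm n\}$ generated by $s_i=(i,i+1)(-i,-i-1)$, $1\le i\le n-1$, and $u=ts_{n-1}t$ with $t=(-n,n)$; it acts on the frame by permuting indices (induced by elements of $G$). Its longest element is $w_0=(1,-1)\cdots(n,-n)$ if $n$ is even and $w_0=(1,-1)\cdots(n-1,-(n-1))$ if $n$ is odd. Two maximal flags $gF,hF$ are opposite if $Bh^{-1}gB=Bw_0B$. An EKR-set of maximal flags is a set of maximal flags no two of which are opposite. *)

theory Defs
  imports "HOL-Analysis.Analysis" "HOL-Algebra.Coset"
begin

section \<open>Hyperbolic quadratic forms\<close>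

definition polar_form :: "('a::field^'d \<Rightarrow> 'a) \<Rightarrow> 'a^'d \<Rightarrow> 'a^'d \<Rightarrow> 'a" where
  "polar_form Q u v = Q (u + v) - Q u - Q v"

definition quadratic_form :: "('a::field^'d \<Rightarrow> 'a) \<Rightarrow> bool" where
  "quadratic_form Q \<longleftrightarrow>
     (\<forall>c v. Q (c *s v) = c\<^sup>2 * Q v) \<and>
     (\<forall>w. Vector_Spaces.linear (*s) (*) (\<lambda>v. polar_form Q v w)) \<and>
     (\<forall>w. Vector_Spaces.linear (*s) (*) (\<lambda>v. polar_form Q w v))"

text \<open>Valid in every characteristic: only singular vectors of the radical of the polar form
  have to vanish.\<close>

definition nondegenerate_form :: "('a::field^'d \<Rightarrow> 'a) \<Rightarrow> bool" where
  "nondegenerate_form Q \<longleftrightarrow> (\<forall>v. Q v = 0 \<and> (\<forall>w. polar_form Q v w = 0) \<longrightarrow> v = 0)"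

definition totally_singular :: "('a::field^'d \<Rightarrow> 'a) \<Rightarrow> ('a^'d) set \<Rightarrow> bool" where
  "totally_singular Q U \<longleftrightarrow> vec.subspace U \<and> (\<forall>v\<in>U. Q v = 0)"

definition singular_subspaces :: "('a::field^'d \<Rightarrow> 'a) \<Rightarrow> nat \<Rightarrow> ('a^'d) set set" where
  "singular_subspaces Q i = {U. totally_singular Q U \<and> vec.dim U = i}"

text \<open>On a space of dimension \<open>2n\<close> a nondegenerate form is hyperbolic iff its Witt index is
  \<open>n\<close>, the largest possible value.\<close>

definition hyperbolic_form :: "nat \<Rightarrow> ('a::field^'d \<Rightarrow> 'a) \<Rightarrow> bool" where
  "hyperbolic_form n Q \<longleftrightarrow>
     CARD('d) = 2 * n \<and> quadratic_form Q \<and> nondegenerate_form Q \<and> singular_subspaces Q n \<noteq> {}"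

section \<open>The oriflamme complex\<close>

definition generators :: "nat \<Rightarrow> ('a::field^'d \<Rightarrow> 'a) \<Rightarrow> ('a^'d) set set" where
  "generators n Q = singular_subspaces Q n"

definition same_class :: "nat \<Rightarrow> ('a::field^'d \<Rightarrow> 'a) \<Rightarrow> (('a^'d) set \<times> ('a^'d) set) set" where
  "same_class n Q = {(M, N). M \<in> generators n Q \<and> N \<in> generators n Q \<and>
                             vec.dim (M \<inter> N) mod 2 = n mod 2}"

text \<open>A type is represented by the set of all elements of that type. The two classes of
  generators (the types \<open>n\<close> and \<open>n'\<close>) enter symmetrically, as the two members of the quotient.\<close>

definition oriflamme_types :: "nat \<Rightarrow> ('a::field^'d \<Rightarrow> 'a) \<Rightarrow> ('a^'d) set set set" where
  "oriflamme_types n Q =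
     singular_subspaces Q ` {1..n-2} \<union> (generators n Q // same_class n Q)"

definition oriflamme_elements :: "nat \<Rightarrow> ('a::field^'d \<Rightarrow> 'a) \<Rightarrow> ('a^'d) set set" where
  "oriflamme_elements n Q = \<Union>(oriflamme_types n Q)"

definition incident ::
    "nat \<Rightarrow> ('a::field^'d \<Rightarrow> 'a) \<Rightarrow> ('a^'d) set \<Rightarrow> ('a^'d) set \<Rightarrow> bool" where
  "incident n Q U V \<longleftrightarrow>
     (if U \<in> generators n Q \<and> V \<in> generators n Q \<and> (U, V) \<notin> same_class n Q
      then vec.dim (U \<inter> V) = n - 1
      else U \<subseteq> V \<or> V \<subseteq> U)"

definition maximal_flags :: "nat \<Rightarrow> ('a::field^'d \<Rightarrow> 'a) \<Rightarrow> ('a^'d) set set set" where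
  "maximal_flags n Q =
     {F. F \<subseteq> oriflamme_elements n Q \<and> pairwise (incident n Q) F \<and>
         (\<forall>T\<in>oriflamme_types n Q. \<exists>!U. U \<in> F \<inter> T)}"

section \<open>Polar frames\<close>

definition collinear_points ::
    "('a::field^'d \<Rightarrow> 'a) \<Rightarrow> ('a^'d) set \<Rightarrow> ('a^'d) set \<Rightarrow> bool" where
  "collinear_points Q P R \<longleftrightarrow> totally_singular Q (vec.span (P \<union> R))"

definition frame_indices :: "nat \<Rightarrow> int set" where
  "frame_indices n = {- int n .. int n} - {0}"

definition polar_frame ::
    "nat \<Rightarrow> ('a::field^'d \<Rightarrow> 'a) \<Rightarrow> (int \<Rightarrow> ('a^'d) set) \<Rightarrow> bool" where
  "polar_frame n Q e \<longleftrightarrow>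
     inj_on e (frame_indices n) \<and> e ` frame_indices n \<subseteq> singular_subspaces Q 1 \<and>
     (\<forall>i\<in>frame_indices n. \<forall>j\<in>frame_indices n. collinear_points Q (e i) (e j) \<longleftrightarrow> j \<noteq> - i)"

definition frame_span :: "(int \<Rightarrow> ('a::field^'d) set) \<Rightarrow> int set \<Rightarrow> ('a^'d) set" where
  "frame_span e I = vec.span (\<Union>i\<in>I. e i)"

definition base_flag :: "nat \<Rightarrow> (int \<Rightarrow> ('a::field^'d) set) \<Rightarrow> ('a^'d) set set" where
  "base_flag n e =
     (\<lambda>i. frame_span e {1..int i}) ` {1..n-2} \<union>
     {frame_span e ({1..int n - 1} \<union> {int n}), frame_span e ({1..int n - 1} \<union> {- int n})}"

section \<open>The group\<close>

text \<open>\<open>PGO\<^sup>+(2n,q)\<close> is the group of projectivities that leave the quadric invariant, i.e.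
  the linear similarities of \<open>Q\<close> modulo the nonzero scalars.\<close>

definition similarity_group :: "('a::field^'d \<Rightarrow> 'a) \<Rightarrow> ('a^'d \<Rightarrow> 'a^'d) monoid" where
  "similarity_group Q =
     \<lparr>carrier = {f. Vector_Spaces.linear (*s) (*s) f \<and> bij f \<and>
                    (\<exists>c. c \<noteq> 0 \<and> (\<forall>v. Q (f v) = c * Q v))},
      mult = (\<circ>), one = id\<rparr>"

definition scalar_maps :: "('a::field^'d \<Rightarrow> 'a^'d) set" where
  "scalar_maps = {(*s) c | c. c \<noteq> 0}"

definition PGO :: "('a::field^'d \<Rightarrow> 'a) \<Rightarrow> ('a^'d \<Rightarrow> 'a^'d) set monoid" where
  "PGO Q = similarity_group Q Mod scalar_maps"

text \<open>The members of a coset \<open>X\<close> differ by scalars only, so for a subspace \<open>U\<close> all the images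
  \<open>f ` U\<close> with \<open>f \<in> X\<close> coincide and their union is this common image.\<close>

definition act :: "('a::field^'d \<Rightarrow> 'a^'d) set \<Rightarrow> ('a^'d) set \<Rightarrow> ('a^'d) set" where
  "act X U = (\<Union>f\<in>X. f ` U)"

definition act_flag :: "('a::field^'d \<Rightarrow> 'a^'d) set \<Rightarrow> ('a^'d) set set \<Rightarrow> ('a^'d) set set" where
  "act_flag X F = act X ` F"

definition type_preserving ::
    "nat \<Rightarrow> ('a::field^'d \<Rightarrow> 'a) \<Rightarrow> ('a^'d \<Rightarrow> 'a^'d) set set" where
  "type_preserving n Q =
     {X \<in> carrier (PGO Q). \<forall>N\<in>generators n Q. (N, act X N) \<in> same_class n Q}"

definition flag_stabilizer ::
    "nat \<Rightarrow> ('a::field^'d \<Rightarrow> 'a) \<Rightarrow> (int \<Rightarrow> ('a^'d) set) \<Rightarrow> ('a^'d \<Rightarrow> 'a^'d) set set" where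
  "flag_stabilizer n Q e =
     {X \<in> type_preserving n Q. act_flag X (base_flag n e) = base_flag n e}"

definition double_coset ::
    "nat \<Rightarrow> ('a::field^'d \<Rightarrow> 'a) \<Rightarrow> (int \<Rightarrow> ('a^'d) set) \<Rightarrow> ('a^'d \<Rightarrow> 'a^'d) set \<Rightarrow>
       ('a^'d \<Rightarrow> 'a^'d) set set" where
  "double_coset n Q e X =
     (flag_stabilizer n Q e #>\<^bsub>PGO Q\<^esub> X) <#>\<^bsub>PGO Q\<^esub> flag_stabilizer n Q e"

section \<open>Opposition and EKR-sets\<close>

text \<open>The longest element of the Weyl group of type \<open>D\<^sub>n\<close>, as a permutation of the frame
  indices. For odd \<open>n\<close> it fixes \<open>n\<close> and \<open>-n\<close>.\<close>

definition longest_element :: "nat \<Rightarrow> int \<Rightarrow> int" where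
  "longest_element n i = (if odd n \<and> \<bar>i\<bar> = int n then i else - i)"

text \<open>The double coset of a Weyl group element is that of any group element inducing it on the
  frame.\<close>

definition opposite ::
    "nat \<Rightarrow> ('a::field^'d \<Rightarrow> 'a) \<Rightarrow> (int \<Rightarrow> ('a^'d) set) \<Rightarrow>
       ('a^'d) set set \<Rightarrow> ('a^'d) set set \<Rightarrow> bool" where
  "opposite n Q e F1 F2 \<longleftrightarrow>
     (\<exists>g\<in>type_preserving n Q. \<exists>h\<in>type_preserving n Q. \<exists>w\<in>type_preserving n Q.
        F1 = act_flag g (base_flag n e) \<and> F2 = act_flag h (base_flag n e) \<and>
        (\<forall>i\<in>frame_indices n. act w (e i) = e (longest_element n i)) \<and>
        double_coset n Q e (inv\<^bsub>PGO Q\<^esub> h \<otimes>\<^bsub>PGO Q\<^esub> g) = double_coset n Q e w)"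

definition EKR_set ::
    "nat \<Rightarrow> ('a::field^'d \<Rightarrow> 'a) \<Rightarrow> (int \<Rightarrow> ('a^'d) set) \<Rightarrow> ('a^'d) set set set \<Rightarrow> bool" where
  "EKR_set n Q e C \<longleftrightarrow>
     C \<subseteq> maximal_flags n Q \<and> pairwise (\<lambda>F1 F2. \<not> opposite n Q e F1 F2) C"

definition q_number :: "nat \<Rightarrow> nat \<Rightarrow> real" where
  "q_number q k = (real q ^ k - 1) / (real q - 1)"

end

theory Submission
  imports Defs
begin

text \<open>
  Maximal flags are, up to exchanging the two generators on an \<open>(n-1)\<close>-dimensional singular subspace,
  the chambers \<open>E\<^sub>1 < \<dots> < E\<^sub>n\<close> of the polar space.  The panel adjacencies \<open>T\<^sub>1, \<dots>, T\<^sub>n\<close> act on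
  functions on chambers as a Hecke algebra of type \<open>B\<^sub>n\<close> with parameters \<open>q, \<dots>, q, 1\<close>.  The operator
  \<open>w\<^sub>0 = (T\<^sub>1 \<cdots> T\<^sub>n)\<^sup>n\<close> only joins opposite chambers, has row sums \<open>q\<close> to the power \<open>n (n-1)\<close>, and is
  central by the braid relations.  Let \<open>E\<close> be an eigenspace of \<open>w\<^sub>0\<^sup>* w\<^sub>0\<close>, of dimension \<open>d\<close>, orthogonal to
  the functions fixed by the generators \<open>T\<^sub>1, \<dots>, T\<^bsub>n-1\<^esub>, T\<^sub>n T\<^bsub>n-1\<^esub> T\<^sub>n\<close> of type \<open>D\<^sub>n\<close>.  Braid
  relations force all of these to have \<open>q\<close>-eigenspaces of the same dimension \<open>k\<close> on \<open>E\<close>, and these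
  eigenspaces meet in \<open>0\<close>, so \<open>n (d - k) \<ge> d\<close>.  Comparing determinants on \<open>E\<close> bounds the eigenvalue by
  \<open>q\<close> to the power \<open>2 (n-1)\<^sup>2\<close>, and Hoffman's ratio argument gives the factor \<open>1 / (1 + q\<^bsup>n-1\<^esup>)\<close>.
\<close>

section \<open>Operators satisfying braid relations\<close>

text \<open>Working in type B_n with last parameter 1 removes the dependence on the parity of n: the
  longest element of B_n is always -1, the n-th power of a Coxeter element, while that of D_n is not
  central for odd n. The price is a second obstacle besides the constants: functions fixed by the
  D_n generators but negated by \<open>T n\<close>, such as the sign of the class of the top
  generator, on which \<open>w0\<close> is as large as on the constants. Hence \<open>V0\<close> is
  taken orthogonal to all of \<open>fixed\<close>; the chambers over a set of flags form a
  \<open>T n\<close>-invariant set, so its indicator minus its mean lies in \<open>V0\<close>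
  automatically. Determinants take the place of the representation theory of the Hecke algebra. On
  an eigenspace of dimension d the power mu^d is a product of determinants of generators:
  \<open>T n\<close> contributes only a sign, and each other generator has determinant q^k up to
  sign, so mu^d = q^(2(n-1)nk). The dimension inequality in the form nk <= (n-1)d turns this into
  the bound. The eigenvalue q^(n(n-1)) on constants exceeds q^((n-1)^2) by the factor q^(n-1) seen
  in the result.\<close>

lemma det_scaling_on_subspace:
  fixes L :: "real^'n \<Rightarrow> real^'n"
  assumes lin: "linear L" and S: "subspace S"
    and scale: "\<And>x. x \<in> S \<Longrightarrow> L x = a *\<^sub>R x"
    and fix_orth: "\<And>x. (\<And>y. y \<in> S \<Longrightarrow> orthogonal y x) \<Longrightarrow> L x = x"
  shows "det (matrix L) = a ^ dim S"
proof -
  define S' where "S' = {x. \<forall>y\<in>S. orthogonal y x}"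
  have S': "subspace S'" unfolding S'_def
    by (auto simp: subspace_def orthogonal_def inner_add_right)
  obtain B1 where B1: "B1 \<subseteq> S" "pairwise orthogonal B1" "\<And>x. x \<in> B1 \<Longrightarrow> norm x = 1"
      "independent B1" "card B1 = dim S"
    using orthonormal_basis_subspace[OF S] by metis
  obtain B2 where B2: "B2 \<subseteq> S'" "pairwise orthogonal B2" "\<And>x. x \<in> B2 \<Longrightarrow> norm x = 1"
      "independent B2" "card B2 = dim S'"
    using orthonormal_basis_subspace[OF S'] by metis
  have fin: "finite B1" "finite B2" using B1 B2 by (auto simp: independent_imp_finite)
  have orth12: "orthogonal x y" if "x \<in> B1" "y \<in> B2" for x y
    using that B1 B2 unfolding S'_def by auto
  have disj: "B1 \<inter> B2 = {}"
    using orth12 B1(3) by (force simp: orthogonal_self)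
  have "dim S' + dim S = CARD('n)"
    using dim_subspace_orthogonal_to_vectors[OF S subspace_UNIV] unfolding S'_def by simp
  then have "card (B1 \<union> B2) = CARD('n)"
    using disj fin B1 B2 by (simp add: card_Un_disjoint)
  then obtain f where f: "bij_betw f (UNIV :: 'n set) (B1 \<union> B2)"
    using fin by (metis finite_UnI finite_same_card_bij finite)
  have f_in: "f i \<in> B1 \<union> B2" for i using f by (auto simp: bij_betw_def)
  have f_inj: "f i = f j \<longleftrightarrow> i = j" for i j
    using f by (auto simp: bij_betw_def inj_on_def)
  have f_norm: "norm (f i) = 1" for i using f_in[of i] B1(3) B2(3) by auto
  have f_orth: "orthogonal (f i) (f j)" if "i \<noteq> j" for i j
    using f_in[of i] f_in[of j] B1(2) B2(2) orth12[of "f i" "f j"] orth12[of "f j" "f i"] that f_inj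
    by (auto simp: pairwise_def orthogonal_commute)
  \<comment> \<open>The columns of \<open>M\<close> are an orthonormal basis adapted to
    \<open>S\<close> and its complement; it diagonalises \<open>matrix L\<close>, with
    \<open>a\<close> on \<open>dim S\<close> of the diagonal places.\<close>
  define M where "M = (\<chi> i j. f j $ i)"
  have col: "column j M = f j" for j by (simp add: column_def M_def vec_eq_iff)
  have "orthogonal_matrix M"
    unfolding orthogonal_matrix_orthonormal_columns col using f_norm f_orth by auto
  then have nz: "det M \<noteq> 0" using det_orthogonal_matrix by fastforce
  define d where "d i = (if f i \<in> B1 then a else 1)" for i
  define D where "D = (\<chi> i j. if i = j then d i else 0)"
  have Lf: "L (f j) = d j *\<^sub>R f j" for j
  proof (cases "f j \<in> B1")
    case True then show ?thesis using B1(1) scale by (auto simp: d_def)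
  next
    case False
    then have "f j \<in> S'" using f_in[of j] B2(1) by auto
    then have "L (f j) = f j" unfolding S'_def by (intro fix_orth) auto
    then show ?thesis using False by (simp add: d_def)
  qed
  have "matrix L ** M = M ** D"
  proof -
    have "column j (matrix L ** M) = column j (M ** D)" for j
    proof -
      have "column j (matrix L ** M) = matrix L *v f j"
        by (simp add: matrix_matrix_mult_def column_def M_def matrix_vector_mult_def)
      also have "\<dots> = d j *\<^sub>R f j" using Lf lin by (simp add: matrix_works)
      also have "\<dots> = column j (M ** D)"
        by (simp add: matrix_matrix_mult_def column_def M_def D_def vec_eq_iff
            if_distrib[of "\<lambda>x. _ * x"] cong: if_cong)
      finally show ?thesis .
    qed
    then show ?thesis by (simp add: column_def vec_eq_iff)
  qed
  then have "det (matrix L) = det D" using nz by (metis det_mul mult.commute mult_cancel_left)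
  also have "\<dots> = (\<Prod>i\<in>UNIV. d i)" unfolding D_def by (subst det_diagonal) auto
  also have "\<dots> = (\<Prod>b\<in>B1 \<union> B2. if b \<in> B1 then a else 1)"
    unfolding d_def by (rule prod.reindex_bij_betw[OF f])
  also have "\<dots> = (\<Prod>b\<in>B1. a)"
    by (rule prod.mono_neutral_cong_right) (use fin disj in auto)
  also have "\<dots> = a ^ dim S" using B1 by simp
  finally show ?thesis .
qed

lemma foldr_commute:
  assumes "\<And>j x. j \<in> set xs \<Longrightarrow> S (T j x) = T j (S x)"
  shows "foldr T xs (S x) = S (foldr T xs x)"
  using assms by (induction xs) auto

section \<open>Braid relations of type B_n and the central element \<open>w0\<close>\<close>

locale braid_operators =
  fixes T :: "nat \<Rightarrow> 'v \<Rightarrow> 'v" and n :: nat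
  assumes n2: "n \<ge> 2"
    and inj_T: "\<And>i. 1 \<le> i \<Longrightarrow> i \<le> n \<Longrightarrow> inj (T i)"
    and comm: "\<And>i j x. 1 \<le> i \<Longrightarrow> i + 1 < j \<Longrightarrow> j \<le> n \<Longrightarrow> T i (T j x) = T j (T i x)"
    and braid3: "\<And>i x. 1 \<le> i \<Longrightarrow> i + 1 < n \<Longrightarrow>
        T i (T (i+1) (T i x)) = T (i+1) (T i (T (i+1) x))"
    and braid4: "\<And>x. T (n-1) (T n (T (n-1) (T n x))) = T n (T (n-1) (T n (T (n-1) x)))"
begin

definition cox :: "'v \<Rightarrow> 'v" where "cox = foldr T [1..<Suc n]"

lemma comm': "1 \<le> i \<Longrightarrow> 1 \<le> j \<Longrightarrow> i \<le> n \<Longrightarrow> j \<le> n \<Longrightarrow> i + 1 < j \<or> j + 1 < i \<Longrightarrow>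
    T i (T j x) = T j (T i x)"
  using comm by metis

text \<open>\<open>T i\<close> travels left through the factors with index above \<open>i+1\<close>,
  then \<open>braid3\<close> rewrites \<open>T i T (i+1) T i\<close>, and the resulting leading
  \<open>T (i+1)\<close> travels left through the factors with index below \<open>i\<close>.\<close>

lemma cox_shift:
  assumes i: "1 \<le> i" "i + 1 < n"
  shows "cox (T i x) = T (i+1) (cox x)"
proof -
  define xs ys where "xs = [1..<i]" and "ys = [i+2..<Suc n]"
  have split: "[1..<Suc n] = xs @ [i, i+1] @ ys"
    using i unfolding xs_def ys_def
    by (metis add.commute add_2_eq_Suc append_Cons append_Nil le_add1 less_imp_le
        One_nat_def Suc_eq_plus1 Suc_less_eq upt_conv_Cons less_Suc_eq_le upt_add_eq_append
        le_add_diff_inverse not_less_eq_eq less_SucI lessI Suc_leD)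
  have 1: "foldr T ys (T i x) = T i (foldr T ys x)"
    by (rule foldr_commute) (use i in \<open>auto simp: ys_def intro!: comm'\<close>)
  have 2: "foldr T xs (T (i+1) y) = T (i+1) (foldr T xs y)" for y
    by (rule foldr_commute) (use i in \<open>auto simp: xs_def intro!: comm'\<close>)
  have "cox (T i x) = foldr T xs (T i (T (i+1) (T i (foldr T ys x))))"
    unfolding cox_def split by (simp add: 1)
  also have "\<dots> = foldr T xs (T (i+1) (T i (T (i+1) (foldr T ys x))))"
    using braid3 i by simp
  also have "\<dots> = T (i+1) (cox x)"
    unfolding cox_def split using 2 by simp
  finally show ?thesis .
qed

lemma cox_foldr_shift: "1 \<le> a \<Longrightarrow> b < n \<Longrightarrow> cox (foldr T [a..<b] y) = foldr T [Suc a..<Suc b] (cox y)"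
proof (induction "b - a" arbitrary: a)
  case 0 then show ?case by simp
next
  case (Suc k)
  then have "[a..<b] = a # [Suc a..<b]" "[Suc a..<Suc b] = Suc a # [Suc (Suc a)..<Suc b]"
    by (auto simp: upt_conv_Cons)
  then show ?case using Suc cox_shift[of a] by simp
qed

lemma cox_split: "cox x = foldr T [1..<n] (T n x)" unfolding cox_def using n2 by simp

lemma split_last: "foldr T [1..<n] x = foldr T [1..<n-1] (T (n-1) x)"
proof -
  have "[1..<n] = [1..<n-1] @ [n-1]" using n2
    by (metis One_nat_def Suc_diff_Suc diff_Suc_1 less_eq_Suc_le one_add_one plus_1_eq_Suc upt_Suc_append
        diff_zero less_Suc_eq_le Suc_le_mono nat_less_le numeral_2_eq_2 Suc_pred zero_less_diff)
  then show ?thesis by simp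
qed

text \<open>\<open>cox_shift\<close> stops at \<open>T (n-1)\<close>, where the double bond
  intervenes. Shifting the prefix \<open>[1..<n-1]\<close> of the inner \<open>cox\<close> through
  the outer one gives \<open>[2..<n]\<close>; \<open>T 1\<close> completes this to
  \<open>[1..<n]\<close>, and \<open>braid4\<close> pulls out the \<open>T n\<close> that makes it a
  full \<open>cox\<close>.\<close>

lemma cox_square_last: "cox (cox (T (n-1) y)) = T 1 (cox (cox y))"
proof -
  let ?s = "T (n-1)" and ?t = "T n" and ?xs = "[1..<n-1]"
  have xs_t: "foldr T ?xs (?t z) = ?t (foldr T ?xs z)" for z
    by (rule foldr_commute) (auto intro!: comm')
  have 1: "cox z = foldr T ?xs (?s (?t z))" for z by (simp only: cox_split split_last)
  have "cox (cox y) = foldr T [Suc 1..<Suc (n-1)] (cox (?s (?t y)))"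
    unfolding 1[of y] by (rule cox_foldr_shift) (use n2 in auto)
  then have "T 1 (cox (cox y)) = foldr T [1..<n] (cox (?s (?t y)))"
    using n2 by (simp add: upt_conv_Cons)
  also have "cox (?s (?t y)) = ?t (cox (?s y))"
    by (simp only: 1 xs_t[symmetric] braid4)
  also have "foldr T [1..<n] (?t (cox (?s y))) = cox (cox (?s y))"
    by (simp only: cox_split)
  finally show ?thesis ..
qed

text \<open>Conjugation by the Coxeter element shifts \<open>T 1, \<dots>, T (n - 1)\<close> and its square takes \<open>T (n - 1)\<close>
  back to \<open>T 1\<close>; hence its \<open>n\<close>-th power is central.\<close>

definition w0 :: "'v \<Rightarrow> 'v" where "w0 = cox ^^ n"

lemma cox_pow_shift: "1 \<le> i \<Longrightarrow> i + k < n \<Longrightarrow> (cox ^^ k) (T i x) = T (i+k) ((cox ^^ k) x)"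
proof (induction k)
  case (Suc k)
  then show ?case using cox_shift[of "i+k"] by simp
qed simp

lemma w0_comm_less:
  assumes "1 \<le> i" "i < n"
  shows "w0 (T i x) = T i (w0 x)"
proof -
  \<comment> \<open>The factors \<open>cox\<close> are grouped so that the index travels from
    \<open>i\<close> up to \<open>n-1\<close>, by two factors back to \<open>1\<close>, and up to
    \<open>i\<close> again.\<close>
  have n: "n = (i - 1) + (2 + (n - 1 - i))" using assms by simp
  have e: "w0 y = (cox ^^ (i-1)) (cox (cox ((cox ^^ (n-1-i)) y)))" for y
    unfolding w0_def by (subst n, subst funpow_add, subst funpow_add) (simp add: numeral_2_eq_2)
  have "w0 (T i x) = (cox ^^ (i-1)) (cox (cox (T (i + (n-1-i)) ((cox ^^ (n-1-i)) x))))"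
    unfolding e using assms by (subst cox_pow_shift) auto
  also have "i + (n-1-i) = n - 1" using assms by simp
  also have "(cox ^^ (i-1)) (cox (cox (T (n-1) ((cox ^^ (n-1-i)) x)))) = T (1 + (i-1)) (w0 x)"
    unfolding e cox_square_last by (rule cox_pow_shift) (use assms in auto)
  finally show ?thesis using assms by simp
qed

lemma inj_foldr: "(\<And>i. i \<in> set xs \<Longrightarrow> 1 \<le> i \<and> i \<le> n) \<Longrightarrow> inj (foldr T xs)"
  by (induction xs) (auto intro!: inj_compose inj_T)

text \<open>The shifts never reach \<open>T n\<close>. But \<open>cox\<close> is \<open>?d\<close>
  followed by \<open>T n\<close> on the right; \<open>w0\<close> commutes with its root
  \<open>cox\<close> and with \<open>?d\<close>, and the injective \<open>?d\<close>
  cancels.\<close>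

lemma w0_comm:
  assumes "1 \<le> i" "i \<le> n"
  shows "w0 (T i x) = T i (w0 x)"
proof (cases "i < n")
  case True then show ?thesis using assms w0_comm_less by simp
next
  case False
  let ?d = "foldr T [1..<n]"
  have d: "w0 (?d y) = ?d (w0 y)" for y
    by (rule foldr_commute[symmetric]) (auto simp: w0_comm_less)
  have "?d (w0 (T n x)) = w0 (cox x)" by (simp only: d cox_split)
  also have "\<dots> = cox (w0 x)" unfolding w0_def by (simp add: funpow_swap1)
  also have "\<dots> = ?d (T n (w0 x))" by (simp add: cox_split)
  finally have "w0 (T n x) = T n (w0 x)"
    by (rule injD[OF inj_foldr, rotated]) auto
  then show ?thesis using False assms by simp
qed

end

section \<open>Hecke operators with one parameter equal to 1\<close>

text \<open>Codimensions inside \<open>E\<close> are subadditive under intersection. The statement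
  is over the integers because its left-hand side may be negative.\<close>

lemma dim_inter_lower_bound:
  fixes E :: "'v::euclidean_space set"
  assumes E: "subspace E" and fin: "finite I"
    and S: "\<And>i. i \<in> I \<Longrightarrow> subspace (S i) \<and> S i \<subseteq> E"
  shows "int (dim E) - (\<Sum>i\<in>I. int (dim E) - int (dim (S i))) \<le> int (dim (E \<inter> (\<Inter>i\<in>I. S i)))"
  using fin S
proof (induction I rule: finite_induct)
  case empty then show ?case by simp
next
  case (insert i I)
  let ?D = "E \<inter> (\<Inter>j\<in>I. S j)"
  have D: "subspace ?D" using E insert.prems
    by (intro subspace_inter subspace_Inter) auto
  have Si: "subspace (S i)" "S i \<subseteq> E" using insert.prems by auto
  have "dim {x + y |x y. x \<in> ?D \<and> y \<in> S i} + dim (?D \<inter> S i) = dim ?D + dim (S i)"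
    by (rule dim_sums_Int[OF D Si(1)])
  moreover have "dim {x + y |x y. x \<in> ?D \<and> y \<in> S i} \<le> dim E"
    by (rule dim_subset) (use Si E in \<open>auto intro: subspace_add\<close>)
  moreover have "?D \<inter> S i = E \<inter> (\<Inter>j\<in>insert i I. S j)" by auto
  ultimately show ?case using insert by simp
qed

locale hecke_operators =
  fixes T :: "nat \<Rightarrow> real^'x \<Rightarrow> real^'x" and n :: nat and q :: real
  assumes n2: "n \<ge> 2" and q1: "q > 1"
    and lin: "\<And>i. 1 \<le> i \<Longrightarrow> i \<le> n \<Longrightarrow> linear (T i)"
    and sym: "\<And>i x y. 1 \<le> i \<Longrightarrow> i \<le> n \<Longrightarrow> T i x \<bullet> y = x \<bullet> T i y"
    and quad: "\<And>i x. 1 \<le> i \<Longrightarrow> i < n \<Longrightarrow> T i (T i x) = (q - 1) *\<^sub>R T i x + q *\<^sub>R x"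
    and invol: "\<And>x. T n (T n x) = x"
    and comm: "\<And>i j x. 1 \<le> i \<Longrightarrow> i + 1 < j \<Longrightarrow> j \<le> n \<Longrightarrow> T i (T j x) = T j (T i x)"
    and braid3: "\<And>i x. 1 \<le> i \<Longrightarrow> i + 1 < n \<Longrightarrow>
        T i (T (i+1) (T i x)) = T (i+1) (T i (T (i+1) x))"
    and braid4: "\<And>x. T (n-1) (T n (T (n-1) (T n x))) = T n (T (n-1) (T n (T (n-1) x)))"
begin

sublocale braid_operators T n
proof
  fix i assume i: "1 \<le> i" "i \<le> n"
  show "inj (T i)"
  proof (cases "i = n")
    case True then show ?thesis by (metis injI invol)
  next
    case False
    show ?thesis unfolding linear_injective_0[OF lin[OF i]]
    proof (intro allI impI)
      fix x assume "T i x = 0"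
      then have "q *\<^sub>R x = 0" using quad[of i x] i False linear_0[OF lin[OF i]] by simp
      then show "x = 0" using q1 by simp
    qed
  qed
qed (use n2 comm braid3 braid4 in auto)

definition w0_adj :: "real^'x \<Rightarrow> real^'x" where
  "w0_adj = foldr T (rev [1..<Suc n]) ^^ n"

lemma linear_foldr: "set xs \<subseteq> {1..n} \<Longrightarrow> linear (foldr T xs)"
  by (induction xs) (auto intro!: linear_compose lin linear_id)

lemma foldr_adjoint: "set xs \<subseteq> {1..n} \<Longrightarrow> foldr T xs x \<bullet> y = x \<bullet> foldr T (rev xs) y"
  by (induction xs arbitrary: x y) (auto simp: sym)

lemma linear_funpow: "linear f \<Longrightarrow> linear (f ^^ k)" for f :: "real^'x \<Rightarrow> real^'x"
  by (induction k) (auto intro!: linear_compose linear_id simp: id_def[symmetric])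

lemma linear_w0: "linear w0"
  unfolding w0_def cox_def by (intro linear_funpow linear_foldr) auto

lemma linear_w0_adj: "linear w0_adj"
  unfolding w0_adj_def by (intro linear_funpow linear_foldr) auto

lemma w0_adjoint: "w0 x \<bullet> y = x \<bullet> w0_adj y"
proof -
  have "(cox ^^ k) x \<bullet> y = x \<bullet> (foldr T (rev [1..<Suc n]) ^^ k) y" for k
  proof (induction k arbitrary: x y)
    case (Suc k)
    have "(cox ^^ Suc k) x \<bullet> y = cox ((cox ^^ k) x) \<bullet> y" by simp
    also have "\<dots> = (cox ^^ k) x \<bullet> foldr T (rev [1..<Suc n]) y"
      unfolding cox_def by (rule foldr_adjoint) auto
    finally show ?case unfolding Suc by (simp add: funpow_swap1 del: upt_Suc)
  qed simp
  then show ?thesis unfolding w0_def w0_adj_def .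
qed

lemma w0_adj_comm:
  assumes "1 \<le> i" "i \<le> n"
  shows "w0_adj (T i x) = T i (w0_adj x)"
proof -
  have "y \<bullet> w0_adj (T i x) = y \<bullet> T i (w0_adj x)" for y
    using assms by (metis w0_adjoint sym w0_comm)
  then show ?thesis using vector_eq_ldot by blast
qed

definition eig :: "nat \<Rightarrow> real" where "eig i = (if i = n then 1 else q)"

text \<open>The generators of the subsystem of type \<open>D\<^sub>n\<close>.\<close>

definition gen :: "nat \<Rightarrow> real^'x \<Rightarrow> real^'x" where
  "gen i = (if i = n then T n \<circ> T (n-1) \<circ> T n else T i)"

text \<open>The part belonging to the index character of D_n. Here \<open>T n\<close> still acts as
  an involution, so \<open>w0\<close> acts as the \<open>n\<close>-th power of
  \<open>q^(n-1) T n\<close> and stretches every vector by \<open>q^(n(n-1))\<close>.\<close>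

definition fixed :: "(real^'x) set" where
  "fixed = {w. \<forall>i\<in>{1..n}. gen i w = q *\<^sub>R w}"

definition V0 :: "(real^'x) set" where
  "V0 = {g. \<forall>w\<in>fixed. g \<bullet> w = 0}"

lemma gen_linear: "1 \<le> i \<Longrightarrow> i \<le> n \<Longrightarrow> linear (gen i)"
  unfolding gen_def using n2 by (auto intro!: linear_compose lin)

lemma gen_sym: "1 \<le> i \<Longrightarrow> i \<le> n \<Longrightarrow> gen i x \<bullet> y = x \<bullet> gen i y"
  unfolding gen_def using n2 by (auto simp: sym)

lemma gen_quad: "1 \<le> i \<Longrightarrow> i \<le> n \<Longrightarrow> gen i (gen i x) = (q - 1) *\<^sub>R gen i x + q *\<^sub>R x"
  using n2 quad[of i] quad[of "n-1"] lin[of n]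
  by (auto simp: gen_def invol linear_add linear_cmul)

text \<open>Conjugation by \<open>T n\<close> is the diagram automorphism of D_n: it exchanges
  \<open>gen (n-1)\<close> and \<open>gen n\<close> and fixes the other generators.\<close>

lemma T_fixed:
  assumes i: "1 \<le> i" "i \<le> n" and w: "w \<in> fixed"
  shows "T i w \<in> fixed"
proof (cases "i = n")
  case False
  then have "T i w = q *\<^sub>R w" using w i unfolding fixed_def gen_def by force
  then show ?thesis using w gen_linear unfolding fixed_def by (auto simp: linear_cmul)
next
  case True
  have u: "T n (T (n-1) (T n w)) = q *\<^sub>R w"
    using w n2 unfolding fixed_def gen_def by (auto dest!: bspec[of _ _ n])
  have s: "T j w = q *\<^sub>R w" if "1 \<le> j" "j < n" for j
    using w that unfolding fixed_def gen_def by (auto dest!: bspec[of _ _ j])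
  have ln: "linear (T n)" using lin n2 by auto
  have "gen j (T n w) = q *\<^sub>R T n w" if j: "1 \<le> j" "j \<le> n" for j
  proof -
    consider "j = n" | "j = n - 1" "j \<noteq> n" | "j + 1 < n" using j by linarith
    then show ?thesis
    proof cases
      case 1 then show ?thesis using s[of "n-1"] n2 ln by (simp add: gen_def invol linear_cmul)
    next
      case 2 then show ?thesis using u ln by (metis gen_def invol linear_cmul)
    next
      case 3 then show ?thesis using s[of j] j comm[of j n] ln by (simp add: gen_def linear_cmul)
    qed
  qed
  then show ?thesis using True unfolding fixed_def by auto
qed

lemma T_V0: "1 \<le> i \<Longrightarrow> i \<le> n \<Longrightarrow> g \<in> V0 \<Longrightarrow> T i g \<in> V0"
  unfolding V0_def using T_fixed sym by auto

lemma foldr_invariant: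
  assumes "\<And>i x. 1 \<le> i \<Longrightarrow> i \<le> n \<Longrightarrow> x \<in> S \<Longrightarrow> T i x \<in> S" "set xs \<subseteq> {1..n}" "x \<in> S"
  shows "foldr T xs x \<in> S"
  using assms(2,3) by (induction xs) (auto intro: assms(1))

lemma funpow_invariant: "(\<And>x. x \<in> S \<Longrightarrow> f x \<in> S) \<Longrightarrow> x \<in> S \<Longrightarrow> (f ^^ k) x \<in> S"
  by (induction k) auto

lemma w0_invariant:
  assumes "\<And>i x. 1 \<le> i \<Longrightarrow> i \<le> n \<Longrightarrow> x \<in> S \<Longrightarrow> T i x \<in> S" "x \<in> S"
  shows "w0 x \<in> S" "w0_adj x \<in> S"
proof -
  show "w0 x \<in> S" unfolding w0_def cox_def
    by (intro funpow_invariant foldr_invariant) (use assms in auto)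
  show "w0_adj x \<in> S" unfolding w0_adj_def
    by (intro funpow_invariant foldr_invariant) (use assms in auto)
qed

lemma subspace_V0: "subspace V0"
  unfolding V0_def subspace_def by (auto simp: inner_add_left)

abbreviation sq :: "real^'x \<Rightarrow> real^'x" where "sq x \<equiv> w0_adj (w0 x)"

lemma sq_inner: "sq x \<bullet> y = w0 x \<bullet> w0 y"
  using w0_adjoint[of y "w0 x"] by (simp add: inner_commute)

text \<open>A maximiser of \<open>norm (w0 x)\<close> on the unit sphere of \<open>V0\<close> exists
  by compactness; the residue \<open>r\<close> of the eigenvalue equation is the gradient
  there.\<close>

lemma top_eigenvalue:
  assumes "V0 \<noteq> {0}"
  obtains \<mu> g where "g \<in> V0" "g \<noteq> 0" "sq g = \<mu> *\<^sub>R g" "\<mu> \<ge> 0"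
    "\<And>x. x \<in> V0 \<Longrightarrow> (norm (w0 x))\<^sup>2 \<le> \<mu> * (norm x)\<^sup>2"
proof -
  let ?S = "V0 \<inter> sphere 0 1"
  have "compact ?S" using closed_subspace[OF subspace_V0] by (simp add: closed_Int_compact)
  moreover have "?S \<noteq> {}"
  proof -
    obtain x where "x \<in> V0" "x \<noteq> 0" using assms subspace_0[OF subspace_V0] by auto
    then have "(1 / norm x) *\<^sub>R x \<in> ?S" using subspace_V0 by (auto simp: subspace_scale)
    then show ?thesis by blast
  qed
  moreover have "continuous_on ?S (\<lambda>x. (norm (w0 x))\<^sup>2)"
    by (intro continuous_intros linear_continuous_on_compose[OF _ linear_w0])
  ultimately obtain g where g: "g \<in> ?S" and max: "\<forall>x\<in>?S. (norm (w0 x))\<^sup>2 \<le> (norm (w0 g))\<^sup>2"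
    using continuous_attains_sup by blast
  define \<mu> where "\<mu> = (norm (w0 g))\<^sup>2"
  have bound: "(norm (w0 x))\<^sup>2 \<le> \<mu> * (norm x)\<^sup>2" if "x \<in> V0" for x
  proof (cases "x = 0")
    case True then show ?thesis using linear_0[OF linear_w0] by simp
  next
    case False
    then have "(1 / norm x) *\<^sub>R x \<in> ?S" using that subspace_V0 by (auto simp: subspace_scale)
    then have "(norm (w0 ((1 / norm x) *\<^sub>R x)))\<^sup>2 \<le> \<mu>" using max unfolding \<mu>_def by blast
    then show ?thesis using False
      by (simp add: linear_cmul[OF linear_w0] power_mult_distrib power_divide field_simps)
  qed
  define r where "r = \<mu> *\<^sub>R g - sq g"
  have gV: "g \<in> V0" and g1: "norm g = 1" using g by auto
  have rV: "r \<in> V0" unfolding r_def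
    using subspace_V0 gV w0_invariant[of V0] T_V0 by (auto intro!: subspace_diff subspace_scale)
  \<comment> \<open>The nonnegative quadratic form \<open>\<mu> |x|\<^sup>2 - |w0 x|\<^sup>2\<close> on \<open>V0\<close> vanishes at \<open>g\<close>, so its gradient does.\<close>
  have "r \<bullet> r = 0"
  proof (rule ccontr)
    assume nz: "r \<bullet> r \<noteq> 0"
    define K where "K = \<mu> * (r \<bullet> r) - w0 r \<bullet> w0 r"
    have key: "0 \<le> - 2 * t * (r \<bullet> r) + t\<^sup>2 * K" for t
    proof -
      have "g - t *\<^sub>R r \<in> V0" using gV rV subspace_V0 by (auto intro!: subspace_diff subspace_scale)
      from bound[OF this] have "w0 (g - t *\<^sub>R r) \<bullet> w0 (g - t *\<^sub>R r) \<le> \<mu> * ((g - t *\<^sub>R r) \<bullet> (g - t *\<^sub>R r))"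
        by (simp add: power2_norm_eq_inner)
      moreover have "w0 (g - t *\<^sub>R r) = w0 g - t *\<^sub>R w0 r"
        by (simp add: linear_diff[OF linear_w0] linear_cmul[OF linear_w0])
      moreover have "w0 g \<bullet> w0 g = \<mu>" by (simp add: \<mu>_def power2_norm_eq_inner)
      moreover have "g \<bullet> g = 1" using g1 by (simp add: norm_eq_1)
      moreover have "w0 g \<bullet> w0 r = \<mu> * (g \<bullet> r) - r \<bullet> r"
        unfolding sq_inner[symmetric] by (simp add: r_def inner_diff_left)
      ultimately show ?thesis
        by (simp add: K_def inner_diff_left inner_diff_right inner_commute algebra_simps power2_eq_square)
    qed
    have rr: "r \<bullet> r > 0" using nz by (metis inner_ge_zero less_eq_real_def)
    \<comment> \<open>So small that \<open>t * K\<close> is at most \<open>r \<bullet> r\<close> and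
      cannot make up for the linear term \<open>- 2 * (r \<bullet> r)\<close>.\<close>
    define t where "t = (r \<bullet> r) / (\<bar>K\<bar> + 1)"
    have t: "t > 0" using rr by (simp add: t_def)
    have "0 \<le> t * (t * K - 2 * (r \<bullet> r))" using key[of t] by (simp add: algebra_simps power2_eq_square)
    then have "2 * (r \<bullet> r) \<le> t * K" using t by (simp add: zero_le_mult_iff)
    also have "\<dots> \<le> t * (\<bar>K\<bar> + 1)" using t by (intro mult_left_mono) auto
    also have "\<dots> = r \<bullet> r" by (simp add: t_def)
    finally show False using rr by simp
  qed
  then have "sq g = \<mu> *\<^sub>R g" by (simp add: r_def)
  moreover have "g \<noteq> 0" using g1 by auto
  ultimately show ?thesis using that[of g \<mu>] gV bound by (simp add: \<mu>_def)
qed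

end

lemma orthogonal_projection_exists:
  fixes E :: "(real^'x) set"
  assumes "subspace E"
  obtains P where "linear P" "\<And>x. P x \<in> E" "\<And>x y. y \<in> E \<Longrightarrow> (x - P x) \<bullet> y = 0"
proof -
  obtain B where B: "B \<subseteq> E" "pairwise orthogonal B" "\<And>x. x \<in> B \<Longrightarrow> norm x = 1"
      "independent B" "span B = E"
    using orthonormal_basis_subspace[OF assms] by metis
  have fin: "finite B" using B(4) by (rule independent_imp_finite)
  define P where "P x = (\<Sum>b\<in>B. (x \<bullet> b) *\<^sub>R b)" for x
  have 1: "linear P" unfolding P_def
    by (rule linearI) (auto simp: inner_add_left scaleR_add_left sum.distrib scaleR_sum_right)
  have 2: "P x \<in> E" for x
    unfolding P_def using B(1) assms by (auto intro!: subspace_sum subspace_scale)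
  have 3: "(x - P x) \<bullet> y = 0" if "y \<in> E" for x y
  proof -
    have "B \<subseteq> {y. (x - P x) \<bullet> y = 0}"
    proof
      fix c assume c: "c \<in> B"
      have "P x \<bullet> c = (\<Sum>b\<in>B. (x \<bullet> b) * (b \<bullet> c))" by (simp add: P_def inner_sum_left)
      also have "\<dots> = (\<Sum>b\<in>B. if b = c then x \<bullet> c else 0)"
        using B(2,3) c by (intro sum.cong) (auto simp: pairwise_def orthogonal_def norm_eq_1)
      also have "\<dots> = x \<bullet> c" using c fin by simp
      finally show "c \<in> {y. (x - P x) \<bullet> y = 0}" by (simp add: inner_diff_left)
    qed
    then have "span B \<subseteq> {y. (x - P x) \<bullet> y = 0}"
      by (rule span_minimal) (auto simp: subspace_def inner_add_right)
    then show ?thesis using that B(5) by auto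
  qed
  show ?thesis using that 1 2 3 by blast
qed

section \<open>The eigenvalue bound by determinants\<close>

context hecke_operators
begin

text \<open>The determinant of \<open>sq\<close> on \<open>E\<close> is \<open>\<mu> ^ d\<close>.
  Written out it has \<open>2 * n\<close> Coxeter factors, each of determinant
  \<open>\<delta> ^ (n-1)\<close> times the sign \<open>D (T n)\<close>, where
  \<open>\<delta>\<^sup>2 = q ^ (2 * k)\<close>; then \<open>n * k \<le> (n-1) * d\<close> bounds
  \<open>\<mu>\<close>.\<close>

lemma eigenvalue_bound:
  assumes E: "subspace E" "E \<noteq> {0}" "E \<subseteq> V0"
    and inv: "\<And>i x. 1 \<le> i \<Longrightarrow> i \<le> n \<Longrightarrow> x \<in> E \<Longrightarrow> T i x \<in> E"
    and eigen: "\<And>x. x \<in> E \<Longrightarrow> sq x = \<mu> *\<^sub>R x" and \<mu>: "\<mu> \<ge> 0"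
  shows "\<mu> \<le> q ^ (2 * (n-1)\<^sup>2)"
proof -
  obtain P where P: "linear P" "\<And>x. P x \<in> E" "\<And>x y. y \<in> E \<Longrightarrow> (x - P x) \<bullet> y = 0"
    using orthogonal_projection_exists[OF E(1)] by metis
  have P_E: "P x = x" if "x \<in> E" for x
  proof -
    have "(x - P x) \<bullet> (x - P x) = 0" using that P(2) E(1) by (intro P(3)) (auto intro: subspace_diff)
    then show ?thesis by simp
  qed
  \<comment> \<open>Operators preserving \<open>E\<close> are restricted to \<open>E\<close> and extended by the identity on its complement,
    so that their determinants on \<open>E\<close> are available as matrix determinants.\<close>
  define L where "L S x = S (P x) + (x - P x)" for S :: "real^'x \<Rightarrow> real^'x" and x
  define D where "D S = det (matrix (L S))" for S
  have L_lin: "linear (L S)" if "linear S" for S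
    unfolding L_def using that P(1) linear_compose[OF P(1) that]
    by (auto intro!: linear_compose_add linear_compose_sub linear_ident simp: o_def)
  have L_comp: "L (S1 \<circ> S2) = L S1 \<circ> L S2" if "\<And>x. x \<in> E \<Longrightarrow> S2 x \<in> E" for S1 S2
  proof
    fix x
    have "P (S2 (P x) + (x - P x)) = S2 (P x)"
      using that P(2) P_E by (simp add: linear_add[OF P(1)] linear_diff[OF P(1)])
    then show "L (S1 \<circ> S2) x = (L S1 \<circ> L S2) x" by (simp add: L_def)
  qed
  have D_comp: "D (S1 \<circ> S2) = D S1 * D S2"
    if "linear S1" "linear S2" "\<And>x. x \<in> E \<Longrightarrow> S2 x \<in> E" for S1 S2
  proof -
    have "L (S1 \<circ> S2) = L S1 \<circ> L S2" by (rule L_comp) (fact that(3))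
    then show ?thesis
      unfolding D_def using L_lin that(1,2) by (simp add: matrix_compose det_mul)
  qed
  have D_id: "D (\<lambda>x. x) = 1"
  proof -
    have "L (\<lambda>x. x) = id" by (auto simp: L_def)
    then show ?thesis by (simp add: D_def matrix_id)
  qed
  have D_foldr: "D (foldr T xs) = (\<Prod>i\<leftarrow>xs. D (T i))" if "set xs \<subseteq> {1..n}" for xs
    using that
  proof (induction xs)
    case Nil then show ?case using D_id by (simp add: id_def)
  next
    case (Cons i xs)
    have "D (foldr T (i # xs)) = D (T i \<circ> foldr T xs)" by (simp add: o_def)
    also have "\<dots> = D (T i) * D (foldr T xs)"
      using Cons.prems by (intro D_comp lin linear_foldr foldr_invariant inv) auto
    finally show ?case using Cons by (simp add: o_def)
  qed
  have D_pow: "D (f ^^ k) = D f ^ k" if "linear f" "\<And>x. x \<in> E \<Longrightarrow> f x \<in> E" for f k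
  proof (induction k)
    case 0 then show ?case using D_id by (simp add: id_def)
  next
    case (Suc k)
    have "D (f \<circ> f ^^ k) = D f * D (f ^^ k)"
      using that by (intro D_comp linear_funpow funpow_invariant) auto
    then show ?case using Suc by (simp add: o_def)
  qed
  define K where "K i = {x\<in>E. gen i x = q *\<^sub>R x}" for i
  have gen_E: "gen i x \<in> E" if "1 \<le> i" "i \<le> n" "x \<in> E" for i x
    using that inv n2 by (auto simp: gen_def)
  have K: "subspace (K i)" if "1 \<le> i" "i \<le> n" for i
    using gen_linear[OF that] E(1) unfolding K_def subspace_def
    by (auto simp: linear_0 linear_add linear_cmul scaleR_add_right)
  \<comment> \<open>On \<open>E\<close> the eigenvalues of \<open>gen i\<close> are \<open>q\<close>
    and \<open>-1\<close>, so its determinant is \<open>q ^ dim (K i)\<close> up to sign. The square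
    loses the sign and is a scalar on \<open>K i\<close> and the identity on the complement.\<close>
  have gen_det: "(D (gen i))\<^sup>2 = q ^ (2 * dim (K i))" if i: "1 \<le> i" "i \<le> n" for i
  proof -
    note gl = gen_linear[OF i]
    have "(D (gen i))\<^sup>2 = D (gen i \<circ> gen i)"
      using D_comp[of "gen i" "gen i"] gl gen_E i by (simp add: power2_eq_square)
    also have "\<dots> = (q\<^sup>2) ^ dim (K i)"
      unfolding D_def
    proof (rule det_scaling_on_subspace[OF _ K[OF i]])
      show "linear (L (gen i \<circ> gen i))" by (intro L_lin linear_compose gl)
    next
      fix x assume "x \<in> K i"
      then show "L (gen i \<circ> gen i) x = q\<^sup>2 *\<^sub>R x"
        using P_E by (auto simp: L_def K_def linear_cmul[OF gl] power2_eq_square)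
    next
      fix x assume orth: "\<And>y. y \<in> K i \<Longrightarrow> orthogonal y x"
      \<comment> \<open>The quadratic relation makes \<open>gen i + 1\<close> map into the
        \<open>q\<close>-eigenspace. Since \<open>P x\<close> is orthogonal to \<open>K i\<close>
        and \<open>gen i\<close> is symmetric, \<open>?y\<close> is orthogonal to itself, so
        \<open>gen i\<close> negates \<open>P x\<close>.\<close>
      let ?y = "gen i (P x) + P x"
      have gy: "gen i ?y = q *\<^sub>R ?y"
        by (simp add: linear_add[OF gl] gen_quad[OF i] algebra_simps)
      have yE: "?y \<in> E" using P(2) gen_E i E(1) by (auto intro: subspace_add)
      have "?y \<in> K i" using gy yE by (simp add: K_def)
      then have "x \<bullet> ?y = 0" using orth unfolding orthogonal_def by (metis inner_commute)
      then have Py: "P x \<bullet> ?y = 0" using P(3)[OF yE, of x] by (simp add: inner_diff_left)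
      have "?y \<bullet> ?y = P x \<bullet> gen i ?y + P x \<bullet> ?y"
        by (simp only: inner_add_left gen_sym[OF i])
      then have "?y \<bullet> ?y = 0" using Py gy by simp
      then have y0: "gen i (P x) = - P x" by (simp add: eq_neg_iff_add_eq_0)
      then have "gen i (gen i (P x)) = P x" by (simp add: linear_neg[OF gl])
      then show "L (gen i \<circ> gen i) x = x" by (simp add: L_def)
    qed
    finally show ?thesis by (simp add: power_mult)
  qed
  have gen_less: "gen i = T i" if "i < n" for i using that by (simp add: gen_def)
  have nz: "D (gen i) \<noteq> 0" if "1 \<le> i" "i \<le> n" for i using gen_det[OF that] q1 by auto
  have Tn: "D (T n) * D (T n) = 1"
  proof -
    have "T n \<circ> T n = (\<lambda>x. x)" using invol by auto
    then show ?thesis using D_comp[of "T n" "T n"] lin inv n2 D_id by simp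
  qed
  define \<delta> where "\<delta> = D (T 1)"
  have T\<delta>: "D (T (Suc i)) = \<delta>" if "Suc i < n" for i
    using that
  proof (induction i)
    case 0 then show ?case by (simp add: \<delta>_def)
  next
    case (Suc i)
    let ?a = "Suc i" and ?b = "Suc (Suc i)"
    have c3: "D (T a \<circ> T b \<circ> T a) = D (T a) * D (T b) * D (T a)" if "1 \<le> a" "1 \<le> b" "a \<le> n" "b \<le> n" for a b
      using that by (simp add: D_comp lin inv linear_compose)
    have "T ?a \<circ> T ?b \<circ> T ?a = T ?b \<circ> T ?a \<circ> T ?b"
      using braid3[of ?a] Suc.prems by (auto simp: o_def)
    then have "D (T ?a \<circ> T ?b \<circ> T ?a) = D (T ?b \<circ> T ?a \<circ> T ?b)" by (rule arg_cong)
    moreover have "D (T ?a \<circ> T ?b \<circ> T ?a) = D (T ?a) * D (T ?b) * D (T ?a)"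
      by (rule c3) (use Suc.prems in auto)
    moreover have "D (T ?b \<circ> T ?a \<circ> T ?b) = D (T ?b) * D (T ?a) * D (T ?b)"
      by (rule c3) (use Suc.prems in auto)
    ultimately have "D (T ?a) * D (T ?b) * D (T ?a) = D (T ?b) * D (T ?a) * D (T ?b)" by argo
    \<comment> \<open>Determinants commute, so \<open>a b a = b a b\<close> with nonzero factors
      gives \<open>a = b\<close>.\<close>
    then have "D (T ?a) = D (T ?b)"
      using nz[of ?a] nz[of ?b] Suc.prems by (simp add: gen_less)
    then show ?case using Suc by simp
  qed
  have g\<delta>: "D (gen i) = \<delta>" if "1 \<le> i" "i \<le> n" for i
  proof (cases "i = n")
    case False then show ?thesis using that T\<delta>[of "i - 1"] by (simp add: gen_less)
  next
    case True
    \<comment> \<open>\<open>gen n\<close> is \<open>T (n-1)\<close> conjugated by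
      \<open>T n\<close>, so its eigenspace is as large as those of the other generators.\<close>
    have "D (gen n) = D (T n) * D (T (n-1)) * D (T n)"
      using n2 by (simp add: gen_def D_comp lin inv linear_compose)
    then have "D (gen n) = D (T (n-1))" using Tn by simp
    then show ?thesis using True T\<delta>[of "n - 2"] n2 by (simp add: numeral_2_eq_2 Suc_diff_Suc)
  qed
  define k where "k = dim (K 1)"
  have \<delta>k: "\<delta>\<^sup>2 = q ^ (2 * k)" using gen_det[of 1] g\<delta>[of 1] n2 by (simp add: k_def)
  have dimK: "dim (K i) = k" if "1 \<le> i" "i \<le> n" for i
    using gen_det[OF that] g\<delta>[OF that] \<delta>k q1 by simp
  define d where "d = dim E"
  have "\<not> E \<subseteq> {0}" using E subspace_0 by blast
  then have d0: "d > 0" unfolding d_def by (metis gr0I dim_eq_0)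
  have "int (dim E) - (\<Sum>i\<in>{1..n}. int (dim E) - int (dim (K i))) \<le> int (dim (E \<inter> (\<Inter>i\<in>{1..n}. K i)))"
    by (rule dim_inter_lower_bound) (use E K in \<open>auto simp: K_def\<close>)
  \<comment> \<open>A vector common to all \<open>K i\<close> lies both in \<open>fixed\<close> and
    in \<open>V0\<close>, hence is orthogonal to itself.\<close>
  also have "E \<inter> (\<Inter>i\<in>{1..n}. K i) = {0}"
  proof
    show "E \<inter> (\<Inter>i\<in>{1..n}. K i) \<subseteq> {0}"
    proof
      fix x assume x: "x \<in> E \<inter> (\<Inter>i\<in>{1..n}. K i)"
      then have "x \<in> fixed" by (auto simp: K_def fixed_def)
      moreover have "x \<in> V0" using x E(3) by blast
      ultimately have "x \<bullet> x = 0" unfolding V0_def by blast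
      then show "x \<in> {0}" by simp
    qed
  qed (use E(1) K n2 in \<open>auto simp: subspace_0\<close>)
  finally have "int d - int n * (int d - int k) \<le> 0" using dimK by (simp add: d_def)
  then have "int (n * k) \<le> int ((n - 1) * d)" using n2 by (simp add: algebra_simps of_nat_diff)
  then have nk: "n * k \<le> (n - 1) * d" by linarith
  have T_\<delta>: "D (T i) = \<delta>" if "1 \<le> i" "i < n" for i
    using g\<delta>[of i] gen_less[of i] that by simp
  have pT: "(\<Prod>i\<leftarrow>[1..<Suc n]. D (T i)) = \<delta> ^ (n - 1) * D (T n)"
  proof -
    have "(\<Prod>i\<leftarrow>[1..<n]. D (T i)) = (\<Prod>i\<leftarrow>[1..<n]. \<delta>)"
      by (rule arg_cong[where f=prod_list], rule map_cong) (use T_\<delta> in auto)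
    then show ?thesis using n2 by (simp add: prod_list_replicate map_replicate_const)
  qed
  have Dcox: "D (foldr T [1..<Suc n]) = \<delta> ^ (n - 1) * D (T n)"
  proof -
    have "set [1..<Suc n] \<subseteq> {1..n}" by auto
    from D_foldr[OF this] show ?thesis unfolding pT .
  qed
  have Dcox': "D (foldr T (rev [1..<Suc n])) = \<delta> ^ (n - 1) * D (T n)"
  proof -
    have "set (rev [1..<Suc n]) \<subseteq> {1..n}" by auto
    from D_foldr[OF this] show ?thesis unfolding rev_map[symmetric] prod_list.rev pT .
  qed
  have "D (w0_adj \<circ> w0) = D w0_adj * D w0"
    using linear_w0 linear_w0_adj w0_invariant[of E] inv by (intro D_comp) auto
  also have "\<dots> = ((\<delta> ^ (n - 1) * D (T n)) ^ n)\<^sup>2"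
    unfolding w0_def w0_adj_def cox_def power2_eq_square Dcox[symmetric]
    by (subst (1 2) D_pow) (use Dcox Dcox' in \<open>auto intro!: linear_foldr foldr_invariant inv simp del: upt_Suc\<close>)
  also have "\<dots> = ((\<delta> ^ (n - 1))\<^sup>2 * (D (T n) * D (T n))) ^ n"
    by (simp add: power2_eq_square power_mult_distrib algebra_simps)
  also have "\<dots> = (\<delta>\<^sup>2) ^ ((n - 1) * n)"
    by (simp add: Tn power_mult[symmetric] ac_simps)
  also have "\<dots> = q ^ (2 * (n - 1) * (n * k))"
    unfolding \<delta>k by (simp add: power_mult[symmetric] ac_simps)
  finally have 1: "D (w0_adj \<circ> w0) = q ^ (2 * (n - 1) * (n * k))" .
  have 2: "D (w0_adj \<circ> w0) = \<mu> ^ d"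
    unfolding D_def d_def
  proof (rule det_scaling_on_subspace[OF _ E(1)])
    show "linear (L (w0_adj \<circ> w0))" by (intro L_lin linear_compose linear_w0 linear_w0_adj)
  next
    fix x assume "x \<in> E"
    then show "L (w0_adj \<circ> w0) x = \<mu> *\<^sub>R x" using P_E eigen by (simp add: L_def)
  next
    fix x assume orth: "\<And>y. y \<in> E \<Longrightarrow> orthogonal y x"
    then have "x \<bullet> P x = 0" using P(2) unfolding orthogonal_def by (metis inner_commute)
    then have "P x \<bullet> P x = 0" using P(3)[OF P(2), of x x] by (simp add: inner_diff_left)
    then have "P x = 0" by simp
    then show "L (w0_adj \<circ> w0) x = x"
      using linear_0[OF linear_w0] linear_0[OF linear_w0_adj] by (simp add: L_def)
  qed
  show ?thesis
  proof (rule ccontr)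
    assume "\<not> ?thesis"
    then have "(q ^ (2 * (n-1)\<^sup>2)) ^ d < \<mu> ^ d" using d0 q1 by (intro power_strict_mono) auto
    also have "\<dots> = q ^ (2 * (n - 1) * (n * k))" using 1 2 by simp
    also have "\<dots> \<le> q ^ (2 * (n - 1) * ((n - 1) * d))"
      using q1 nk by (intro power_increasing mult_left_mono) auto
    also have "\<dots> = (q ^ (2 * (n-1)\<^sup>2)) ^ d"
      by (simp add: power_mult[symmetric] power2_eq_square ac_simps)
    finally show False by simp
  qed
qed

text \<open>\<open>E\<close> is the full eigenspace of \<open>sq\<close> in \<open>V0\<close> for
  its largest eigenvalue; centrality of \<open>w0\<close>, inherited by its adjoint, makes it
  invariant under every \<open>T i\<close>.\<close>

theorem w0_norm_bound:
  assumes "g \<in> V0"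
  shows "norm (w0 g) \<le> q ^ ((n-1)\<^sup>2) * norm g"
proof (cases "V0 = {0}")
  case True then show ?thesis using assms linear_0[OF linear_w0] by simp
next
  case False
  then obtain \<mu> h where h: "h \<in> V0" "h \<noteq> 0" "sq h = \<mu> *\<^sub>R h" "\<mu> \<ge> 0"
    and bound: "\<And>x. x \<in> V0 \<Longrightarrow> (norm (w0 x))\<^sup>2 \<le> \<mu> * (norm x)\<^sup>2"
    using top_eigenvalue by metis
  define E where "E = {x\<in>V0. sq x = \<mu> *\<^sub>R x}"
  have "\<mu> \<le> q ^ (2 * (n-1)\<^sup>2)"
  proof (rule eigenvalue_bound)
    show "subspace E" using subspace_V0 linear_w0 linear_w0_adj unfolding E_def subspace_def
      by (auto simp: linear_0 linear_add linear_cmul scaleR_add_right)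
    show "E \<noteq> {0}" using h by (auto simp: E_def)
    fix i x assume "1 \<le> i" "i \<le> n" "x \<in> E"
    then show "T i x \<in> E" using T_V0 lin unfolding E_def
      by (auto simp: w0_comm w0_adj_comm linear_cmul)
  qed (use h in \<open>auto simp: E_def\<close>)
  then have "(norm (w0 g))\<^sup>2 \<le> q ^ (2 * (n-1)\<^sup>2) * (norm g)\<^sup>2"
    using bound[OF assms] by (meson mult_right_mono order_trans zero_le_power2)
  also have "\<dots> = (q ^ ((n-1)\<^sup>2) * norm g)\<^sup>2"
    by (simp add: power_mult_distrib power_mult[symmetric] mult.commute)
  finally show ?thesis using q1 by (simp add: power2_le_iff_abs_le)
qed

text \<open>A vector fixed by \<open>T n\<close> has the same inner product with \<open>w\<close>
  and with \<open>T n w\<close>, so it suffices to test the symmetrised \<open>w + T n w\<close>,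
  which is an eigenvector of every \<open>T i\<close>. On chambers such vectors turn out to be
  constant.\<close>

lemma V0_I:
  assumes g: "T n g = g" and orth: "\<And>w. (\<And>i. 1 \<le> i \<Longrightarrow> i \<le> n \<Longrightarrow> T i w = eig i *\<^sub>R w) \<Longrightarrow> g \<bullet> w = 0"
  shows "g \<in> V0"
  unfolding V0_def
proof (intro CollectI ballI)
  fix w assume w: "w \<in> fixed"
  have Tw: "T n w \<in> fixed" using T_fixed w n2 by simp
  have *: "T i v = q *\<^sub>R v" if "v \<in> fixed" "1 \<le> i" "i < n" for i v
    using that unfolding fixed_def gen_def by (auto dest!: bspec[of _ _ i])
  have "g \<bullet> (w + T n w) = 0"
  proof (rule orth)
    fix i assume i: "1 \<le> i" "i \<le> n"
    show "T i (w + T n w) = eig i *\<^sub>R (w + T n w)"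
      using * w Tw i by (cases "i = n") (auto simp: eig_def linear_add[OF lin] invol scaleR_add_right)
  qed
  moreover have "g \<bullet> T n w = g \<bullet> w" using sym[of n g w] g n2 by simp
  ultimately show "g \<bullet> w = 0" by (simp add: inner_add_right)
qed

end

section \<open>Quadrics over finite fields\<close>

lemma card_eq_sum_fibres:
  assumes "finite A"
  shows "card A = (\<Sum>y\<in>f ` A. card {x\<in>A. f x = y})"
  using sum.image_gen[OF assms, of "\<lambda>_. 1::nat" f] by simp

lemma card_subspace:
  fixes U :: "('a::{field,finite}^'d) set"
  assumes "vec.subspace U"
  shows "card U = CARD('a) ^ vec.dim U"
proof -
  have *: "card (vec.span B) = CARD('a) ^ card B" if "vec.independent B" for B :: "('a^'d) set"
  proof -
    have "finite B" using that by (rule vec.finiteI_independent)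
    then show ?thesis using that
    proof (induction B rule: finite_induct)
      case empty then show ?case by simp
    next
      case (insert b B)
      have ind: "vec.independent B" "b \<notin> vec.span B"
        using insert.hyps(2) insert.prems vec.independent_insert[of b B] by auto
      let ?f = "\<lambda>(c, x). c *s b + x"
      have "vec.span (insert b B) = ?f ` (UNIV \<times> vec.span B)"
      proof
        show "vec.span (insert b B) \<subseteq> ?f ` (UNIV \<times> vec.span B)"
        proof
          fix x assume "x \<in> vec.span (insert b B)"
          then obtain k where "x - k *s b \<in> vec.span B" unfolding vec.span_insert by auto
          then show "x \<in> ?f ` (UNIV \<times> vec.span B)"
            by (intro image_eqI[of _ _ "(k, x - k *s b)"]) auto
        qed
        show "?f ` (UNIV \<times> vec.span B) \<subseteq> vec.span (insert b B)"
        proof clarify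
          fix c y assume "y \<in> vec.span B"
          then show "c *s b + y \<in> vec.span (insert b B)"
            unfolding vec.span_insert by (auto intro!: exI[of _ c])
        qed
      qed
      moreover have "inj_on ?f (UNIV \<times> vec.span B)"
      proof (rule inj_onI, clarify)
        fix c x c' x' assume x: "x \<in> vec.span B" "x' \<in> vec.span B" and e: "c *s b + x = c' *s b + x'"
        have "(c - c') *s b = x' - x" using e by (simp add: algebra_simps vec.scale_left_diff_distrib)
        then have m: "(c - c') *s b \<in> vec.span B" using x by (simp add: vec.span_diff)
        have "c = c'"
        proof (rule ccontr)
          assume "c \<noteq> c'"
          then have "inverse (c - c') *s ((c - c') *s b) = b"
            by (simp only: vec.scale_scale) (simp)
          then show False using m ind(2) by (metis vec.span_scale)
        qed
        then show "c = c' \<and> x = x'" using e by simp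
      qed
      ultimately have "card (vec.span (insert b B)) = CARD('a) * card (vec.span B)"
        by (simp add: card_image card_cartesian_product)
      then show ?case using insert ind by simp
    qed
  qed
  obtain B where "B \<subseteq> U" "vec.independent B" "U \<subseteq> vec.span B" "card B = vec.dim U"
    using vec.basis_exists by blast
  then show ?thesis using * assms by (metis vec.span_subspace)
qed

lemma card_field_gt_1: "CARD('a::{field,finite}) > 1"
proof -
  have "card {0, 1::'a} \<le> CARD('a)" by (rule card_mono) auto
  then show ?thesis by simp
qed

lemma dim_eqI_card:
  fixes U :: "('a::{field,finite}^'d) set"
  assumes "vec.subspace U" "card U = CARD('a) ^ k"
  shows "vec.dim U = k"
  using card_subspace[OF assms(1)] assms(2) card_field_gt_1[where 'a='a] by simp

text \<open>The fibres of addition from \<open>S \<times> T\<close> onto the sum all have the size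
  of \<open>S \<inter> T\<close>.\<close>

lemma dim_span_Un_Int:
  fixes S T :: "('a::{field,finite}^'d) set"
  assumes S: "vec.subspace S" and T: "vec.subspace T"
  shows "vec.dim (vec.span (S \<union> T)) + vec.dim (S \<inter> T) = vec.dim S + vec.dim T"
proof -
  let ?f = "\<lambda>(x, y). x + y"
  have im: "vec.span (S \<union> T) = ?f ` (S \<times> T)"
    unfolding vec.span_Un using S T by (auto simp: vec.span_eq_iff[THEN iffD2] image_iff)
  have fib: "card {p\<in>S \<times> T. ?f p = z} = card (S \<inter> T)" if z: "z \<in> ?f ` (S \<times> T)" for z
  proof -
    obtain x y where xy: "x \<in> S" "y \<in> T" "z = x + y" using z by auto
    have "bij_betw (\<lambda>w. (x + w, y - w)) (S \<inter> T) {p\<in>S \<times> T. ?f p = z}"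
    proof (rule bij_betwI[where g = "\<lambda>p. fst p - x"])
      show "(\<lambda>p. fst p - x) \<in> {p \<in> S \<times> T. ?f p = z} \<rightarrow> S \<inter> T"
      proof
        fix p assume "p \<in> {p \<in> S \<times> T. ?f p = z}"
        then have p: "fst p \<in> S" "snd p \<in> T" "fst p + snd p = z" by auto
        then have "fst p - x = y - snd p" using xy by (simp add: algebra_simps)
        then show "fst p - x \<in> S \<inter> T" using p xy S T by (metis IntI vec.subspace_diff)
      qed
    qed (use xy S T in \<open>auto simp: vec.subspace_add vec.subspace_diff algebra_simps\<close>)
    then show ?thesis by (simp add: bij_betw_same_card)
  qed
  have "card (S \<times> T) = card (vec.span (S \<union> T)) * card (S \<inter> T)"
    using card_eq_sum_fibres[of "S \<times> T" ?f] fib im by simp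
  then have "CARD('a) ^ (vec.dim S + vec.dim T)
      = CARD('a) ^ (vec.dim (vec.span (S \<union> T)) + vec.dim (S \<inter> T))"
    using S T by (simp add: card_cartesian_product card_subspace vec.subspace_inter power_add
        del: vec.dim_span)
  then show ?thesis using card_field_gt_1[where 'a='a] by (simp del: vec.dim_span)
qed

lemma card_functional_fibre:
  fixes U :: "('a::{field,finite}^'d) set" and f :: "'a^'d \<Rightarrow> 'a"
  assumes U: "vec.subspace U"
    and add: "\<And>x y. f (x + y) = f x + f y" and scale: "\<And>c x. f (c *s x) = c * f x"
    and u: "u \<in> U" "f u \<noteq> 0"
  shows "card {x\<in>U. f x = a} * CARD('a) = card U"
proof -
  have fib: "card {x\<in>U. f x = b} = card {x\<in>U. f x = a}" for b
  proof -
    let ?t = "((b - a) / f u) *s u"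
    have ft: "f ?t = b - a" using u by (simp add: scale)
    have tU: "?t \<in> U" using U u by (simp add: vec.subspace_scale)
    have fm: "f (- x) = - f x" for x using scale[of "-1" x] by (simp)
    have fd: "f (x - y) = f x - f y" for x y using add[of x "-y"] fm by simp
    have "bij_betw (\<lambda>x. x - ?t) {x\<in>U. f x = b} {x\<in>U. f x = a}"
      by (rule bij_betwI[where g = "\<lambda>x. x + ?t"])
        (use U tU ft fd add in \<open>auto simp: vec.subspace_add vec.subspace_diff\<close>)
    then show ?thesis by (rule bij_betw_same_card)
  qed
  have "f ` U = UNIV"
  proof -
    have "c \<in> f ` U" for c
      using u U by (intro image_eqI[of _ _ "(c / f u) *s u"]) (auto simp: scale vec.subspace_scale)
    then show ?thesis by auto
  qed
  then have "card U = (\<Sum>b\<in>UNIV. card {x\<in>U. f x = b})"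
    using card_eq_sum_fibres[of U f] by simp
  also have "\<dots> = (\<Sum>b\<in>(UNIV::'a set). card {x\<in>U. f x = a})" by (rule sum.cong[OF refl fib])
  finally show ?thesis by simp
qed

lemma dim_insert_new:
  fixes A :: "('a::{field,finite}^'d) set"
  assumes "vec.subspace A" "v \<notin> A"
  shows "vec.dim (vec.span (insert v A)) = Suc (vec.dim A)"
  using assms by (simp add: vec.dim_insert vec.span_eq_iff[THEN iffD2])

lemma span_insert_eq:
  fixes A U :: "('a::{field,finite}^'d) set"
  assumes "vec.subspace A" "v \<notin> A" "vec.subspace U" "insert v A \<subseteq> U" "vec.dim U \<le> Suc (vec.dim A)"
  shows "vec.span (insert v A) = U"
  by (rule vec.subspace_dim_equal)
    (use assms dim_insert_new[OF assms(1,2)] vec.span_minimal[of "insert v A" U] in auto)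

text \<open>An extension \<open>U\<close> arises from exactly the vectors of \<open>U - A\<close>.
  \<open>S\<close> is only assumed closed under spans with \<open>A\<close>, because it will be not
  just a level of a chamber but also the set of singular vectors of \<open>perp E\<close>.\<close>

lemma card_extensions:
  fixes A S :: "('a::{field,finite}^'d) set"
  assumes A: "vec.subspace A" "A \<subseteq> S"
    and S: "\<And>v. v \<in> S \<Longrightarrow> v \<notin> A \<Longrightarrow> vec.span (insert v A) \<subseteq> S"
  shows "card {U. vec.subspace U \<and> vec.dim U = Suc (vec.dim A) \<and> A \<subseteq> U \<and> U \<subseteq> S}
           * (CARD('a) ^ Suc (vec.dim A) - CARD('a) ^ vec.dim A)
         = card S - CARD('a) ^ vec.dim A" (is "card ?X * _ = _")
proof -
  let ?f = "\<lambda>v. vec.span (insert v A)"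
  have fib: "{v \<in> S - A. ?f v = U} = U - A" if "U \<in> ?X" for U
    using that A span_insert_eq[of A _ U] by (auto intro: vec.span_base)
  have im: "?f ` (S - A) = ?X"
  proof
    show "?f ` (S - A) \<subseteq> ?X"
    proof
      fix U assume "U \<in> ?f ` (S - A)"
      then obtain v where v: "v \<in> S" "v \<notin> A" "U = ?f v" by auto
      then show "U \<in> ?X"
        using S[OF v(1,2)] dim_insert_new[OF A(1) v(2)] vec.span_superset[of "insert v A"] by simp
    qed
    show "?X \<subseteq> ?f ` (S - A)"
    proof
      fix U assume U: "U \<in> ?X"
      have "\<not> U \<subseteq> A" using U vec.dim_subset[of U A] by auto
      then obtain v where "v \<in> U" "v \<notin> A" by auto
      then show "U \<in> ?f ` (S - A)" using U fib[OF U] by (auto intro!: image_eqI[of _ _ v])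
    qed
  qed
  have "card (S - A) = (\<Sum>U\<in>?X. card (U - A))"
    using card_eq_sum_fibres[of "S - A" ?f] fib im by simp
  also have "\<dots> = (\<Sum>U\<in>?X. CARD('a) ^ Suc (vec.dim A) - CARD('a) ^ vec.dim A)"
    by (intro sum.cong refl) (use A in \<open>auto simp: card_Diff_subset card_subspace\<close>)
  finally show ?thesis using A by (simp add: card_Diff_subset card_subspace mult.commute)
qed

section \<open>Perpendicular spaces, generators and the number of singular vectors\<close>

locale hyperbolic_quadric =
  fixes Q :: "'a::{field,finite}^'d \<Rightarrow> 'a" and n :: nat
  assumes hyp: "hyperbolic_form n Q" and n2: "n \<ge> 2"
begin

abbreviation B :: "'a^'d \<Rightarrow> 'a^'d \<Rightarrow> 'a" where "B \<equiv> polar_form Q"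
abbreviation TS :: "('a^'d) set \<Rightarrow> bool" where "TS \<equiv> totally_singular Q"
abbreviation G :: "('a^'d) set set" where "G \<equiv> generators n Q"

definition perp :: "('a^'d) set \<Rightarrow> ('a^'d) set" where "perp S = {v. \<forall>u\<in>S. B v u = 0}"

lemma quadratic: "quadratic_form Q" and nondeg: "nondegenerate_form Q"
  and card_d: "CARD('d) = 2 * n" and G_nonempty: "\<exists>M. M \<in> G"
  using hyp by (auto simp: hyperbolic_form_def generators_def)

lemma Q_scale: "Q (c *s v) = c\<^sup>2 * Q v"
  using quadratic by (simp add: quadratic_form_def)

lemma B_add_left: "B (x + y) w = B x w + B y w"
  and B_scale_left: "B (c *s x) w = c * B x w"
  using quadratic unfolding quadratic_form_def
  by (auto simp: Vector_Spaces.linear_iff)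

lemma B_commute: "B u v = B v u"
  by (simp add: polar_form_def add.commute)

lemma B_add_right: "B w (x + y) = B w x + B w y"
  using B_add_left B_commute by metis

lemma B_scale_right: "B w (c *s x) = c * B w x"
  using B_scale_left B_commute by metis

lemma Q_add: "Q (u + v) = Q u + Q v + B u v"
  by (simp add: polar_form_def)

lemma Q_0: "Q 0 = 0" using Q_scale[of 0 0] by simp

lemma B_0_left [simp]: "B 0 w = 0" using B_scale_left[of 0 0] by simp
lemma B_0_right [simp]: "B w 0 = 0" using B_commute by simp
lemma B_diff_left: "B (x - y) w = B x w - B y w"
  using B_add_left[of "x - y" y w] by simp

lemma subspace_perp: "vec.subspace (perp S)"
  by (auto simp: perp_def vec.subspace_def B_add_left B_scale_left)

lemma perp_antimono: "S \<subseteq> T \<Longrightarrow> perp T \<subseteq> perp S"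
  by (auto simp: perp_def)

lemma subset_perp_commute: "S \<subseteq> perp T \<longleftrightarrow> T \<subseteq> perp S"
  using B_commute by (fastforce simp: perp_def)

lemma perp_span: "perp (vec.span S) = perp S"
proof
  show "perp (vec.span S) \<subseteq> perp S" by (rule perp_antimono) (rule vec.span_superset)
  have "S \<subseteq> perp (perp S)" using subset_perp_commute by blast
  then have "vec.span S \<subseteq> perp (perp S)" using subspace_perp by (rule vec.span_minimal)
  then show "perp S \<subseteq> perp (vec.span S)" using subset_perp_commute by blast
qed

lemma perp_Un: "perp (S \<union> T) = perp S \<inter> perp T" by (auto simp: perp_def)

lemma perp_empty: "perp {} = UNIV" by (simp add: perp_def)

lemma TS_subspace: "TS U \<Longrightarrow> vec.subspace U" by (simp add: totally_singular_def)

lemma TS_Q: "TS U \<Longrightarrow> v \<in> U \<Longrightarrow> Q v = 0" by (simp add: totally_singular_def)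

lemma TS_B: "TS U \<Longrightarrow> u \<in> U \<Longrightarrow> v \<in> U \<Longrightarrow> B u v = 0"
  using vec.subspace_add[of U u v] by (simp add: totally_singular_def polar_form_def)

lemma TS_perp: "TS U \<Longrightarrow> U \<subseteq> perp U" by (auto simp: perp_def TS_B)

lemma TS_subset: "TS U \<Longrightarrow> vec.subspace V \<Longrightarrow> V \<subseteq> U \<Longrightarrow> TS V"
  by (auto simp: totally_singular_def)

lemma TS_span_Un:
  assumes "TS U" "TS V" "U \<subseteq> perp V"
  shows "TS (vec.span (U \<union> V))"
proof -
  have "Q (x + y) = 0" if "x \<in> U" "y \<in> V" for x y
    using that assms by (auto simp: Q_add TS_Q perp_def)
  then show ?thesis
    using assms unfolding totally_singular_def vec.span_Un
    by (auto simp: vec.span_eq_iff[THEN iffD2] vec.subspace_sums)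
qed

lemma dim_inter_perp_insert:
  assumes W: "vec.subspace W"
  shows "vec.dim W \<le> Suc (vec.dim (W \<inter> perp {v}))"
proof (cases "\<exists>u\<in>W. B u v \<noteq> 0")
  case False
  then have "W \<inter> perp {v} = W" by (auto simp: perp_def)
  then show ?thesis by simp
next
  case True
  then obtain u where "u \<in> W" "B u v \<noteq> 0" by auto
  from card_functional_fibre[OF W, of "\<lambda>x. B x v" u 0] this
  have "card (W \<inter> perp {v}) * CARD('a) = card W"
    by (simp add: B_add_left B_scale_left perp_def Int_def)
  then have "CARD('a) ^ vec.dim W = CARD('a) ^ Suc (vec.dim (W \<inter> perp {v}))"
    using W by (simp add: card_subspace vec.subspace_inter subspace_perp mult.commute)
  then show ?thesis using card_field_gt_1[where 'a='a] by (simp del: power_Suc)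
qed

lemma dim_inter_perp_Un:
  assumes W: "vec.subspace W" and "finite C"
  shows "vec.dim (W \<inter> perp S) \<le> vec.dim (W \<inter> perp (S \<union> C)) + card C"
  using assms(2)
proof (induction C rule: finite_induct)
  case (insert v C)
  have "W \<inter> perp (S \<union> C) \<inter> perp {v} = W \<inter> perp (S \<union> insert v C)"
    by (auto simp: perp_def)
  then show ?case
    using insert dim_inter_perp_insert[of "W \<inter> perp (S \<union> C)" v] W
    by (simp add: vec.subspace_inter subspace_perp)
qed simp

lemma dim_UNIV: "vec.dim (UNIV :: ('a^'d) set) = 2 * n"
  using vec_dim_card[where 'a='a and 'n='d] card_d by (simp del: vec.dim_UNIV)

lemma extend_basis_of:
  assumes "vec.subspace (U :: ('a^'d) set)"
  obtains S C where "vec.span S = U" "card S = vec.dim U" "finite S" "finite C"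
    "vec.span (S \<union> C) = UNIV" "card C + vec.dim U = 2 * n"
proof -
  obtain S where S: "S \<subseteq> U" "vec.independent S" "U \<subseteq> vec.span S" "card S = vec.dim U"
    using vec.basis_exists by blast
  obtain D where D: "S \<subseteq> D" "vec.independent D" "UNIV \<subseteq> vec.span D"
    using vec.maximal_independent_subset_extend[OF subset_UNIV S(2)] by metis
  have fin: "finite D" using D(2) by (rule vec.finiteI_independent)
  have cD: "card D = 2 * n" using D dim_UNIV
    by (metis vec.basis_card_eq_dim subset_UNIV)
  show ?thesis
  proof (rule that[of S "D - S"])
    show "vec.span S = U" using S assms by (metis vec.span_subspace)
    show "finite S" using fin D by (auto intro: finite_subset)
    show "vec.span (S \<union> (D - S)) = UNIV" using D by (simp add: Un_absorb1 top.extremum_uniqueI)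
    show "card (D - S) + vec.dim U = 2 * n"
      using fin D S cD by (metis card_Diff_subset card_mono finite_subset le_add_diff_inverse2)
  qed (use S fin in auto)
qed

text \<open>In characteristic 2 \<open>nondegenerate_form\<close> excludes only singular vectors
  from the radical, so the Witt index has to enter. A generator \<open>M\<close> meets the radical
  in \<open>0\<close>; a count with bases gives \<open>dim (perp M) \<le> n\<close>, so
  \<open>perp M = M\<close>, and the radical lies in \<open>M\<close>.\<close>

lemma perp_UNIV: "perp UNIV = {0}"
proof -
  obtain M where M: "TS M" "vec.dim M = n"
    using G_nonempty by (auto simp: generators_def singular_subspaces_def)
  note sM = TS_subspace[OF M(1)]
  have RM: "x = 0" if "x \<in> M" "x \<in> perp UNIV" for x
    using nondeg that TS_Q[OF M(1)] by (auto simp: nondegenerate_form_def perp_def)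
  obtain S C where SC: "vec.span S = perp M" "finite C" "vec.span (S \<union> C) = UNIV"
     "card C + vec.dim (perp M) = 2 * n"
    using extend_basis_of[OF subspace_perp] by metis
  have pS: "perp S = perp (perp M)" using SC(1) perp_span by metis
  have "M \<subseteq> perp (perp M)" using subset_perp_commute by blast
  then have "vec.dim M \<le> vec.dim (M \<inter> perp (S \<union> C)) + card C"
    using dim_inter_perp_Un[OF sM SC(2), of S] pS by (simp add: Int_absorb2)
  moreover have "M \<inter> perp (S \<union> C) = {0}"
    using RM perp_span[of "S \<union> C"] SC(3) sM by (auto simp: vec.subspace_0 perp_def)
  ultimately have "vec.dim (perp M) \<le> n" using SC(4) M(2) by simp
  then have "M = perp M"
    using TS_perp[OF M(1)] M(2) sM subspace_perp by (intro vec.subspace_dim_equal) auto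
  then have "perp UNIV \<subseteq> M" using perp_antimono[of M UNIV] by auto
  then show ?thesis using RM by (auto simp: perp_def)
qed

lemma dim_perp:
  assumes "vec.subspace U"
  shows "vec.dim (perp U) + vec.dim U = 2 * n"
proof -
  obtain S C where SC: "vec.span S = U" "card S = vec.dim U" "finite S" "finite C"
    "vec.span (S \<union> C) = UNIV" "card C + vec.dim U = 2 * n"
    using extend_basis_of[OF assms] by metis
  have "2 * n \<le> vec.dim (perp S) + card S"
    using dim_inter_perp_Un[OF vec.subspace_UNIV SC(3), of "{}"] dim_UNIV
    by (simp add: perp_empty del: vec.dim_UNIV)
  moreover have "vec.dim (perp S) \<le> vec.dim (perp (S \<union> C)) + card C"
    using dim_inter_perp_Un[OF vec.subspace_UNIV SC(4), of S] by simp
  moreover have "perp (S \<union> C) = {0}" using perp_UNIV perp_span SC(5) by metis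
  ultimately show ?thesis using SC perp_span[of S] by simp
qed

lemma subset_perp_perp: "U \<subseteq> perp (perp U)"
  using subset_perp_commute by blast

lemma perp_perp: "vec.subspace U \<Longrightarrow> perp (perp U) = U"
  using dim_perp[of U] dim_perp[OF subspace_perp, of U]
  by (intro vec.subspace_dim_equal[symmetric] subspace_perp) (auto intro: subset_perp_perp[THEN subsetD])

lemma G_iff: "M \<in> G \<longleftrightarrow> TS M \<and> vec.dim M = n"
  by (simp add: generators_def singular_subspaces_def)

lemma TS_dim_le: "TS U \<Longrightarrow> vec.dim U \<le> n"
  using dim_perp[OF TS_subspace] vec.dim_subset[OF TS_perp] by fastforce

lemma G_perp: "M \<in> G \<Longrightarrow> perp M = M"
  using dim_perp[of M] TS_perp[of M]
  by (intro vec.subspace_dim_equal[symmetric] subspace_perp) (auto simp: G_iff TS_subspace)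

lemma G_maximal: "M \<in> G \<Longrightarrow> TS U \<Longrightarrow> M \<subseteq> U \<Longrightarrow> U = M"
  using TS_dim_le[of U] by (intro vec.subspace_dim_equal[symmetric]) (auto simp: G_iff TS_subspace)

text \<open>The projection of \<open>N\<close> onto \<open>E\<close>: the generator on
  \<open>E\<close> that meets \<open>N\<close> as much as possible. Its dimension follows from
  \<open>N \<inter> perp E = perp (N \<union> E)\<close>, which holds because
  \<open>N = perp N\<close>.\<close>

lemma G_projection:
  assumes N: "N \<in> G" and E: "TS E"
  shows "vec.span ((N \<inter> perp E) \<union> E) \<in> G"
proof -
  have sN: "vec.subspace N" "TS N" and sE: "vec.subspace E"
    using N E by (auto simp: G_iff TS_subspace)
  have sI: "vec.subspace (N \<inter> perp E)" using sN subspace_perp by (auto intro: vec.subspace_inter)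
  have ts: "TS (vec.span ((N \<inter> perp E) \<union> E))"
    by (rule TS_span_Un) (use sN sI E TS_subset in auto)
  have EE: "E \<subseteq> perp E" using TS_perp E by auto
  have 1: "vec.dim (vec.span ((N \<inter> perp E) \<union> E)) + vec.dim (N \<inter> E) = vec.dim (N \<inter> perp E) + vec.dim E"
    using dim_span_Un_Int[OF sI sE] EE by (simp add: Int_assoc Int_absorb1)
  have "N \<inter> perp E = perp (vec.span (N \<union> E))"
    using G_perp[OF N] by (simp add: perp_span perp_Un)
  then have 2: "vec.dim (N \<inter> perp E) + vec.dim (vec.span (N \<union> E)) = 2 * n"
    using dim_perp[of "vec.span (N \<union> E)"] by simp
  have 3: "vec.dim (vec.span (N \<union> E)) + vec.dim (N \<inter> E) = vec.dim N + vec.dim E"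
    by (rule dim_span_Un_Int[OF sN(1) sE])
  have "vec.dim N = n" using N by (simp add: G_iff)
  then show ?thesis using 1 2 3 ts unfolding G_iff by linarith
qed

text \<open>Averaging over the translates by a generator \<open>M \<supseteq> E\<close>: the form is affine and nonconstant on each
  coset of \<open>M\<close> in \<open>perp E\<close> other than \<open>M\<close> itself.\<close>

lemma card_singular_perp:
  assumes E: "TS E"
  shows "card {v\<in>perp E. Q v = 0}
    = CARD('a) ^ n + (CARD('a) ^ (n - vec.dim E) - 1) * CARD('a) ^ (n - 1)"
proof -
  let ?q = "CARD('a)"
  obtain N where N: "N \<in> G" using G_nonempty by auto
  define M where "M = vec.span ((N \<inter> perp E) \<union> E)"
  have M: "M \<in> G" unfolding M_def by (rule G_projection[OF N E])
  have EM: "E \<subseteq> M" unfolding M_def using vec.span_superset by blast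
  then have MP: "M \<subseteq> perp E" using perp_antimono G_perp[OF M] by blast
  have sM: "vec.subspace M" "TS M" "vec.dim M = n" using M by (auto simp: G_iff TS_subspace)
  define Z where "Z = {v\<in>perp E. Q v = 0}"
  have cM: "card M = ?q ^ n" using card_subspace[OF sM(1)] sM by simp
  have shift: "card {v\<in>perp E. Q (v + m) = 0} = card Z" if "m \<in> M" for m
  proof -
    have "bij_betw (\<lambda>v. v + m) {v\<in>perp E. Q (v + m) = 0} Z"
      by (rule bij_betwI[where g = "\<lambda>v. v - m"])
        (use that MP subspace_perp in \<open>auto simp: Z_def vec.subspace_add vec.subspace_diff\<close>)
    then show ?thesis by (rule bij_betw_same_card)
  qed
  have fib1: "{m\<in>M. Q (v + m) = 0} = M" if "v \<in> M" for v
    using that sM by (auto simp: TS_Q vec.subspace_add)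
  have fib2: "card {m\<in>M. Q (v + m) = 0} = ?q ^ (n - 1)" if v: "v \<notin> M" for v
  proof -
    have "v \<notin> perp M" using v G_perp[OF M] by simp
    then obtain u where u: "u \<in> M" "B v u \<noteq> 0" by (auto simp: perp_def)
    have "{m\<in>M. Q (v + m) = 0} = {m\<in>M. B v m = - Q v}"
      using sM by (auto simp: Q_add TS_Q add_eq_0_iff)
    then have "card {m\<in>M. Q (v + m) = 0} * ?q = ?q ^ n"
      using card_functional_fibre[OF sM(1), of "B v" u "- Q v"] u cM
      by (simp add: B_add_right B_scale_right)
    also have "?q ^ n = ?q ^ (n - 1) * ?q" using n2 by (simp add: power_eq_if)
    finally show ?thesis using card_field_gt_1[where 'a='a] by simp
  qed
  \<comment> \<open>Pairs \<open>(v, m)\<close> with \<open>Q (v + m) = 0\<close> are counted by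
    \<open>m\<close>, where translation gives \<open>card Z\<close> each time, and by
    \<open>v\<close>.\<close>
  have "?q ^ n * card Z = (\<Sum>m\<in>M. card {v\<in>perp E. Q (v + m) = 0})"
    using shift cM by simp
  also have "\<dots> = (\<Sum>m\<in>M. \<Sum>v\<in>perp E. if Q (v + m) = 0 then 1 else 0)"
    by (simp add: sum.If_cases Int_def)
  also have "\<dots> = (\<Sum>v\<in>perp E. \<Sum>m\<in>M. if Q (v + m) = 0 then 1 else 0)"
    by (rule sum.swap)
  also have "\<dots> = (\<Sum>v\<in>perp E. card {m\<in>M. Q (v + m) = 0})"
    by (simp add: sum.If_cases Int_def)
  also have "\<dots> = (\<Sum>v\<in>M. card {m\<in>M. Q (v + m) = 0}) + (\<Sum>v\<in>perp E - M. card {m\<in>M. Q (v + m) = 0})"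
    using sum.subset_diff[OF MP] by (simp add: add.commute)
  also have "\<dots> = ?q ^ n * ?q ^ n + card (perp E - M) * ?q ^ (n - 1)"
    using fib1 fib2 cM by simp
  also have "card (perp E - M) = ?q ^ (2 * n - vec.dim E) - ?q ^ n"
    using MP cM dim_perp[OF TS_subspace[OF E]] card_subspace[OF subspace_perp, of E]
    by (simp add: card_Diff_subset) (metis add_diff_cancel_right')
  also have "2 * n - vec.dim E = n + (n - vec.dim E)" using TS_dim_le[OF E] by simp
  also have "?q ^ (n + (n - vec.dim E)) - ?q ^ n = ?q ^ n * (?q ^ (n - vec.dim E) - 1)"
    by (simp add: power_add right_diff_distrib')
  finally have "?q ^ n * card Z = ?q ^ n * (?q ^ n + (?q ^ (n - vec.dim E) - 1) * ?q ^ (n - 1))"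
    by (simp add: algebra_simps)
  then show ?thesis using card_field_gt_1[where 'a='a] by (simp add: Z_def)
qed

text \<open>The number of points of the hyperbolic quadric of rank \<open>m\<close>, which occurs as
  the residue \<open>perp E / E\<close> with \<open>m = n - dim E\<close>. The geometric sum avoids
  a division of natural numbers.\<close>

definition residue_points :: "nat \<Rightarrow> nat" where
  "residue_points m = (\<Sum>i<m. CARD('a) ^ i) * (CARD('a) ^ (m - 1) + 1)"

text \<open>The extensions are the spans of \<open>E\<close> with a singular vector of
  \<open>perp E\<close>, and \<open>card_singular_perp\<close> counts these vectors.\<close>

lemma card_TS_extensions:
  assumes E: "TS E" and k: "vec.dim E < n"
  shows "card {U. TS U \<and> vec.dim U = Suc (vec.dim E) \<and> E \<subseteq> U} = residue_points (n - vec.dim E)"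
proof -
  let ?q = "CARD('a)" and ?k = "vec.dim E"
  define m where "m = n - ?k"
  define Z where "Z = {v\<in>perp E. Q v = 0}"
  note sE = TS_subspace[OF E]
  have span: "vec.span (insert v E) \<subseteq> Z \<and> TS (vec.span (insert v E))" if v: "v \<in> Z" for v
  proof -
    have "Q w = 0" if "w \<in> vec.span {v}" for w
      using that v by (auto simp: vec.span_singleton Z_def Q_scale)
    then have "TS (vec.span {v})" by (simp add: totally_singular_def)
    then have "TS (vec.span (E \<union> vec.span {v}))"
    proof (rule TS_span_Un[OF E])
      have "B x v = 0" if "x \<in> E" for x
        using v that B_commute[of x v] by (simp add: Z_def perp_def)
      then show "E \<subseteq> perp (vec.span {v})" unfolding perp_span by (auto simp: perp_def)
    qed
    moreover have "vec.span (E \<union> vec.span {v}) = vec.span (insert v E)"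
    proof (rule vec.span_eq[THEN iffD2], intro conjI)
      show "E \<union> vec.span {v} \<subseteq> vec.span (insert v E)"
        using vec.span_mono[of "{v}" "insert v E"] vec.span_superset[of "insert v E"] by auto
      show "insert v E \<subseteq> vec.span (E \<union> vec.span {v})"
        using vec.span_superset[of "{v}"] vec.span_superset[of "E \<union> vec.span {v}"] by auto
    qed
    ultimately have ts: "TS (vec.span (insert v E))" by simp
    moreover have "vec.span (insert v E) \<subseteq> perp E"
      using TS_perp[OF ts] perp_antimono[of E "vec.span (insert v E)"]
      by (meson order_trans subset_insertI vec.span_superset)
    ultimately show ?thesis by (auto simp: Z_def TS_Q)
  qed
  have "{U. TS U \<and> vec.dim U = Suc ?k \<and> E \<subseteq> U}
      = {U. vec.subspace U \<and> vec.dim U = Suc ?k \<and> E \<subseteq> U \<and> U \<subseteq> Z}" (is "?X = ?Y")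
  proof
    have "U \<subseteq> perp E" if "TS U" "E \<subseteq> U" for U
      using TS_perp[OF that(1)] perp_antimono[OF that(2)] by (rule subset_trans)
    then show "?X \<subseteq> ?Y" by (auto simp: Z_def TS_Q TS_subspace)
    show "?Y \<subseteq> ?X" by (auto simp: Z_def totally_singular_def)
  qed
  moreover have "card ?Y * (?q ^ Suc ?k - ?q ^ ?k) = card Z - ?q ^ ?k"
  proof (rule card_extensions[OF sE])
    show "E \<subseteq> Z" using TS_perp[OF E] TS_Q[OF E] by (auto simp: Z_def)
  qed (use span in blast)
  moreover have "?q ^ Suc ?k - ?q ^ ?k = ?q ^ ?k * (?q - 1)" by (simp add: algebra_simps)
  ultimately have 1: "card ?X * (?q ^ ?k * (?q - 1)) = card Z - ?q ^ ?k" by simp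
  have geo: "(?q - 1) * (\<Sum>i<m. ?q ^ i) = ?q ^ m - 1"
  proof -
    have "(int ?q - 1) * (\<Sum>i<m. int ?q ^ i) = int ?q ^ m - 1" by (rule power_diff_1_eq[symmetric])
    then have "int ((?q - 1) * (\<Sum>i<m. ?q ^ i)) = int (?q ^ m - 1)"
      using card_field_gt_1[where 'a='a] by (simp add: of_nat_diff)
    then show ?thesis by (simp only: of_nat_eq_iff)
  qed
  have m0: "m > 0" using k by (simp add: m_def)
  have qn: "?q ^ n = ?q ^ ?k * ?q ^ m" "?q ^ (n - 1) = ?q ^ ?k * ?q ^ (m - 1)"
    using k by (simp_all add: m_def flip: power_add)
  have "card Z = ?q ^ ?k * (?q ^ m + (?q ^ m - 1) * ?q ^ (m - 1))"
    using card_singular_perp[OF E] unfolding Z_def[symmetric] m_def[symmetric] qn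
    by (simp add: algebra_simps)
  then have "card Z - ?q ^ ?k = ?q ^ ?k * ((?q ^ m + (?q ^ m - 1) * ?q ^ (m - 1)) - 1)"
    by (simp add: right_diff_distrib')
  also have "(?q ^ m + (?q ^ m - 1) * ?q ^ (m - 1)) - 1 = (?q ^ m - 1) * (?q ^ (m - 1) + 1)"
    using card_field_gt_1[where 'a='a] by (simp add: algebra_simps)
  finally have "card ?X * (?q ^ ?k * (?q - 1)) = ?q ^ ?k * ((?q ^ m - 1) * (?q ^ (m - 1) + 1))"
    using 1 by simp
  also have "\<dots> = residue_points m * (?q ^ ?k * (?q - 1))"
    unfolding residue_points_def geo[symmetric] by (simp add: algebra_simps)
  finally show ?thesis using card_field_gt_1[where 'a='a] by (simp add: m_def)
qed

end

section \<open>Classes of generators and chains of singular subspaces\<close>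

lemma card_subsingleton:
  assumes "\<And>x y. x \<in> S \<Longrightarrow> y \<in> S \<Longrightarrow> x = y"
  shows "card S = of_bool (S \<noteq> {})"
proof (cases "S = {}")
  case False
  then obtain x where "x \<in> S" by auto
  then have "S = {x}" using assms by auto
  then show ?thesis by simp
qed simp

lemma exists_hyperplane:
  fixes D :: "('a::{field,finite}^'d) set"
  assumes "vec.subspace D" "vec.dim D = Suc m"
  shows "\<exists>H. vec.subspace H \<and> H \<subseteq> D \<and> vec.dim H = m"
proof -
  obtain S where S: "S \<subseteq> D" "vec.independent S" "D \<subseteq> vec.span S" "card S = vec.dim D"
    using vec.basis_exists by blast
  then obtain b where b: "b \<in> S" using assms by (metis card.empty ex_in_conv nat.distinct(1))
  have fin: "finite S" using S(2) by (rule vec.finiteI_independent)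
  have "vec.independent (S - {b})" using S(2) by (rule vec.independent_mono) auto
  then have "vec.dim (vec.span (S - {b})) = m"
    using S b fin assms vec.dim_span_eq_card_independent[of "S - {b}"] by simp
  moreover have "vec.span (S - {b}) \<subseteq> D" using S(1) assms(1) by (intro vec.span_minimal) auto
  ultimately show ?thesis using vec.subspace_span by blast
qed

lemma vec_subspace_eqI:
  fixes U V :: "('a::{field,finite}^'d) set"
  assumes "vec.subspace U" "vec.subspace V" "U \<subseteq> V" "vec.dim U = vec.dim V"
  shows "U = V"
  using assms by (intro vec.subspace_dim_equal) auto

context hyperbolic_quadric
begin

lemma G_TS: "M \<in> G \<Longrightarrow> TS M" and G_dim: "M \<in> G \<Longrightarrow> vec.dim M = n"
  and G_subspace: "M \<in> G \<Longrightarrow> vec.subspace M"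
  by (auto simp: G_iff TS_subspace)

text \<open>The residue has rank 1 and just two points; this is the origin of the parameter
  1.\<close>

lemma card_generators_on:
  assumes "TS E" "vec.dim E = n - 1"
  shows "card {M\<in>G. E \<subseteq> M} = 2"
proof -
  have "n - vec.dim E = 1" "Suc (vec.dim E) = n" using assms n2 by auto
  moreover have "residue_points 1 = 2" by (simp add: residue_points_def)
  ultimately have "card {U. TS U \<and> vec.dim U = n \<and> E \<subseteq> U} = 2"
    using card_TS_extensions[OF assms(1)] assms(2) n2 by simp
  then show ?thesis by (simp add: G_iff conj_assoc)
qed

lemma generators_on_cases:
  assumes E: "TS E" "vec.dim E = n - 1" and M: "M \<in> G" "N \<in> G" "L \<in> G"
    and sub: "E \<subseteq> M" "E \<subseteq> N" "E \<subseteq> L" and "M \<noteq> N"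
  shows "L = M \<or> L = N"
proof (rule ccontr)
  assume "\<not> ?thesis"
  then have "card {L, M, N} = 3" using \<open>M \<noteq> N\<close> by auto
  moreover have "card {L, M, N} \<le> card {M\<in>G. E \<subseteq> M}"
    by (rule card_mono) (use M sub in auto)
  ultimately show False using card_generators_on[OF E] by simp
qed

lemma G_inter_dim_less:
  assumes "M \<in> G" "N \<in> G" "M \<noteq> N"
  shows "vec.dim (M \<inter> N) < n"
proof -
  have "vec.dim (M \<inter> N) \<le> vec.dim M" by (rule vec.dim_subset) auto
  moreover have "vec.dim (M \<inter> N) \<noteq> n"
  proof
    assume d: "vec.dim (M \<inter> N) = n"
    have "M \<inter> N = M" "M \<inter> N = N"
      by (rule vec_subspace_eqI; use assms d in \<open>auto simp: G_dim G_subspace vec.subspace_inter\<close>)+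
    then show False using assms by auto
  qed
  ultimately show ?thesis using assms by (simp add: G_dim)
qed

lemma G_inter_eq:
  assumes "M \<in> G" "N \<in> G" "M \<noteq> N" "vec.subspace E" "vec.dim E = n - 1" "E \<subseteq> M" "E \<subseteq> N"
  shows "M \<inter> N = E"
proof -
  have "E \<subseteq> M \<inter> N" using assms by auto
  moreover have "vec.dim (M \<inter> N) \<le> vec.dim E" using G_inter_dim_less assms by fastforce
  ultimately show ?thesis
    using assms by (intro vec.subspace_dim_equal[symmetric]) (auto simp: vec.subspace_inter G_subspace)
qed

text \<open>Only two generators contain \<open>E = M \<inter> M'\<close>, so the projection
  \<open>P\<close> of \<open>N\<close> onto \<open>E\<close> is one of them, say \<open>A\<close>.
  Then \<open>A \<inter> N = N \<inter> perp E\<close>, the other one meets \<open>N\<close> in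
  \<open>N \<inter> E\<close>, and the dimension formula for \<open>P\<close> makes the difference
  exactly 1.\<close>

lemma adjacent_parity:
  assumes M: "M \<in> G" "M' \<in> G" "N \<in> G" and d: "vec.dim (M \<inter> M') = n - 1"
  shows "vec.dim (M \<inter> N) = Suc (vec.dim (M' \<inter> N)) \<or> vec.dim (M' \<inter> N) = Suc (vec.dim (M \<inter> N))"
proof -
  define E where "E = M \<inter> M'"
  have E: "TS E" "vec.dim E = n - 1" "vec.subspace E" unfolding E_def
    using M d by (auto simp: G_TS G_subspace vec.subspace_inter intro: TS_subset[of M])
  define P where "P = vec.span ((N \<inter> perp E) \<union> E)"
  have P: "P \<in> G" "E \<subseteq> P" unfolding P_def
    using G_projection[OF M(3) E(1)] vec.span_superset[of "(N \<inter> perp E) \<union> E"] by auto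
  have neq: "M \<noteq> M'" using d M n2 by (auto simp: G_dim)
  have case1: "vec.dim (A \<inter> N) = Suc (vec.dim (A' \<inter> N))"
    if A: "A \<in> G" "A' \<in> G" "E = A \<inter> A'" "P = A" for A A'
  proof -
    have AE: "A \<subseteq> perp E" "A' \<subseteq> perp E"
      using A perp_antimono[of E A] perp_antimono[of E A'] G_perp by auto
    have "N \<inter> perp E \<subseteq> A" using A(4) vec.span_superset[of "(N \<inter> perp E) \<union> E"] unfolding P_def by auto
    then have 1: "N \<inter> perp E = A \<inter> N" "A' \<inter> N = N \<inter> E" using AE A(3) by auto
    have "vec.dim P + vec.dim ((N \<inter> perp E) \<inter> E) = vec.dim (N \<inter> perp E) + vec.dim E"
      unfolding P_def using M(3) E
      by (intro dim_span_Un_Int) (auto simp: G_subspace subspace_perp vec.subspace_inter)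
    moreover have "(N \<inter> perp E) \<inter> E = A' \<inter> N" using 1 TS_perp[OF E(1)] by auto
    ultimately have "n + vec.dim (A' \<inter> N) = vec.dim (A \<inter> N) + (n - 1)"
      using 1 P E G_dim by simp
    then show ?thesis using n2 by linarith
  qed
  have "P = M \<or> P = M'"
    by (rule generators_on_cases[OF E(1,2)]) (use M P neq in \<open>auto simp: E_def\<close>)
  then show ?thesis using case1[of M M'] case1[of M' M] M by (auto simp: E_def Int_commute)
qed

lemma TS_line: "Q v = 0 \<Longrightarrow> TS (vec.span {v})"
proof -
  assume v: "Q v = 0"
  have "Q w = 0" if "w \<in> vec.span {v}" for w
    using that v by (auto simp: vec.span_singleton Q_scale)
  then show "TS (vec.span {v})" by (simp add: totally_singular_def)
qed

text \<open>\<open>M'\<close> is the projection of \<open>M\<close> onto a point \<open>p\<close> of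
  \<open>N\<close> outside \<open>M\<close>: it keeps a hyperplane of \<open>M\<close> containing
  \<open>M \<inter> N\<close> and gains \<open>p\<close>.\<close>

lemma exists_adjacent_closer:
  assumes M: "M \<in> G" "N \<in> G" "M \<noteq> N"
  shows "\<exists>M'\<in>G. vec.dim (M \<inter> M') = n - 1 \<and> vec.dim (M' \<inter> N) = Suc (vec.dim (M \<inter> N))"
proof -
  have "\<not> N \<subseteq> M" using G_maximal[of N M] M by (auto simp: G_TS)
  then obtain p where p: "p \<in> N" "p \<notin> M" by auto
  let ?P = "vec.span {p}"
  have P: "TS ?P" using p M(2) by (intro TS_line) (auto dest: G_TS TS_Q)
  have pP: "p \<in> ?P" by (auto intro: vec.span_base)
  define M' where "M' = vec.span ((M \<inter> perp ?P) \<union> ?P)"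
  have M': "M' \<in> G" unfolding M'_def by (rule G_projection[OF M(1) P])
  have sup: "M \<inter> perp {p} \<subseteq> M'" "p \<in> M'"
    using pP vec.span_superset[of "(M \<inter> perp ?P) \<union> ?P"] unfolding M'_def perp_span by auto
  have neq: "M \<noteq> M'" using p sup by auto
  have "n \<le> Suc (vec.dim (M \<inter> perp {p}))"
    using dim_inter_perp_insert[OF G_subspace[OF M(1)], of p] M(1) by (simp add: G_dim)
  also have "vec.dim (M \<inter> perp {p}) \<le> vec.dim (M \<inter> M')"
    using sup by (intro vec.dim_subset) auto
  finally have d: "vec.dim (M \<inter> M') = n - 1" using G_inter_dim_less[OF M(1) M' neq] by simp
  have "M \<inter> N \<subseteq> perp {p}" using p M(2) by (auto simp: perp_def dest: G_TS TS_B)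
  then have "M \<inter> N \<subseteq> M' \<inter> N" using sup by auto
  then have ins: "vec.span (insert p (M \<inter> N)) \<subseteq> M' \<inter> N"
    using sup p M M' by (intro vec.span_minimal) (auto simp: vec.subspace_inter G_subspace)
  have "Suc (vec.dim (M \<inter> N)) \<le> vec.dim (M' \<inter> N)"
    using vec.dim_subset[OF ins] dim_insert_new[of "M \<inter> N" p] p M
    by (simp add: vec.subspace_inter G_subspace)
  then show ?thesis using adjacent_parity[OF M(1) M' M(2) d] M' d by auto
qed

text \<open>Moving \<open>M\<close> one step towards \<open>N\<close> changes both dimensions that
  involve \<open>M\<close> by one, so the parity survives until \<open>M = N\<close>. This makes
  \<open>same\<close> an equivalence relation with at most two classes.\<close>

theorem generator_parity:
  assumes "M \<in> G" "N \<in> G" "L \<in> G"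
  shows "even (vec.dim (M \<inter> N) + vec.dim (N \<inter> L) + vec.dim (M \<inter> L) + n)"
  using assms
proof (induction "n - vec.dim (M \<inter> N)" arbitrary: M)
  case 0
  then have "M = N" using G_inter_dim_less[of M N] by fastforce
  then show ?case using 0 by (auto simp: G_dim Int_commute)
next
  case (Suc k)
  then have "M \<noteq> N" by (auto simp: G_dim)
  then obtain M' where M': "M' \<in> G" "vec.dim (M \<inter> M') = n - 1"
      "vec.dim (M' \<inter> N) = Suc (vec.dim (M \<inter> N))"
    using exists_adjacent_closer Suc.prems by metis
  have "even (vec.dim (M' \<inter> N) + vec.dim (N \<inter> L) + vec.dim (M' \<inter> L) + n)"
    using Suc M' by (intro Suc.hyps(1)) auto
  then show ?case using adjacent_parity[of M M' L] M' Suc.prems by auto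
qed

abbreviation same :: "('a^'d) set \<Rightarrow> ('a^'d) set \<Rightarrow> bool" where
  "same M N \<equiv> (M, N) \<in> same_class n Q"

lemma same_iff: "M \<in> G \<Longrightarrow> N \<in> G \<Longrightarrow> same M N \<longleftrightarrow> even (vec.dim (M \<inter> N) + n)"
proof -
  have "a mod 2 = n mod 2 \<longleftrightarrow> even (a + n)" for a :: nat by presburger
  then show "M \<in> G \<Longrightarrow> N \<in> G \<Longrightarrow> ?thesis" by (simp add: same_class_def)
qed

lemma same_G: "same M N \<Longrightarrow> M \<in> G \<and> N \<in> G" by (simp add: same_class_def)

lemma same_cycle: "M \<in> G \<Longrightarrow> N \<in> G \<Longrightarrow> L \<in> G \<Longrightarrow> same M N \<longleftrightarrow> (same N L \<longleftrightarrow> same M L)"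
  using generator_parity[of M N L] by (simp add: same_iff) argo

lemma same_refl: "M \<in> G \<Longrightarrow> same M M" by (simp add: same_iff G_dim)

lemma same_sym: "same M N \<Longrightarrow> same N M" by (simp add: same_class_def Int_commute)

lemma same_trans: "same M N \<Longrightarrow> same N L \<Longrightarrow> same M L"
  using same_cycle same_G by blast

lemma adjacent_not_same: "M \<in> G \<Longrightarrow> N \<in> G \<Longrightarrow> vec.dim (M \<inter> N) = n - 1 \<Longrightarrow> \<not> same M N"
  using n2 by (simp add: same_iff)

lemma equiv_same_class: "equiv G (same_class n Q)"
proof (rule equivI)
  show "refl_on G (same_class n Q)" by (auto simp: refl_on_def same_refl dest: same_G)
  show "sym (same_class n Q)" by (auto simp: sym_def same_sym)
  show "trans (same_class n Q)" by (auto intro!: transI intro: same_trans)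
  show "same_class n Q \<subseteq> G \<times> G" by (auto dest: same_G)
qed

section \<open>Chains of singular subspaces and their number\<close>

definition good :: "nat \<Rightarrow> (nat \<Rightarrow> ('a^'d) set) \<Rightarrow> bool" where
  "good k e \<longleftrightarrow> (\<forall>i\<le>k. TS (e i) \<and> vec.dim (e i) = i) \<and> (\<forall>i<k. e i \<subseteq> e (Suc i))"

text \<open>A chain is encoded as the set of its members, including \<open>{0}\<close>, so that the chambers form a
  subset of a finite type and can index the coordinates of a vector.\<close>

definition chains :: "nat \<Rightarrow> ('a^'d) set set set" where
  "chains k = {e ` {0..k} |e. good k e}"

definition lev :: "('a^'d) set set \<Rightarrow> nat \<Rightarrow> ('a^'d) set" where
  "lev F i = (THE U. U \<in> F \<and> vec.dim U = i)"

lemma lev_image: "good k e \<Longrightarrow> i \<le> k \<Longrightarrow> lev (e ` {0..k}) i = e i"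
  unfolding lev_def good_def by (rule the_equality) auto

lemma chains_I: "good k e \<Longrightarrow> e ` {0..k} \<in> chains k"
  unfolding chains_def by auto

lemma good_cong: "good k e \<Longrightarrow> (\<And>i. i \<le> k \<Longrightarrow> e i = e' i) \<Longrightarrow> good k e'"
  unfolding good_def by (metis Suc_leI less_imp_le_nat)

lemma chains_D:
  assumes "F \<in> chains k"
  shows "good k (lev F)" "F = lev F ` {0..k}"
proof -
  obtain e where e: "good k e" "F = e ` {0..k}" using assms unfolding chains_def by auto
  have eq: "lev F i = e i" if "i \<le> k" for i using e lev_image that by auto
  show "good k (lev F)" using e(1) by (rule good_cong) (simp add: eq)
  show "F = lev F ` {0..k}" unfolding e(2) using eq e(2) by (intro image_cong) auto
qed

lemma chains_eqI:
  assumes "F \<in> chains k" "F' \<in> chains k" "\<And>i. i \<le> k \<Longrightarrow> lev F i = lev F' i"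
  shows "F = F'"
proof -
  have "lev F ` {0..k} = lev F' ` {0..k}" using assms(3) by (intro image_cong) auto
  then show ?thesis using chains_D(2) assms(1,2) by metis
qed

lemma good_mono: "good k e \<Longrightarrow> i \<le> j \<Longrightarrow> j \<le> k \<Longrightarrow> e i \<subseteq> e j"
proof (induction j)
  case (Suc j)
  then have "e j \<subseteq> e (Suc j)" by (simp add: good_def)
  then show ?case using Suc by (cases "i = Suc j") auto
qed auto

lemma good_dim: "good k e \<Longrightarrow> i \<le> k \<Longrightarrow> vec.dim (e i) = i"
  and good_TS: "good k e \<Longrightarrow> i \<le> k \<Longrightarrow> TS (e i)"
  and good_subspace: "good k e \<Longrightarrow> i \<le> k \<Longrightarrow> vec.subspace (e i)"
  by (auto simp: good_def TS_subspace)

lemma good_0: "good k e \<Longrightarrow> e 0 = {0}"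
  using good_dim[of k e 0] good_subspace[of k e 0] vec.subspace_0 by auto

lemma good_extend:
  "good k e \<Longrightarrow> TS U \<Longrightarrow> vec.dim U = Suc k \<Longrightarrow> e k \<subseteq> U \<Longrightarrow> good (Suc k) (e(Suc k := U))"
  unfolding good_def by (auto simp: le_Suc_eq less_Suc_eq)

lemma TS_0: "TS {0}" by (auto simp: totally_singular_def Q_0)

lemma exists_good: "TS D \<Longrightarrow> vec.dim D = m \<Longrightarrow> \<exists>e. good m e \<and> e m = D"
proof (induction m arbitrary: D)
  case 0
  then have "D = {0}" using vec.subspace_0 TS_subspace by (auto simp: vec.dim_eq_0)
  then show ?case by (intro exI[of _ "\<lambda>_. {0}"]) (auto simp: good_def TS_0)
next
  case (Suc m)
  obtain H where H: "vec.subspace H" "H \<subseteq> D" "vec.dim H = m"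
    using exists_hyperplane Suc.prems TS_subspace by metis
  then obtain e where "good m e" "e m = H" using Suc.IH TS_subset Suc.prems by metis
  then have "good (Suc m) (e(Suc m := D))" using good_extend[of m e D] Suc.prems H by simp
  then show ?case using fun_upd_same by metis
qed

lemma card_chains: "k \<le> n \<Longrightarrow> card (chains k) = (\<Prod>j<k. residue_points (n - j))"
proof (induction k)
  case 0
  have "chains 0 = {{{0}}}"
  proof
    show "chains 0 \<subseteq> {{{0}}}" using good_0 by (auto simp: chains_def)
    have "good 0 (\<lambda>_. {0})" by (simp add: good_def TS_0)
    then show "{{{0}}} \<subseteq> chains 0" using chains_I by force
  qed
  then show ?case by simp
next
  case (Suc k)
  define ex where "ex F = {U. TS U \<and> vec.dim U = Suc k \<and> lev F k \<subseteq> U}" for F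
  let ?f = "\<lambda>(F, U). insert U F"
  have dims: "vec.dim U \<le> k" if "F \<in> chains k" "U \<in> F" for F U
    using that by (auto simp: chains_def good_def)
  have "chains (Suc k) = ?f ` Sigma (chains k) ex"
  proof
    show "chains (Suc k) \<subseteq> ?f ` Sigma (chains k) ex"
    proof
      fix F assume "F \<in> chains (Suc k)"
      then obtain e where e: "good (Suc k) e" "F = e ` {0..Suc k}" unfolding chains_def by auto
      then have g: "good k e" by (simp add: good_def)
      have "e (Suc k) \<in> ex (e ` {0..k})"
        using e(1) by (simp add: ex_def lev_image[OF g] good_def)
      moreover have "F = insert (e (Suc k)) (e ` {0..k})"
        unfolding e(2) by (simp add: atLeast0_atMost_Suc)
      ultimately show "F \<in> ?f ` Sigma (chains k) ex" using chains_I[OF g] by force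
    qed
    show "?f ` Sigma (chains k) ex \<subseteq> chains (Suc k)"
    proof clarify
      fix F U assume F: "F \<in> chains k" and U: "U \<in> ex F"
      have "good (Suc k) ((lev F)(Suc k := U))"
        by (rule good_extend) (use chains_D(1)[OF F] U in \<open>auto simp: ex_def\<close>)
      from chains_I[OF this] have "((lev F)(Suc k := U)) ` {0..Suc k} \<in> chains (Suc k)" .
      moreover have "((lev F)(Suc k := U)) ` {0..Suc k} = insert U (lev F ` {0..k})"
      proof -
        have "((lev F)(Suc k := U)) ` {0..k} = lev F ` {0..k}" by (rule image_cong) auto
        then show ?thesis by (simp only: atLeast0_atMost_Suc[of k] image_insert fun_upd_same)
      qed
      ultimately show "insert U F \<in> chains (Suc k)" using chains_D(2)[OF F] by simp
    qed
  qed
  moreover have "inj_on ?f (Sigma (chains k) ex)"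
  proof (rule inj_onI, clarify)
    fix F U F' U' assume F: "F \<in> chains k" "F' \<in> chains k" and U: "U \<in> ex F" "U' \<in> ex F'"
      and eq: "insert U F = insert U' F'"
    have d: "vec.dim U = Suc k" "vec.dim U' = Suc k" using U by (auto simp: ex_def)
    then have 1: "U \<notin> F" "U' \<notin> F'" "U \<notin> F'" "U' \<notin> F" using dims F by force+
    then have "U = U'" using eq by auto
    then show "F = F' \<and> U = U'" using eq 1 by auto
  qed
  moreover have "card (ex F) = residue_points (n - k)" if "F \<in> chains k" for F
    using card_TS_extensions[of "lev F k"] chains_D(1)[OF that] Suc.prems
    by (simp add: ex_def good_def)
  ultimately have "card (chains (Suc k)) = card (chains k) * residue_points (n - k)"
    by (simp add: card_image card_SigmaI)
  then show ?case using Suc by simp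
qed

end

section \<open>Panel adjacency operators\<close>

text \<open>Turns iterated neighbour sums into sums weighted by numbers of paths, so that braid
  relations of operators become equalities of path counts.\<close>

lemma sum_sum_fibres:
  fixes g :: "'b \<Rightarrow> real"
  assumes "finite A" "finite X" "\<And>a. a \<in> A \<Longrightarrow> f a \<subseteq> X"
  shows "(\<Sum>a\<in>A. \<Sum>b\<in>f a. g b) = (\<Sum>b\<in>X. real (card {a\<in>A. b \<in> f a}) * g b)"
proof -
  have "(\<Sum>a\<in>A. \<Sum>b\<in>f a. g b) = (\<Sum>a\<in>A. \<Sum>b\<in>X. if b \<in> f a then g b else 0)"
  proof (rule sum.cong[OF refl])
    fix a assume "a \<in> A"
    then have "X \<inter> f a = f a" using assms(3) by auto
    then show "sum g (f a) = (\<Sum>b\<in>X. if b \<in> f a then g b else 0)"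
      using sum.inter_restrict[OF assms(2), of g "f a"] by simp
  qed
  also have "\<dots> = (\<Sum>b\<in>X. \<Sum>a\<in>A. if b \<in> f a then g b else 0)" by (rule sum.swap)
  also have "\<dots> = (\<Sum>b\<in>X. real (card {a\<in>A. b \<in> f a}) * g b)"
    using assms by (intro sum.cong refl) (simp add: sum.If_cases Int_def)
  finally show ?thesis .
qed

context hyperbolic_quadric
begin

abbreviation X :: "('a^'d) set set set" where "X \<equiv> chains n"

definition agree :: "nat \<Rightarrow> ('a^'d) set set \<Rightarrow> ('a^'d) set set \<Rightarrow> bool" where
  "agree i F F' \<longleftrightarrow> (\<forall>j\<le>n. j \<noteq> i \<longrightarrow> lev F j = lev F' j)"

definition nb :: "nat \<Rightarrow> ('a^'d) set set \<Rightarrow> ('a^'d) set set set" where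
  "nb i F = {F'\<in>X. agree i F F' \<and> F' \<noteq> F}"

lemma agree_sym: "agree i F F' \<Longrightarrow> agree i F' F" by (simp add: agree_def)
lemma agree_trans: "agree i F F' \<Longrightarrow> agree i F' F'' \<Longrightarrow> agree i F F''" by (simp add: agree_def)
lemma agreeD: "agree i F F' \<Longrightarrow> j \<le> n \<Longrightarrow> j \<noteq> i \<Longrightarrow> lev F j = lev F' j" by (simp add: agree_def)

lemma nb_D: "F' \<in> nb i F \<Longrightarrow> F' \<in> X \<and> agree i F F' \<and> F' \<noteq> F" by (simp add: nb_def)

lemma nb_sym: "F \<in> X \<Longrightarrow> F' \<in> nb i F \<Longrightarrow> F \<in> nb i F'"
  by (auto simp: nb_def agree_sym)

lemma agree_eqI: "F \<in> X \<Longrightarrow> F' \<in> X \<Longrightarrow> agree i F F' \<Longrightarrow> lev F i = lev F' i \<Longrightarrow> F = F'"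
  by (rule chains_eqI) (auto simp: agree_def)

lemma nb_lev: "F \<in> X \<Longrightarrow> F' \<in> nb i F \<Longrightarrow> lev F' i \<noteq> lev F i"
  using agree_eqI nb_D by metis

lemma X_dim: "F \<in> X \<Longrightarrow> i \<le> n \<Longrightarrow> vec.dim (lev F i) = i"
  and X_TS: "F \<in> X \<Longrightarrow> i \<le> n \<Longrightarrow> TS (lev F i)"
  and X_subspace: "F \<in> X \<Longrightarrow> i \<le> n \<Longrightarrow> vec.subspace (lev F i)"
  and X_mono: "F \<in> X \<Longrightarrow> i \<le> j \<Longrightarrow> j \<le> n \<Longrightarrow> lev F i \<subseteq> lev F j"
  and X_0: "F \<in> X \<Longrightarrow> lev F 0 = {0}"
  using chains_D(1) good_dim good_TS good_subspace good_mono good_0 by metis+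

lemma X_G: "F \<in> X \<Longrightarrow> lev F n \<in> G" by (simp add: G_iff X_TS X_dim)

definition upd :: "nat \<Rightarrow> ('a^'d) set \<Rightarrow> ('a^'d) set set \<Rightarrow> ('a^'d) set set" where
  "upd i U F = ((lev F)(i := U)) ` {0..n}"

lemma upd_props:
  assumes F: "F \<in> X" and i: "1 \<le> i" "i \<le> n" and U: "TS U" "vec.dim U = i" "lev F (i-1) \<subseteq> U"
    "i < n \<Longrightarrow> U \<subseteq> lev F (i+1)"
  shows "upd i U F \<in> X" "j \<le> n \<Longrightarrow> lev (upd i U F) j = (if j = i then U else lev F j)"
    "agree i F (upd i U F)"
proof -
  have g: "good n (lev F)" using chains_D(1)[OF F] .
  have "((lev F)(i := U)) j \<subseteq> ((lev F)(i := U)) (Suc j)" if "j < n" for j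
  proof -
    consider "j = i" | "Suc j = i" | "j \<noteq> i" "Suc j \<noteq> i" by blast
    then show ?thesis
      by cases (use U that i g in \<open>auto simp: good_def\<close>)
  qed
  then have g': "good n ((lev F)(i := U))" using g U by (simp add: good_def)
  show "upd i U F \<in> X" unfolding upd_def by (rule chains_I[OF g'])
  show L: "j \<le> n \<Longrightarrow> lev (upd i U F) j = (if j = i then U else lev F j)" for j
    unfolding upd_def by (subst lev_image[OF g']) auto
  show "agree i F (upd i U F)" unfolding agree_def using L by simp
qed

lemma nb_bij:
  assumes F: "F \<in> X" and i: "1 \<le> i" "i \<le> n"
  shows "card (nb i F) = card ({U. TS U \<and> vec.dim U = i \<and> lev F (i-1) \<subseteq> U \<and> (i < n \<longrightarrow> U \<subseteq> lev F (i+1))} - {lev F i})"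
    (is "_ = card (?S - _)")
proof -
  have "bij_betw (\<lambda>F'. lev F' i) (nb i F) (?S - {lev F i})"
  proof (rule bij_betwI[where g = "\<lambda>U. upd i U F"])
    show "(\<lambda>F'. lev F' i) \<in> nb i F \<rightarrow> ?S - {lev F i}"
    proof
      fix F' assume nb: "F' \<in> nb i F"
      then have F': "F' \<in> X" "agree i F F'" using nb_D by auto
      have "lev F (i-1) = lev F' (i-1)" using F' i by (intro agreeD) auto
      then have "lev F (i-1) \<subseteq> lev F' i" using X_mono[OF F'(1), of "i-1" i] i by simp
      moreover have "lev F' i \<subseteq> lev F (i+1)" if "i < n"
        using X_mono[OF F'(1), of i "i+1"] agreeD[OF F'(2), of "i+1"] that by simp
      ultimately show "lev F' i \<in> ?S - {lev F i}"
        using nb_lev[OF F nb] F' i X_TS X_dim by simp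
    qed
    show "(\<lambda>U. upd i U F) \<in> ?S - {lev F i} \<rightarrow> nb i F"
    proof
      fix U assume U: "U \<in> ?S - {lev F i}"
      note u = upd_props[OF F i, of U]
      have "lev (upd i U F) i \<noteq> lev F i" using u(2)[of i] U i by simp
      then show "upd i U F \<in> nb i F" unfolding nb_def using u(1,3) U by auto
    qed
    show "upd i (lev F' i) F = F'" if nb: "F' \<in> nb i F" for F'
    proof -
      have F': "F' \<in> X" "agree i F F'" using nb nb_D by auto
      have "lev F (i-1) = lev F' (i-1)" using F' i by (intro agreeD) auto
      then have 1: "lev F (i-1) \<subseteq> lev F' i" using X_mono[OF F'(1), of "i-1" i] i by simp
      have 2: "lev F' i \<subseteq> lev F (i+1)" if "i < n"
        using X_mono[OF F'(1), of i "i+1"] agreeD[OF F'(2), of "i+1"] that by simp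
      note u = upd_props[OF F i X_TS[OF F'(1) i(2)] X_dim[OF F'(1) i(2)] 1 2]
      show ?thesis using agreeD[OF F'(2)] u(2)
        by (intro chains_eqI[OF u(1) F'(1)]) auto
    qed
    show "lev (upd i U F) i = U" if "U \<in> ?S - {lev F i}" for U
      using upd_props(2)[OF F i, of U i] that i by auto
  qed
  then show ?thesis by (rule bij_betw_same_card)
qed

lemma card_nb:
  assumes F: "F \<in> X" and i: "1 \<le> i" "i \<le> n"
  shows "card (nb i F) = (if i = n then 1 else CARD('a))"
proof -
  let ?S = "{U. TS U \<and> vec.dim U = i \<and> lev F (i-1) \<subseteq> U \<and> (i < n \<longrightarrow> U \<subseteq> lev F (i+1))}"
  have inS: "lev F i \<in> ?S" using X_TS X_dim X_mono F i by simp
  have "card ?S = (if i = n then 2 else CARD('a) + 1)"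
  proof (cases "i = n")
    case True
    have "?S = {M\<in>G. lev F (n-1) \<subseteq> M}" using True by (auto simp: G_iff)
    then show ?thesis using card_generators_on[of "lev F (n-1)"] X_TS X_dim F True by simp
  next
    case False
    let ?q = "CARD('a)" and ?A = "lev F (i-1)" and ?C = "lev F (i+1)"
    have A: "vec.subspace ?A" "?A \<subseteq> ?C" "Suc (vec.dim ?A) = i" "vec.dim ?A = i - 1"
      using X_subspace X_mono X_dim F i False by auto
    have C: "TS ?C" "vec.subspace ?C" "vec.dim ?C = i + 1"
      using X_TS X_subspace X_dim F i False by auto
    have S: "?S = {U. vec.subspace U \<and> vec.dim U = Suc (vec.dim ?A) \<and> ?A \<subseteq> U \<and> U \<subseteq> ?C}"
      using False i A TS_subset[OF C(1)] by (auto simp: TS_subspace)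
    have "card ?S * (?q ^ i - ?q ^ (i-1)) = card ?C - ?q ^ (i-1)"
    proof -
      have "vec.span (insert v ?A) \<subseteq> ?C" if "v \<in> ?C" for v
        using that A(2) C(2) by (intro vec.span_minimal) auto
      moreover have "Suc (i - 1) = i" using i by simp
      ultimately show ?thesis
        unfolding S using card_extensions[OF A(1,2)] by (simp only: A(4))
    qed
    also have "\<dots> = ?q ^ (i+1) - ?q ^ (i-1)" using card_subspace[OF C(2)] C by simp
    also have "\<dots> = (?q + 1) * (?q ^ i - ?q ^ (i-1))"
      using i by (cases i) (simp_all add: algebra_simps)
    finally have eq: "card ?S * (?q ^ i - ?q ^ (i-1)) = (?q + 1) * (?q ^ i - ?q ^ (i-1))" .
    have "?q ^ (i-1) < ?q ^ i"
      using i card_field_gt_1[where 'a='a] by (intro power_strict_increasing) auto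
    then have nz: "?q ^ i - ?q ^ (i-1) \<noteq> 0" by simp
    have "card ?S = ?q + 1" by (rule mult_right_cancel[OF nz, THEN iffD1, OF eq])
    then show ?thesis using False by simp
  qed
  then show ?thesis unfolding nb_bij[OF F i] using inS by simp
qed

definition qi :: "nat \<Rightarrow> real" where "qi i = (if i = n then 1 else real CARD('a))"

text \<open>Off the chambers the operator is a scalar, chosen so that the Hecke relations hold on the whole
  coordinate space.\<close>

definition hop :: "nat \<Rightarrow> real^(('a^'d) set set) \<Rightarrow> real^(('a^'d) set set)" where
  "hop i x = (\<chi> F. if F \<in> X then \<Sum>F'\<in>nb i F. x $ F' else qi i * x $ F)"

lemma hop_in: "F \<in> X \<Longrightarrow> hop i x $ F = (\<Sum>F'\<in>nb i F. x $ F')" by (simp add: hop_def)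
lemma hop_out: "F \<notin> X \<Longrightarrow> hop i x $ F = qi i * x $ F" by (simp add: hop_def)

lemma linear_hop: "linear (hop i)"
  by (rule linearI) (auto simp: hop_def vec_eq_iff sum.distrib sum_distrib_left algebra_simps)

lemma hop_sym: "hop i x \<bullet> y = x \<bullet> hop i y"
proof -
  have in_X: "(\<Sum>F\<in>X. hop i x $ F * y $ F) = (\<Sum>F\<in>X. x $ F * hop i y $ F)"
    for x y :: "real^(('a^'d) set set)"
  proof -
    have "(\<Sum>F\<in>X. hop i x $ F * y $ F) = (\<Sum>F\<in>X. \<Sum>F'\<in>X. if F' \<in> nb i F then x $ F' * y $ F else 0)"
    proof (intro sum.cong refl)
      fix F assume F: "F \<in> X"
      have "nb i F \<subseteq> X" using nb_D by auto
      then show "hop i x $ F * y $ F = (\<Sum>F'\<in>X. if F' \<in> nb i F then x $ F' * y $ F else 0)"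
        by (simp add: hop_in F sum_distrib_right sum.inter_restrict[symmetric] Int_absorb1)
    qed
    also have "\<dots> = (\<Sum>F\<in>X. \<Sum>F'\<in>X. if F \<in> nb i F' then x $ F * y $ F' else 0)"
      by (rule sum.swap)
    also have "\<dots> = (\<Sum>F\<in>X. x $ F * hop i y $ F)"
    proof (intro sum.cong refl)
      fix F assume F: "F \<in> X"
      have "nb i F \<subseteq> X" using nb_D by auto
      moreover have "(\<Sum>F'\<in>X. if F \<in> nb i F' then x $ F * y $ F' else 0)
          = (\<Sum>F'\<in>X. if F' \<in> nb i F then x $ F * y $ F' else 0)"
        using nb_sym F by (intro sum.cong refl) auto
      ultimately show "(\<Sum>F'\<in>X. if F \<in> nb i F' then x $ F * y $ F' else 0) = x $ F * hop i y $ F"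
        by (simp add: hop_in F sum_distrib_left sum.inter_restrict[symmetric] Int_absorb1)
    qed
    finally show ?thesis .
  qed
  have split: "u \<bullet> v = (\<Sum>F\<in>X. u $ F * v $ F) + (\<Sum>F\<in>-X. u $ F * v $ F)" for u v :: "real^(('a^'d) set set)"
    unfolding inner_vec_def by (simp add: sum.subset_diff[of X UNIV] Compl_eq_Diff_UNIV)
  have "(\<Sum>F\<in>-X. hop i x $ F * y $ F) = (\<Sum>F\<in>-X. x $ F * hop i y $ F)"
    by (intro sum.cong refl) (simp add: hop_out)
  then show ?thesis unfolding split by (simp add: in_X)
qed

lemma hop_quad:
  assumes i: "1 \<le> i" "i \<le> n"
  shows "hop i (hop i x) = (qi i - 1) *\<^sub>R hop i x + qi i *\<^sub>R x"
proof -
  have "hop i (hop i x) $ F = (qi i - 1) * hop i x $ F + qi i * x $ F" for F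
  proof (cases "F \<in> X")
    case False then show ?thesis by (simp add: hop_out algebra_simps)
  next
    case True
    \<comment> \<open>The sum of \<open>x\<close> over the whole \<open>i\<close>-panel of
      \<open>F\<close>, common to all chambers of the panel.\<close>
    define S where "S = x $ F + (\<Sum>F'\<in>nb i F. x $ F')"
    have "hop i x $ F' = S - x $ F'" if "F' \<in> nb i F" for F'
    proof -
      have F': "F' \<in> X" "agree i F F'" "F' \<noteq> F" using nb_D that by auto
      have "insert F' (nb i F') = insert F (nb i F)"
        using F' True agree_trans agree_sym unfolding nb_def by (auto simp: agree_def)
      moreover have "(\<Sum>G\<in>insert F' (nb i F'). x $ G) = x $ F' + hop i x $ F'"
        by (simp add: hop_in F' nb_def)
      moreover have "(\<Sum>G\<in>insert F (nb i F). x $ G) = S" by (simp add: S_def nb_def)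
      ultimately show ?thesis by simp
    qed
    then have "hop i (hop i x) $ F = (\<Sum>F'\<in>nb i F. S - x $ F')"
      by (simp add: hop_in[OF True])
    also have "\<dots> = qi i * S - (S - x $ F)"
      by (simp add: sum_subtractf card_nb[OF True i] S_def qi_def)
    finally show ?thesis by (simp add: hop_in[OF True] S_def algebra_simps)
  qed
  then show ?thesis by (simp add: vec_eq_iff)
qed

lemma middle_unique:
  assumes "F2 \<in> X" "F2' \<in> X" "agree j F1 F2" "agree i F2 F3" "agree j F1 F2'" "agree i F2' F3" "i \<noteq> j"
  shows "F2 = F2'"
proof (rule chains_eqI[OF assms(1,2)])
  fix k assume "k \<le> n"
  then show "lev F2 k = lev F2' k" using assms by (cases "k = j") (auto simp: agree_def)
qed

lemma card_middle:
  assumes "i \<noteq> j"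
  shows "card {F1\<in>nb i F. F2 \<in> nb j F1} = of_bool ({F1\<in>nb i F. F2 \<in> nb j F1} \<noteq> {})"
  by (rule card_subsingleton) (use assms middle_unique[of _ _ i F j F2] nb_D in blast)

lemma hop2: "F \<in> X \<Longrightarrow> hop i (hop j x) $ F = (\<Sum>F2\<in>X. real (card {F1\<in>nb i F. F2 \<in> nb j F1}) * x $ F2)"
proof -
  assume F: "F \<in> X"
  have "hop i (hop j x) $ F = (\<Sum>F1\<in>nb i F. \<Sum>F2\<in>nb j F1. x $ F2)"
    unfolding hop_in[OF F] by (intro sum.cong refl hop_in) (use nb_D in blast)
  also have "\<dots> = (\<Sum>F2\<in>X. real (card {F1\<in>nb i F. F2 \<in> nb j F1}) * x $ F2)"
    by (rule sum_sum_fibres) (use nb_D in auto)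
  finally show ?thesis .
qed

text \<open>Levels \<open>i\<close> and \<open>j\<close> are not neighbours, so the new level
  \<open>j\<close> satisfies the same inclusions whether it is put in before or after the change at
  level \<open>i\<close>.\<close>

lemma far_middle:
  assumes ij: "1 \<le> i" "i \<le> n" "1 \<le> j" "j \<le> n" "i + 1 < j \<or> j + 1 < i" and F: "F \<in> X"
    and F1: "F1 \<in> nb i F" "F2 \<in> nb j F1"
  shows "\<exists>F1'\<in>nb j F. F2 \<in> nb i F1'"
proof -
  have X1: "F1 \<in> X" "agree i F F1" "F1 \<noteq> F" and X2: "F2 \<in> X" "agree j F1 F2" "F2 \<noteq> F1"
    using F1 nb_D by auto
  let ?U = "lev F2 j"
  have 1: "lev F (j-1) \<subseteq> ?U"
    using agreeD[OF X1(2), of "j-1"] agreeD[OF X2(2), of "j-1"] X_mono[OF X2(1), of "j-1" j] ij by auto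
  have 2: "?U \<subseteq> lev F (j+1)" if "j < n"
    using agreeD[OF X1(2), of "j+1"] agreeD[OF X2(2), of "j+1"] X_mono[OF X2(1), of j "j+1"] ij that by auto
  note u = upd_props[OF F ij(3,4) X_TS[OF X2(1) ij(4)] X_dim[OF X2(1) ij(4)] 1 2]
  let ?F = "upd j ?U F"
  have "lev F2 j \<noteq> lev F1 j" using nb_lev[OF X1(1) F1(2)] .
  then have "?F \<noteq> F" using agreeD[OF X1(2), of j] u(2)[of j] ij by auto
  moreover have ag: "agree i ?F F2" unfolding agree_def
    using u(2) agreeD[OF X1(2)] agreeD[OF X2(2)] by auto
  moreover have "F2 \<noteq> ?F"
  proof
    assume "F2 = ?F"
    then have "lev F i = lev F2 i" using u(2)[of i] ij by auto
    also have "\<dots> = lev F1 i" using agreeD[OF X2(2), of i] ij by auto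
    finally show False using agree_eqI[OF F X1(1,2)] X1(3) by auto
  qed
  ultimately show ?thesis using u X2 unfolding nb_def by blast
qed

lemma hop_comm:
  assumes ij: "1 \<le> i" "i + 1 < j" "j \<le> n"
  shows "hop i (hop j x) = hop j (hop i x)"
proof -
  have "hop i (hop j x) $ F = hop j (hop i x) $ F" for F
  proof (cases "F \<in> X")
    case False then show ?thesis by (simp add: hop_out)
  next
    case True
    have eq: "card {F1\<in>nb i F. F2 \<in> nb j F1} = card {F1\<in>nb j F. F2 \<in> nb i F1}" for F2
    proof -
      have "{F1\<in>nb i F. F2 \<in> nb j F1} \<noteq> {} \<longleftrightarrow> {F1\<in>nb j F. F2 \<in> nb i F1} \<noteq> {}"
        using far_middle[of i j F _ F2] far_middle[of j i F _ F2] True ij by fastforce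
      then show ?thesis using card_middle[of i j F F2] card_middle[of j i F F2] ij by simp
    qed
    show ?thesis unfolding hop2[OF True] by (simp add: eq)
  qed
  then show ?thesis by (simp add: vec_eq_iff)
qed

section \<open>The braid relation of length three\<close>

definition paths3 :: "nat \<Rightarrow> nat \<Rightarrow> ('a^'d) set set \<Rightarrow> ('a^'d) set set \<Rightarrow> (('a^'d) set set \<times> ('a^'d) set set) set" where
  "paths3 i j F F3 = {p\<in>Sigma (nb i F) (nb j). F3 \<in> nb i (snd p)}"

lemma hop3: "F \<in> X \<Longrightarrow> hop i (hop j (hop i x)) $ F = (\<Sum>F3\<in>X. real (card (paths3 i j F F3)) * x $ F3)"
proof -
  assume F: "F \<in> X"
  have "hop i (hop j (hop i x)) $ F = (\<Sum>F1\<in>nb i F. \<Sum>F2\<in>nb j F1. hop i x $ F2)"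
    unfolding hop_in[OF F] by (intro sum.cong refl hop_in) (use nb_D in blast)
  also have "\<dots> = (\<Sum>F1\<in>nb i F. \<Sum>F2\<in>nb j F1. \<Sum>F3\<in>nb i F2. x $ F3)"
    by (intro sum.cong refl hop_in) (use nb_D in blast)
  also have "\<dots> = (\<Sum>p\<in>Sigma (nb i F) (nb j). \<Sum>F3\<in>nb i (snd p). x $ F3)"
    by (subst sum.Sigma) (auto simp: split_def)
  also have "\<dots> = (\<Sum>F3\<in>X. real (card (paths3 i j F F3)) * x $ F3)"
    unfolding paths3_def by (rule sum_sum_fibres) (use nb_D in auto)
  finally show ?thesis .
qed

text \<open>Opposition of point-line flags in the projective plane
  \<open>lev F (i+2) / lev F (i-1)\<close>: neither point lies on the line of the other
  flag.\<close>

definition opp3 :: "nat \<Rightarrow> ('a^'d) set set \<Rightarrow> ('a^'d) set set \<Rightarrow> bool" where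
  "opp3 i F F3 \<longleftrightarrow> (\<forall>k\<le>n. k \<noteq> i \<longrightarrow> k \<noteq> i+1 \<longrightarrow> lev F k = lev F3 k) \<and>
     \<not> lev F i \<subseteq> lev F3 (i+1) \<and> \<not> lev F3 i \<subseteq> lev F (i+1)"

lemma X_dim_inter:
  assumes F: "F \<in> X" "F' \<in> X" and i: "Suc i \<le> n" and ne: "lev F (Suc i) \<noteq> lev F' (Suc i)"
    and U: "vec.subspace U" "vec.dim U = i" "U \<subseteq> lev F (Suc i)" "U \<subseteq> lev F' (Suc i)"
  shows "U = lev F (Suc i) \<inter> lev F' (Suc i)"
proof (rule vec.subspace_dim_equal)
  let ?I = "lev F (Suc i) \<inter> lev F' (Suc i)"
  show s: "vec.subspace ?I" using X_subspace F i by (auto intro: vec.subspace_inter)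
  have "vec.dim ?I \<noteq> Suc i"
  proof
    assume d: "vec.dim ?I = Suc i"
    have "?I = lev F (Suc i)" "?I = lev F' (Suc i)"
      by (rule vec_subspace_eqI; use F i s d X_subspace X_dim in auto)+
    then show False using ne by auto
  qed
  moreover have "vec.dim ?I \<le> Suc i"
    using vec.dim_subset[of ?I "lev F (Suc i)"] X_dim F i by auto
  ultimately show "vec.dim ?I \<le> vec.dim U" using U by simp
qed (use U in auto)

lemma X_dim_sum:
  assumes F: "F \<in> X" "F' \<in> X" and i: "i \<le> n" and ne: "lev F i \<noteq> lev F' i"
    and U: "vec.subspace U" "vec.dim U = Suc i" "lev F i \<subseteq> U" "lev F' i \<subseteq> U"
  shows "U = vec.span (lev F i \<union> lev F' i)"
proof -
  obtain v where v: "v \<in> lev F' i" "v \<notin> lev F i"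
    using ne vec_subspace_eqI[of "lev F' i" "lev F i"] X_subspace X_dim F i by auto
  have "vec.span (insert v (lev F i)) = U"
    by (rule span_insert_eq) (use X_subspace X_dim F i U v in auto)
  moreover have "vec.span (insert v (lev F i)) \<subseteq> vec.span (lev F i \<union> lev F' i)"
    using v by (intro vec.span_mono) auto
  moreover have "vec.span (lev F i \<union> lev F' i) \<subseteq> U" using U by (intro vec.span_minimal) auto
  ultimately show ?thesis by auto
qed

text \<open>The point \<open>lev F1 i\<close> of a path must be the meet of the lines
  \<open>lev F (i+1)\<close> and \<open>lev F3 (i+1)\<close>, which leaves at most one path; it
  exists exactly for opposite flags.\<close>

lemma paths3_up:
  assumes i: "1 \<le> i" "i + 1 < n" and F: "F \<in> X" "F3 \<in> X"
  shows "card (paths3 i (i+1) F F3) = of_bool (opp3 i F F3)"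
proof -
  have D: "opp3 i F F3 \<and> lev F1 i = lev F (i+1) \<inter> lev F3 (i+1)"
    if p: "(F1, F2) \<in> paths3 i (i+1) F F3" for F1 F2
  proof -
    have nbs: "F1 \<in> nb i F" "F2 \<in> nb (i+1) F1" "F3 \<in> nb i F2" using p by (auto simp: paths3_def)
    have X: "F1 \<in> X" "F2 \<in> X" and ag: "agree i F F1" "agree (i+1) F1 F2" "agree i F2 F3"
      using nbs nb_D by auto
    have ne: "lev F1 i \<noteq> lev F i" "lev F2 (i+1) \<noteq> lev F1 (i+1)" "lev F3 i \<noteq> lev F2 i"
      using nb_lev nbs F X by auto
    have e: "lev F1 (i+1) = lev F (i+1)" "lev F2 (i+1) = lev F3 (i+1)" "lev F2 i = lev F1 i"
      using agreeD[OF ag(1), of "i+1"] agreeD[OF ag(3), of "i+1"] agreeD[OF ag(2), of i] i by auto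
    have sub: "lev F1 i \<subseteq> lev F (i+1)" "lev F1 i \<subseteq> lev F3 (i+1)"
      using X_mono[OF X(1), of i "i+1"] X_mono[OF X(2), of i "i+1"] e i by auto
    have I: "lev F1 i = lev F (Suc i) \<inter> lev F3 (Suc i)"
      by (rule X_dim_inter) (use F i X_subspace X_dim X sub ne e in auto)
    have n1: "\<not> lev F i \<subseteq> lev F3 (i+1)"
    proof
      assume "lev F i \<subseteq> lev F3 (i+1)"
      then have "lev F i \<subseteq> lev F1 i" using I X_mono[OF F(1), of i "i+1"] i by auto
      then show False using ne vec_subspace_eqI[of "lev F i" "lev F1 i"] X_subspace X_dim F X i by auto
    qed
    have n2: "\<not> lev F3 i \<subseteq> lev F (i+1)"
    proof
      assume "lev F3 i \<subseteq> lev F (i+1)"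
      then have "lev F3 i \<subseteq> lev F1 i" using I X_mono[OF F(2), of i "i+1"] i by auto
      then show False using ne e vec_subspace_eqI[of "lev F3 i" "lev F1 i"] X_subspace X_dim F X i by auto
    qed
    have "lev F k = lev F3 k" if "k \<le> n" "k \<noteq> i" "k \<noteq> i+1" for k
      using agreeD[OF ag(1), of k] agreeD[OF ag(2), of k] agreeD[OF ag(3), of k] that by simp
    then show ?thesis using n1 n2 I by (auto simp: opp3_def)
  qed
  have unique: "p = p'" if pp: "p \<in> paths3 i (i+1) F F3" "p' \<in> paths3 i (i+1) F F3" for p p'
  proof -
    obtain F1 F2 F1' F2' where p: "p = (F1, F2)" "p' = (F1', F2')" by fastforce
    have X: "F1 \<in> X" "F1' \<in> X" "F2 \<in> X" "F2' \<in> X" and ag: "agree i F F1" "agree i F F1'"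
      "agree (i+1) F1 F2" "agree i F2 F3" "agree (i+1) F1' F2'" "agree i F2' F3"
      using pp nb_D unfolding p paths3_def by auto
    have "F1 = F1'"
      by (rule agree_eqI[OF X(1,2) agree_trans[OF agree_sym[OF ag(1)] ag(2)]])
        (use D pp p in auto)
    moreover from this have "F2 = F2'"
      using ag X by (intro middle_unique[of F2 F2' "i+1" F1 i F3]) auto
    ultimately show ?thesis using p by simp
  qed
  have "paths3 i (i+1) F F3 \<noteq> {}" if o: "opp3 i F F3"
  proof -
    let ?l = "lev F (i+1)" and ?l3 = "lev F3 (i+1)" and ?m = "lev F (i+2)"
    have e: "lev F3 k = lev F k" if "k \<le> n" "k \<noteq> i" "k \<noteq> i+1" for k
      using o that by (simp add: opp3_def)
    have n12: "\<not> lev F i \<subseteq> ?l3" "\<not> lev F3 i \<subseteq> ?l" using o by (auto simp: opp3_def)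
    have mono: "lev F i \<subseteq> ?l" "lev F3 i \<subseteq> ?l3" "?l \<subseteq> ?m" "lev F (i-1) \<subseteq> ?l"
      using X_mono[OF F(1)] X_mono[OF F(2)] i by auto
    have mono3: "?l3 \<subseteq> ?m" "lev F (i-1) \<subseteq> ?l3"
      using X_mono[OF F(2), of "i+1" "i+2"] X_mono[OF F(2), of "i-1" "i+1"] e[of "i+2"] e[of "i-1"] i by auto
    have ne: "?l \<noteq> ?l3" using n12 mono by auto
    have s: "vec.subspace ?l" "vec.subspace ?l3" "TS ?l" using X_subspace X_TS F i by auto
    let ?p = "?l \<inter> ?l3"
    have sp: "vec.subspace ?p" using s by (simp add: vec.subspace_inter)
    have "vec.dim (vec.span (?l \<union> ?l3)) \<le> vec.dim ?m"
      using mono mono3 X_subspace[OF F(1), of "i+2"] i by (intro vec.dim_subset vec.span_minimal) auto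
    then have "i \<le> vec.dim ?p"
      using dim_span_Un_Int[OF s(1,2)] X_dim F i by simp
    moreover have "vec.dim ?p < i + 1"
    proof -
      have "vec.dim ?p \<le> i + 1" using vec.dim_subset[of ?p ?l] X_dim F i by simp
      moreover have "vec.dim ?p \<noteq> i + 1"
      proof
        assume "vec.dim ?p = i + 1"
        then have "?p = ?l" using sp s X_dim F i by (intro vec_subspace_eqI) auto
        then show False using n12 mono by auto
      qed
      ultimately show ?thesis by simp
    qed
    ultimately have dp: "vec.dim ?p = i" by simp
    have i': "1 \<le> i" "i \<le> n" "1 \<le> i+1" "i+1 \<le> n" using i by auto
    have tp: "TS ?p" using TS_subset[OF s(3) sp] by auto
    have up: "lev F (i-1) \<subseteq> ?p" "?p \<subseteq> lev F (i+1)" using mono mono3 by auto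
    note u1 = upd_props[OF F(1) i'(1,2) tp dp up]
    let ?F1 = "upd i ?p F"
    have v1: "lev ?F1 (i+1-1) \<subseteq> ?l3" using u1(2)[of i] i' by simp
    have v2: "?l3 \<subseteq> lev ?F1 (i+1+1)" using u1(2)[of "i+2"] i mono3 by simp
    note u2 = upd_props[OF u1(1) i'(3,4) X_TS[OF F(2) i'(4)] X_dim[OF F(2) i'(4)] v1 v2]
    let ?F2 = "upd (i+1) ?l3 ?F1"
    have l1: "lev ?F1 i = ?p" "lev ?F1 (i+1) = ?l" using u1(2)[of i] u1(2)[of "i+1"] i' by auto
    have l2: "lev ?F2 i = ?p" "lev ?F2 (i+1) = ?l3" using u2(2)[of i] u2(2)[of "i+1"] i' l1 by auto
    have "?p \<noteq> lev F i" "?p \<noteq> lev F3 i" using n12 by auto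
    then have d: "?F1 \<noteq> F" "?F2 \<noteq> ?F1" "F3 \<noteq> ?F2" using l1 l2 ne by auto
    have "agree i ?F2 F3" unfolding agree_def
      using u2(2) u1(2) e i by auto
    then have "(?F1, ?F2) \<in> paths3 i (i+1) F F3"
      using d u1 u2 F unfolding paths3_def nb_def by auto
    then show ?thesis by auto
  qed
  then have "paths3 i (i+1) F F3 \<noteq> {} \<longleftrightarrow> opp3 i F F3" using D by auto
  then show ?thesis using card_subsingleton[OF unique] by simp
qed

text \<open>Dual to \<open>paths3_up\<close>: the line \<open>lev F1 (i+1)\<close> must be the join
  of the points \<open>lev F i\<close> and \<open>lev F3 i\<close>.\<close>

lemma paths3_down:
  assumes i: "1 \<le> i" "i + 1 < n" and F: "F \<in> X" "F3 \<in> X"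
  shows "card (paths3 (i+1) i F F3) = of_bool (opp3 i F F3)"
proof -
  have D: "opp3 i F F3 \<and> lev F1 (i+1) = vec.span (lev F i \<union> lev F3 i)"
    if p: "(F1, F2) \<in> paths3 (i+1) i F F3" for F1 F2
  proof -
    have nbs: "F1 \<in> nb (i+1) F" "F2 \<in> nb i F1" "F3 \<in> nb (i+1) F2" using p by (auto simp: paths3_def)
    have X: "F1 \<in> X" "F2 \<in> X" and ag: "agree (i+1) F F1" "agree i F1 F2" "agree (i+1) F2 F3"
      using nbs nb_D by auto
    have ne: "lev F1 (i+1) \<noteq> lev F (i+1)" "lev F2 i \<noteq> lev F1 i" "lev F3 (i+1) \<noteq> lev F2 (i+1)"
      using nb_lev nbs F X by auto
    have e: "lev F1 i = lev F i" "lev F2 i = lev F3 i" "lev F2 (i+1) = lev F1 (i+1)"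
      using agreeD[OF ag(1), of i] agreeD[OF ag(3), of i] agreeD[OF ag(2), of "i+1"] i by auto
    have sub: "lev F i \<subseteq> lev F1 (i+1)" "lev F3 i \<subseteq> lev F1 (i+1)"
      using X_mono[OF X(1), of i "i+1"] X_mono[OF X(2), of i "i+1"] e i by auto
    have ne2: "lev F i \<noteq> lev F3 i" using ne e by auto
    have I: "lev F1 (i+1) = vec.span (lev F i \<union> lev F3 i)"
      by (rule X_dim_sum) (use F i X_subspace X_dim X sub ne2 in auto)
    have eqI: "lev A (i+1) = lev F1 (i+1)" if "A \<in> X" "lev F i \<subseteq> lev A (i+1)" "lev F3 i \<subseteq> lev A (i+1)" for A
      unfolding I by (rule X_dim_sum) (use F i X_subspace X_dim that ne2 in auto)
    have n1: "\<not> lev F i \<subseteq> lev F3 (i+1)"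
      using eqI[OF F(2)] X_mono[OF F(2), of i "i+1"] i ne e by auto
    have n2: "\<not> lev F3 i \<subseteq> lev F (i+1)"
      using eqI[OF F(1)] X_mono[OF F(1), of i "i+1"] i ne e by auto
    have "lev F k = lev F3 k" if "k \<le> n" "k \<noteq> i" "k \<noteq> i+1" for k
      using agreeD[OF ag(1), of k] agreeD[OF ag(2), of k] agreeD[OF ag(3), of k] that by simp
    then show ?thesis using n1 n2 I by (auto simp: opp3_def)
  qed
  have unique: "p = p'" if pp: "p \<in> paths3 (i+1) i F F3" "p' \<in> paths3 (i+1) i F F3" for p p'
  proof -
    obtain F1 F2 F1' F2' where p: "p = (F1, F2)" "p' = (F1', F2')" by fastforce
    have X: "F1 \<in> X" "F1' \<in> X" "F2 \<in> X" "F2' \<in> X" and ag: "agree (i+1) F F1" "agree (i+1) F F1'"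
      "agree i F1 F2" "agree (i+1) F2 F3" "agree i F1' F2'" "agree (i+1) F2' F3"
      using pp nb_D unfolding p paths3_def by auto
    have "F1 = F1'"
      by (rule agree_eqI[OF X(1,2) agree_trans[OF agree_sym[OF ag(1)] ag(2)]])
        (use D pp p in auto)
    moreover from this have "F2 = F2'"
      using ag X by (intro middle_unique[of F2 F2' i F1 "i+1" F3]) auto
    ultimately show ?thesis using p by simp
  qed
  have "paths3 (i+1) i F F3 \<noteq> {}" if o: "opp3 i F F3"
  proof -
    let ?p = "lev F i" and ?p3 = "lev F3 i" and ?m = "lev F (i+2)"
    have e: "lev F3 k = lev F k" if "k \<le> n" "k \<noteq> i" "k \<noteq> i+1" for k
      using o that by (simp add: opp3_def)
    have n12: "\<not> ?p \<subseteq> lev F3 (i+1)" "\<not> ?p3 \<subseteq> lev F (i+1)" using o by (auto simp: opp3_def)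
    have mono: "?p \<subseteq> lev F (i+1)" "?p3 \<subseteq> lev F3 (i+1)" "?p \<subseteq> ?m" "lev F (i-1) \<subseteq> ?p"
      using X_mono[OF F(1)] X_mono[OF F(2)] i by auto
    have mono3: "?p3 \<subseteq> ?m" "lev F (i-1) \<subseteq> ?p3"
      using X_mono[OF F(2), of i "i+2"] X_mono[OF F(2), of "i-1" i] e[of "i+2"] e[of "i-1"] i by auto
    have ne: "?p \<noteq> ?p3" using n12 mono by auto
    have s: "vec.subspace ?p" "vec.subspace ?p3" "vec.subspace ?m" "TS ?m" using X_subspace X_TS F i by auto
    let ?l = "vec.span (?p \<union> ?p3)"
    have lm: "?l \<subseteq> ?m" using mono mono3 s by (intro vec.span_minimal) auto
    have tl: "TS ?l" using TS_subset[OF s(4) _ lm] by simp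
    have "vec.dim (lev F (i-1)) \<le> vec.dim (?p \<inter> ?p3)" using mono mono3 by (intro vec.dim_subset) auto
    then have "vec.dim ?l \<le> i + 1"
      using dim_span_Un_Int[OF s(1,2)] X_dim F i by simp
    moreover have "i < vec.dim ?l"
    proof -
      obtain v where v: "v \<in> ?p3" "v \<notin> ?p" using n12 mono by auto
      have "vec.dim (vec.span (insert v ?p)) \<le> vec.dim ?l"
        using v by (intro vec.dim_subset vec.span_mono) auto
      then show ?thesis using dim_insert_new[OF s(1) v(2)] X_dim F i by simp
    qed
    ultimately have dl: "vec.dim ?l = i + 1" by simp
    have i': "1 \<le> i" "i \<le> n" "1 \<le> i+1" "i+1 \<le> n" using i by auto
    have pl: "?p \<subseteq> ?l" "?p3 \<subseteq> ?l" using vec.span_superset[of "?p \<union> ?p3"] by auto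
    have up: "lev F (i+1-1) \<subseteq> ?l" "?l \<subseteq> lev F (i+1+1)" using pl lm by auto
    note u1 = upd_props[OF F(1) i'(3,4) tl dl up]
    let ?F1 = "upd (i+1) ?l F"
    have "i - 1 \<noteq> i + 1" by simp
    then have v1: "lev ?F1 (i-1) \<subseteq> ?p3" using u1(2)[of "i-1"] i' mono3 by simp
    have v2: "?p3 \<subseteq> lev ?F1 (i+1)" using u1(2)[of "i+1"] i pl by simp
    note u2 = upd_props[OF u1(1) i'(1,2) X_TS[OF F(2) i'(2)] X_dim[OF F(2) i'(2)] v1 v2]
    let ?F2 = "upd i ?p3 ?F1"
    have l1: "lev ?F1 i = ?p" "lev ?F1 (i+1) = ?l" using u1(2)[of i] u1(2)[of "i+1"] i' by auto
    have l2: "lev ?F2 i = ?p3" "lev ?F2 (i+1) = ?l" using u2(2)[of i] u2(2)[of "i+1"] i' l1 by auto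
    have "?l \<noteq> lev F (i+1)" "?l \<noteq> lev F3 (i+1)" using n12 pl by auto
    then have d: "?F1 \<noteq> F" "?F2 \<noteq> ?F1" "F3 \<noteq> ?F2" using l1 l2 ne by auto
    have "agree (i+1) ?F2 F3" unfolding agree_def
      using u2(2) u1(2) e i by auto
    then have "(?F1, ?F2) \<in> paths3 (i+1) i F F3"
      using d u1 u2 F unfolding paths3_def nb_def by auto
    then show ?thesis by auto
  qed
  then have "paths3 (i+1) i F F3 \<noteq> {} \<longleftrightarrow> opp3 i F F3" using D by auto
  then show ?thesis using card_subsingleton[OF unique] by simp
qed

lemma hop_braid3:
  assumes i: "1 \<le> i" "i + 1 < n"
  shows "hop i (hop (i+1) (hop i x)) = hop (i+1) (hop i (hop (i+1) x))"
proof -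
  have "hop i (hop (i+1) (hop i x)) $ F = hop (i+1) (hop i (hop (i+1) x)) $ F" for F
  proof (cases "F \<in> X")
    case False then show ?thesis using i by (simp add: hop_out qi_def)
  next
    case True
    show ?thesis unfolding hop3[OF True]
      by (intro sum.cong refl) (simp only: paths3_up[OF i True] paths3_down[OF i True])
  qed
  then show ?thesis by (simp add: vec_eq_iff)
qed

end

section \<open>The ratio bound\<close>

context hyperbolic_quadric
begin

section \<open>The exchange of generators and the braid relation of length four\<close>

definition swp :: "('a^'d) set set \<Rightarrow> ('a^'d) set set" where
  "swp F = (THE F'. F' \<in> nb n F)"

lemma nb_n: assumes "F \<in> X" shows "nb n F = {swp F}"
proof -
  have "card (nb n F) = 1" using card_nb[OF assms, of n] n2 by simp
  then obtain F' where F': "nb n F = {F'}" using card_1_singletonE by blast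
  then have "swp F = F'" unfolding swp_def by simp
  then show ?thesis using F' by simp
qed

lemma swp_props:
  assumes F: "F \<in> X"
  shows "swp F \<in> X" "swp (swp F) = F" "swp F \<noteq> F" "j < n \<Longrightarrow> lev (swp F) j = lev F j"
    "lev (swp F) n \<noteq> lev F n" "lev (swp F) n \<in> G"
proof -
  have s: "swp F \<in> nb n F" using nb_n[OF F] by simp
  then show X: "swp F \<in> X" and "swp F \<noteq> F" and "j < n \<Longrightarrow> lev (swp F) j = lev F j"
    using nb_D[OF s] by (auto simp: agree_def)
  show "lev (swp F) n \<noteq> lev F n" by (rule nb_lev[OF F s])
  show "swp (swp F) = F" using nb_sym[OF F s] nb_n[OF X] by simp
  show "lev (swp F) n \<in> G" by (rule X_G[OF X])
qed

lemma hop_n: "F \<in> X \<Longrightarrow> hop n x $ F = x $ swp F"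
  by (simp add: hop_in nb_n)

abbreviation top2 :: "('a^'d) set set \<Rightarrow> ('a^'d) set" where "top2 F \<equiv> lev (swp F) n"

lemma top_inter: assumes F: "F \<in> X" shows "lev F n \<inter> top2 F = lev F (n-1)"
proof (rule G_inter_eq)
  show "lev F n \<noteq> top2 F" using swp_props(5)[OF F] by auto
  show "lev F (n-1) \<subseteq> top2 F"
    using X_mono[OF swp_props(1)[OF F], of "n-1" n] swp_props(4)[OF F, of "n-1"] n2 by simp
qed (use F X_G swp_props X_subspace X_dim X_mono in auto)

lemma top_not_same: assumes F: "F \<in> X" shows "\<not> same (lev F n) (top2 F)"
  using adjacent_not_same[OF X_G[OF F] swp_props(6)[OF F]] top_inter[OF F] X_dim[OF F, of "n-1"] by simp

lemma top2_I:
  assumes F: "F \<in> X" and N: "N \<in> G" "lev F (n-1) \<subseteq> N" "N \<noteq> lev F n"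
  shows "top2 F = N"
proof -
  have "lev F (n-1) \<subseteq> top2 F" using top_inter[OF F] by auto
  moreover have "lev F (n-1) \<subseteq> lev F n" using X_mono[OF F] by simp
  ultimately have "N = lev F n \<or> N = top2 F"
    using F N X_TS X_dim X_G swp_props(5,6)[OF F]
    by (intro generators_on_cases[of "lev F (n-1)"]) auto
  then show ?thesis using N by auto
qed

text \<open>Among chambers with the same lower part, \<open>F\<close> is determined by the pair of
  adjacent generators \<open>lev F n\<close> and \<open>top2 F\<close>. These pairs form two square
  grids, one for each class of \<open>lev F n\<close>.\<close>

definition low :: "('a^'d) set set \<Rightarrow> ('a^'d) set set \<Rightarrow> bool" where
  "low F F' \<longleftrightarrow> (\<forall>j\<le>n-2. lev F j = lev F' j)"

lemma low_sym: "low F F' \<Longrightarrow> low F' F" by (simp add: low_def)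
lemma low_trans: "low F F' \<Longrightarrow> low F' F'' \<Longrightarrow> low F F''" by (simp add: low_def)

lemma low_swp: "F \<in> X \<Longrightarrow> low F (swp F)" using swp_props(4) n2 by (simp add: low_def)

lemma low_eqI:
  assumes F: "F \<in> X" "F' \<in> X" and e: "low F F'" "lev F n = lev F' n" "top2 F = top2 F'"
  shows "F = F'"
proof (rule chains_eqI[OF F])
  fix i assume "i \<le> n"
  then consider "i \<le> n - 2" | "i = n - 1" | "i = n" by linarith
  then show "lev F i = lev F' i"
    using e top_inter[OF F(1)] top_inter[OF F(2)] by cases (auto simp: low_def)
qed

lemma nb_pred:
  assumes F: "F \<in> X"
  shows "nb (n-1) F = {F'\<in>X. low F F' \<and> lev F' n = lev F n \<and> F' \<noteq> F}"
proof -
  have "agree (n-1) F F' \<longleftrightarrow> low F F' \<and> lev F' n = lev F n" for F'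
  proof
    assume a: "agree (n-1) F F'"
    then show "low F F' \<and> lev F' n = lev F n" using n2 by (auto simp: agree_def low_def)
  next
    assume a: "low F F' \<and> lev F' n = lev F n"
    show "agree (n-1) F F'" unfolding agree_def
    proof (intro allI impI)
      fix j assume "j \<le> n" "j \<noteq> n - 1"
      then have "j \<le> n - 2 \<or> j = n" by linarith
      then show "lev F j = lev F' j" using a by (auto simp: low_def)
    qed
  qed
  then show ?thesis by (auto simp: nb_def)
qed

text \<open>Adjacency for the generator \<open>H.gen n\<close>: whereas \<open>nb (n-1)\<close>
  changes \<open>top2\<close> and keeps level \<open>n\<close>, this changes level \<open>n\<close>
  and keeps \<open>top2\<close>.\<close>

definition unb :: "('a^'d) set set \<Rightarrow> ('a^'d) set set set" where
  "unb F = {F'\<in>X. low F F' \<and> top2 F' = top2 F \<and> F' \<noteq> F}"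

lemma hop_u:
  assumes F: "F \<in> X"
  shows "hop n (hop (n-1) (hop n x)) $ F = (\<Sum>F'\<in>unb F. x $ F')"
proof -
  note sF = swp_props(1)[OF F]
  have "hop n (hop (n-1) (hop n x)) $ F = (\<Sum>F'\<in>nb (n-1) (swp F). hop n x $ F')"
    by (simp add: hop_n[OF F] hop_in[OF sF])
  also have "\<dots> = (\<Sum>F'\<in>nb (n-1) (swp F). x $ swp F')"
    by (intro sum.cong refl hop_n) (use nb_D in blast)
  also have "\<dots> = (\<Sum>F'\<in>unb F. x $ F')"
  proof (rule sum.reindex_bij_witness[where i = swp and j = swp])
    fix A assume A: "A \<in> nb (n-1) (swp F)"
    then have A: "A \<in> X" "low (swp F) A" "lev A n = top2 F" "A \<noteq> swp F"
      unfolding nb_pred[OF sF] by simp_all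
    note sA = swp_props[OF A(1)]
    have "low F (swp A)" using low_trans[OF low_trans[OF low_swp[OF F] A(2)] low_swp[OF A(1)]] .
    moreover have "swp A \<noteq> F" using sA(2) A(4) by auto
    ultimately show "swp A \<in> unb F" unfolding unb_def using sA(1,2) A(3) by simp
    show "swp (swp A) = A" by (rule sA(2))
  next
    fix A assume "A \<in> unb F"
    then have A: "A \<in> X" "low F A" "top2 A = top2 F" "A \<noteq> F" unfolding unb_def by simp_all
    note sA = swp_props[OF A(1)]
    have "low (swp F) (swp A)"
      using low_trans[OF low_trans[OF low_sym[OF low_swp[OF F]] A(2)] low_swp[OF A(1)]] .
    moreover have "swp A \<noteq> swp F" using sA(2) A(4) swp_props(2)[OF F] by metis
    ultimately show "swp A \<in> nb (n-1) (swp F)" unfolding nb_pred[OF sF] using sA(1) A(3) by simp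
    show "swp (swp A) = A" by (rule sA(2))
  qed simp
  finally show ?thesis .
qed

lemma TS_inter: "M \<in> G \<Longrightarrow> N \<in> G \<Longrightarrow> TS (M \<inter> N)"
  using TS_subset[OF G_TS vec.subspace_inter[OF G_subspace G_subspace]] by simp

lemma exists_grid_point:
  assumes F: "F \<in> X" and MN: "M \<in> G" "N \<in> G" "lev F (n-2) \<subseteq> M \<inter> N" "vec.dim (M \<inter> N) = n - 1"
  shows "\<exists>F'\<in>X. low F F' \<and> lev F' n = M \<and> top2 F' = N"
proof -
  let ?k = "n - 2"
  have n: "n = Suc (Suc ?k)" "n - 1 = Suc ?k" using n2 by auto
  have g: "good ?k (lev F)" using chains_D(1)[OF F] n2 by (simp add: good_def)
  have tI: "TS (M \<inter> N)"
    using MN(1,2) by (rule TS_inter)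
  have g1: "good (Suc ?k) ((lev F)(Suc ?k := M \<inter> N))"
    using good_extend[OF g tI] MN n(2) by simp
  let ?e = "(lev F)(Suc ?k := M \<inter> N, Suc (Suc ?k) := M)"
  have "good (Suc (Suc ?k)) ?e"
    by (rule good_extend[OF g1]) (use MN n in \<open>auto simp: G_TS G_dim\<close>)
  then have ge: "good n ?e" using n by simp
  define F' where "F' = ?e ` {0..n}"
  have X': "F' \<in> X" unfolding F'_def by (rule chains_I[OF ge])
  have L: "j \<le> n \<Longrightarrow> lev F' j = ?e j" for j unfolding F'_def by (rule lev_image[OF ge])
  have Ln: "lev F' n = M" "lev F' (n-1) = M \<inter> N" using L[of n] L[of "n-1"] n by auto
  have "low F F'" unfolding low_def using L n by auto
  moreover have "M \<noteq> N" using MN n2 by (auto simp: G_dim)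
  then have "top2 F' = N" using MN Ln by (intro top2_I[OF X']) auto
  ultimately show ?thesis using X' Ln by auto
qed

text \<open>Only the dimensions \<open>n-2\<close>, \<open>n-1\<close> and \<open>n\<close> are
  possible, and the class decides the parity.\<close>

lemma opposite_class_iff:
  assumes "M \<in> G" "N \<in> G" "E \<subseteq> M \<inter> N" "vec.dim E = n - 2"
  shows "vec.dim (M \<inter> N) = n - 1 \<longleftrightarrow> \<not> same M N"
proof -
  have "n - 2 \<le> vec.dim (M \<inter> N)" using vec.dim_subset[OF assms(3)] assms(4) by simp
  moreover have "vec.dim (M \<inter> N) \<le> n" using vec.dim_subset[of "M \<inter> N" M] assms by (simp add: G_dim)
  ultimately have "vec.dim (M \<inter> N) = n - 2 \<or> vec.dim (M \<inter> N) = n - 1 \<or> vec.dim (M \<inter> N) = n"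
    by linarith
  then show ?thesis using same_iff[OF assms(1,2)] n2 by auto
qed

lemma low_sub: "F \<in> X \<Longrightarrow> lev F (n-2) \<subseteq> lev F n \<inter> top2 F"
  using top_inter X_mono[of F "n-2" "n-1"] n2 by auto

text \<open>Both conditions say that the tops of \<open>F\<close> and \<open>F'\<close> are in the
  same class, i.e. that the chambers lie in the same grid. The two sides are what the two orders of
  changing the pair require of the intermediate chamber.\<close>

lemma grid_symmetric:
  assumes F: "F \<in> X" "F' \<in> X" and l: "low F F'"
  shows "vec.dim (lev F n \<inter> top2 F') = n - 1 \<longleftrightarrow> vec.dim (lev F' n \<inter> top2 F) = n - 1"
proof -
  have e: "lev F (n-2) = lev F' (n-2)" using l by (simp add: low_def)
  have d: "vec.dim (lev F (n-2)) = n - 2" using X_dim F by simp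
  have g: "lev F n \<in> G" "lev F' n \<in> G" "top2 F \<in> G" "top2 F' \<in> G"
    using F X_G swp_props by auto
  have "vec.dim (lev F n \<inter> top2 F') = n - 1 \<longleftrightarrow> \<not> same (lev F n) (top2 F')"
    by (rule opposite_class_iff[of _ _ "lev F (n-2)"]) (use g d e low_sub F in auto)
  moreover have "vec.dim (lev F' n \<inter> top2 F) = n - 1 \<longleftrightarrow> \<not> same (lev F' n) (top2 F)"
    by (rule opposite_class_iff[of _ _ "lev F (n-2)"]) (use g d e low_sub F in auto)
  moreover have "same (lev F n) (top2 F') \<longleftrightarrow> same (lev F' n) (top2 F)"
    using same_cycle[of "lev F n" "lev F' n" "top2 F'"] same_cycle[of "lev F n" "lev F' n" "top2 F"]
      top_not_same F g by metis
  ultimately show ?thesis by simp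
qed

definition grid_opp :: "('a^'d) set set \<Rightarrow> ('a^'d) set set \<Rightarrow> bool" where
  "grid_opp F F' \<longleftrightarrow> low F F' \<and> vec.dim (lev F n \<inter> top2 F') = n - 1 \<and> lev F n \<noteq> lev F' n \<and> top2 F \<noteq> top2 F'"

lemma card_grid1:
  assumes F: "F \<in> X" "F2 \<in> X"
  shows "card {F1\<in>nb (n-1) F. F2 \<in> unb F1} = of_bool (grid_opp F F2)" (is "card ?K = _")
proof -
  have D: "F1 \<in> X" "low F F1" "lev F1 n = lev F n" "top2 F1 = top2 F2" "F1 \<noteq> F" "F2 \<noteq> F1" "low F1 F2"
    if "F1 \<in> ?K" for F1
    using that nb_pred[OF F(1)] by (auto simp: unb_def)
  have u: "x = y" if "x \<in> ?K" "y \<in> ?K" for x y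
    by (rule low_eqI) (use D[OF that(1)] D[OF that(2)] low_trans low_sym in metis)+
  have "?K \<noteq> {} \<longleftrightarrow> grid_opp F F2"
  proof
    assume "?K \<noteq> {}"
    then obtain F1 where "F1 \<in> ?K" by auto
    note d = D[OF this]
    have "low F F2" using d low_trans by metis
    moreover have "vec.dim (lev F n \<inter> top2 F2) = n - 1"
      using top_inter[OF d(1)] X_dim[OF d(1), of "n-1"] d by simp
    moreover have "lev F n \<noteq> lev F2 n" using low_eqI[OF d(1) F(2)] d by auto
    moreover have "top2 F \<noteq> top2 F2" using low_eqI[OF F(1) d(1)] d by auto
    ultimately show "grid_opp F F2" by (simp add: grid_opp_def)
  next
    assume o: "grid_opp F F2"
    have "lev F (n-2) = lev F2 (n-2)" using o by (simp add: grid_opp_def low_def)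
    then have "lev F (n-2) \<subseteq> lev F n \<inter> top2 F2" using low_sub[OF F(1)] low_sub[OF F(2)] by auto
    then obtain F1 where F1: "F1 \<in> X" "low F F1" "lev F1 n = lev F n" "top2 F1 = top2 F2"
      using exists_grid_point[OF F(1) X_G[OF F(1)] swp_props(6)[OF F(2)]] o by (auto simp: grid_opp_def)
    have "low F1 F2" using F1 o low_sym low_trans unfolding grid_opp_def by metis
    moreover have "F1 \<noteq> F" "F2 \<noteq> F1" using F1 o by (auto simp: grid_opp_def)
    ultimately have "F1 \<in> ?K" unfolding nb_pred[OF F(1)] unb_def using F1 F by simp
    then show "?K \<noteq> {}" by auto
  qed
  moreover have "card ?K = of_bool (?K \<noteq> {})" by (rule card_subsingleton) (rule u)
  ultimately show ?thesis by simp
qed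

lemma card_grid2:
  assumes F: "F \<in> X" "F2 \<in> X"
  shows "card {F1\<in>unb F. F2 \<in> nb (n-1) F1} = of_bool (grid_opp F F2)" (is "card ?K = _")
proof -
  have D: "F1 \<in> X" "low F F1" "lev F1 n = lev F2 n" "top2 F1 = top2 F" "F1 \<noteq> F" "F2 \<noteq> F1" "low F1 F2"
    if K: "F1 \<in> ?K" for F1
  proof -
    have "F1 \<in> X" using K by (simp add: unb_def)
    from nb_pred[OF this] K show "F1 \<in> X" "low F F1" "lev F1 n = lev F2 n" "top2 F1 = top2 F"
      "F1 \<noteq> F" "F2 \<noteq> F1" "low F1 F2" by (auto simp: unb_def)
  qed
  have u: "x = y" if "x \<in> ?K" "y \<in> ?K" for x y
    by (rule low_eqI) (use D[OF that(1)] D[OF that(2)] low_trans low_sym in metis)+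
  have "?K \<noteq> {} \<longleftrightarrow> grid_opp F F2"
  proof
    assume "?K \<noteq> {}"
    then obtain F1 where "F1 \<in> ?K" by auto
    note d = D[OF this]
    have l: "low F F2" using d low_trans by metis
    moreover have "vec.dim (lev F2 n \<inter> top2 F) = n - 1"
      using top_inter[OF d(1)] X_dim[OF d(1), of "n-1"] d by simp
    then have "vec.dim (lev F n \<inter> top2 F2) = n - 1" using grid_symmetric[OF F l] by simp
    moreover have "lev F n \<noteq> lev F2 n" using low_eqI[OF F(1) d(1)] d by auto
    moreover have "top2 F \<noteq> top2 F2" using low_eqI[OF d(1) F(2)] d by auto
    ultimately show "grid_opp F F2" by (simp add: grid_opp_def)
  next
    assume o: "grid_opp F F2"
    have l: "low F F2" using o by (simp add: grid_opp_def)
    have "lev F (n-2) = lev F2 (n-2)" using l by (simp add: low_def)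
    then have "lev F (n-2) \<subseteq> lev F2 n \<inter> top2 F" using low_sub[OF F(1)] low_sub[OF F(2)] by auto
    moreover have "vec.dim (lev F2 n \<inter> top2 F) = n - 1"
      using o grid_symmetric[OF F l] by (simp add: grid_opp_def)
    ultimately obtain F1 where F1: "F1 \<in> X" "low F F1" "lev F1 n = lev F2 n" "top2 F1 = top2 F"
      using exists_grid_point[OF F(1) X_G[OF F(2)] swp_props(6)[OF F(1)]] by auto
    have "low F1 F2" using F1 l low_sym low_trans by metis
    moreover have "F1 \<noteq> F" "F2 \<noteq> F1" using F1 o by (auto simp: grid_opp_def)
    ultimately have "F2 \<in> nb (n-1) F1" "F1 \<in> unb F"
      unfolding nb_pred[OF F1(1)] unb_def using F1 F by simp_all
    then have "F1 \<in> ?K" by simp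
    then show "?K \<noteq> {}" by auto
  qed
  moreover have "card ?K = of_bool (?K \<noteq> {})" by (rule card_subsingleton) (rule u)
  ultimately show ?thesis by simp
qed

text \<open>In other words, \<open>hop (n-1)\<close> commutes with its conjugate by
  \<open>hop n\<close>. One changes \<open>top2\<close>, the other level \<open>n\<close>; in either
  order the intermediate chamber of the grid is unique and exists exactly under
  \<open>grid_opp\<close>.\<close>

lemma hop_braid4:
  "hop (n-1) (hop n (hop (n-1) (hop n x))) = hop n (hop (n-1) (hop n (hop (n-1) x)))"
proof -
  have "hop (n-1) (hop n (hop (n-1) (hop n x))) $ F = hop n (hop (n-1) (hop n (hop (n-1) x))) $ F" for F
  proof (cases "F \<in> X")
    case False then show ?thesis by (simp add: hop_out)
  next
    case F: True
    have unb_X: "unb A \<subseteq> X" for A by (auto simp: unb_def)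
    have "hop (n-1) (hop n (hop (n-1) (hop n x))) $ F = (\<Sum>F1\<in>nb (n-1) F. \<Sum>F2\<in>unb F1. x $ F2)"
      unfolding hop_in[OF F] by (intro sum.cong refl hop_u) (use nb_D in blast)
    also have "\<dots> = (\<Sum>F2\<in>X. real (card {F1\<in>nb (n-1) F. F2 \<in> unb F1}) * x $ F2)"
      by (rule sum_sum_fibres) (use unb_X in auto)
    also have "\<dots> = (\<Sum>F2\<in>X. real (card {F1\<in>unb F. F2 \<in> nb (n-1) F1}) * x $ F2)"
      by (intro sum.cong refl) (simp only: card_grid1[OF F] card_grid2[OF F])
    also have "\<dots> = (\<Sum>F1\<in>unb F. \<Sum>F2\<in>nb (n-1) F1. x $ F2)"
      by (rule sum_sum_fibres[symmetric]) (use nb_D in auto)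
    also have "\<dots> = (\<Sum>F1\<in>unb F. hop (n-1) x $ F1)"
      by (intro sum.cong refl hop_in[symmetric]) (use unb_X in blast)
    finally show ?thesis unfolding hop_u[OF F] .
  qed
  then show ?thesis by (simp add: vec_eq_iff)
qed

sublocale H: hecke_operators hop n "real CARD('a)"
proof (rule hecke_operators.intro)
  fix i x assume "1 \<le> i" "i < n"
  then show "hop i (hop i x) = (real CARD('a) - 1) *\<^sub>R hop i x + real CARD('a) *\<^sub>R x"
    using hop_quad[of i x] by (simp add: qi_def)
next
  show "hop n (hop n x) = x" for x using hop_quad[of n x] n2 by (simp add: qi_def)
  show "1 < real CARD('a)" using card_field_gt_1[where 'a='a] by simp
  show "hop (n - 1) (hop n (hop (n - 1) (hop n x))) = hop n (hop (n - 1) (hop n (hop (n - 1) x)))" for x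
    by (rule hop_braid4)
  show "linear (hop i)" for i by (rule linear_hop)
  show "hop i x \<bullet> y = x \<bullet> hop i y" for i x y by (rule hop_sym)
  show "1 \<le> i \<Longrightarrow> i + 1 < j \<Longrightarrow> j \<le> n \<Longrightarrow> hop i (hop j x) = hop j (hop i x)" for i j x by (rule hop_comm)
  show "1 \<le> i \<Longrightarrow> i + 1 < n \<Longrightarrow> hop i (hop (i+1) (hop i x)) = hop (i+1) (hop i (hop (i+1) x))" for i x
    by (rule hop_braid3)
qed (rule n2)

section \<open>Connectedness of the chamber graph\<close>

lemma splice:
  assumes e: "good m e" and F: "F \<in> X" and m: "m < n" "e m \<subseteq> lev F (Suc m)"
  shows "\<exists>H\<in>X. (\<forall>j\<le>m. lev H j = e j) \<and> (\<forall>j. m < j \<longrightarrow> j \<le> n \<longrightarrow> lev H j = lev F j)"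
proof -
  let ?e = "\<lambda>j. if j \<le> m then e j else lev F j"
  have "?e j \<subseteq> ?e (Suc j)" if "j < n" for j
  proof -
    consider "Suc j \<le> m" | "j = m" | "m < j" by linarith
    then show ?thesis
      using e m X_mono[OF F, of j "Suc j"] that by cases (auto simp: good_def)
  qed
  then have g: "good n ?e" using e X_TS[OF F] X_dim[OF F] by (simp add: good_def)
  show ?thesis
    by (rule bexI[OF _ chains_I[OF g]]) (use lev_image[OF g] m in auto)
qed

text \<open>Connectedness is expressed by functions \<open>f\<close> that agree on adjacent
  chambers. At the topmost level \<open>k\<close> where the chambers differ, the two spaces meet in
  dimension \<open>k-1\<close>; chambers through this meet reduce level \<open>k\<close> to one
  adjacency and the lower levels to the induction hypothesis.\<close>

lemma connected_fixed_upper: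
  assumes f: "\<And>i F F'. 1 \<le> i \<Longrightarrow> i \<le> n \<Longrightarrow> F \<in> X \<Longrightarrow> F' \<in> nb i F \<Longrightarrow> f F = f F'"
  shows "k \<le> n \<Longrightarrow> F \<in> X \<Longrightarrow> F' \<in> X \<Longrightarrow> (\<And>j. k \<le> j \<Longrightarrow> j \<le> n \<Longrightarrow> lev F j = lev F' j) \<Longrightarrow> f F = f F'"
proof (induction k arbitrary: F F')
  case 0
  then have "F = F'" by (intro chains_eqI) auto
  then show ?case by simp
next
  case (Suc k)
  note F = Suc.prems(2,3)
  show ?case
  proof (cases "lev F k = lev F' k")
    case True
    then have "lev F j = lev F' j" if "k \<le> j" "j \<le> n" for j
      using Suc.prems(4)[of j] that by (cases "j = k") auto
    then show ?thesis using Suc.prems by (intro Suc.IH) auto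
  next
    case False
    then have k: "k \<noteq> 0" using X_0 F by auto
    then obtain m where m: "k = Suc m" using not0_implies_Suc by blast
    let ?D = "lev F k \<inter> lev F' k"
    have s: "vec.subspace (lev F k)" "vec.subspace (lev F' k)" using X_subspace F Suc.prems(1) by auto
    have up: "lev F k \<subseteq> lev F (Suc k)" "lev F' k \<subseteq> lev F (Suc k)"
      using X_mono[OF F(1), of k "Suc k"] X_mono[OF F(2), of k "Suc k"] Suc.prems(4)[of "Suc k"] Suc.prems(1) by auto
    have sD: "vec.subspace ?D" using s by (simp add: vec.subspace_inter)
    have "vec.dim (vec.span (lev F k \<union> lev F' k)) \<le> Suc k"
      using up vec.dim_subset[of "vec.span (lev F k \<union> lev F' k)" "lev F (Suc k)"]
        X_dim[OF F(1), of "Suc k"] X_subspace[OF F(1), of "Suc k"] Suc.prems(1) vec.span_minimal[of "lev F k \<union> lev F' k" "lev F (Suc k)"]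
      by auto
    then have "m \<le> vec.dim ?D"
      using dim_span_Un_Int[OF s] X_dim[of F k] X_dim[of F' k] F Suc.prems(1) m by simp
    moreover have "vec.dim ?D \<noteq> k"
    proof
      assume "vec.dim ?D = k"
      then have "?D = lev F k" "?D = lev F' k"
        using s X_dim[of F k] X_dim[of F' k] F Suc.prems(1)
          vec_subspace_eqI[OF sD s(1)] vec_subspace_eqI[OF sD s(2)] by auto
      then show False using False by auto
    qed
    moreover have "vec.dim ?D \<le> k" using vec.dim_subset[of ?D "lev F k"] X_dim[of F k] F Suc.prems(1) by simp
    ultimately have dD: "vec.dim ?D = m" using m by simp
    have tD: "TS ?D" using TS_subset[of "lev F k" ?D] sD X_TS F Suc.prems(1) by auto
    obtain e where e: "good m e" "e m = ?D" using exists_good[OF tD dD] by auto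
    obtain H where H: "H \<in> X" "\<And>j. j \<le> m \<Longrightarrow> lev H j = e j" "\<And>j. m < j \<Longrightarrow> j \<le> n \<Longrightarrow> lev H j = lev F j"
      using splice[OF e(1) F(1)] e(2) m Suc.prems(1) by auto
    obtain H' where H': "H' \<in> X" "\<And>j. j \<le> m \<Longrightarrow> lev H' j = e j" "\<And>j. m < j \<Longrightarrow> j \<le> n \<Longrightarrow> lev H' j = lev F' j"
      using splice[OF e(1) F(2)] e(2) m Suc.prems(1) by auto
    have 1: "f F = f H"
      by (rule Suc.IH) (use Suc.prems F H m in auto)
    have 2: "f H' = f F'"
      by (rule Suc.IH) (use Suc.prems F H' m in auto)
    have "agree k H H'" unfolding agree_def
    proof (intro allI impI)
      fix j assume "j \<le> n" "j \<noteq> k"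
      then consider "j \<le> m" | "m < j" "Suc k \<le> j" using m by linarith
      then show "lev H j = lev H' j"
        using H H' Suc.prems(4)[of j] \<open>j \<le> n\<close> by cases auto
    qed
    moreover have "H' \<noteq> H" using H(3)[of k] H'(3)[of k] False m Suc.prems(1) by auto
    ultimately have "H' \<in> nb k H" using H' by (simp add: nb_def)
    then have "f H = f H'" using f[of k H H'] k Suc.prems(1) H by simp
    then show ?thesis using 1 2 by simp
  qed
qed

text \<open>Induction on the distance of the top generators: with the top kept, level
  \<open>n-1\<close> is moved to the hyperplane shared with a closer generator \<open>M\<close>, and
  \<open>swp\<close> then exchanges the top for \<open>M\<close>.\<close>

theorem chains_connected:
  assumes f: "\<And>i F F'. 1 \<le> i \<Longrightarrow> i \<le> n \<Longrightarrow> F \<in> X \<Longrightarrow> F' \<in> nb i F \<Longrightarrow> f F = f F'"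
    and F: "F \<in> X" "F' \<in> X"
  shows "f F = f F'"
  using F(1)
proof (induction "n - vec.dim (lev F n \<inter> lev F' n)" arbitrary: F rule: less_induct)
  case less
  note FX = less.prems
  show ?case
  proof (cases "lev F n = lev F' n")
    case True
    show ?thesis
      by (rule connected_fixed_upper[of f n, OF f]) (use True FX F in auto)
  next
    case False
    obtain M where M: "M \<in> G" "vec.dim (lev F n \<inter> M) = n - 1"
      "vec.dim (M \<inter> lev F' n) = Suc (vec.dim (lev F n \<inter> lev F' n))"
      using exists_adjacent_closer[OF X_G[OF FX] X_G[OF F(2)] False] by auto
    let ?E = "lev F n \<inter> M"
    have tE: "TS ?E" using X_G[OF FX] M(1) by (rule TS_inter)
    obtain e where e: "good (n-1) e" "e (n-1) = ?E" using exists_good[OF tE M(2)] by auto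
    obtain H where H: "H \<in> X" "\<And>j. j \<le> n-1 \<Longrightarrow> lev H j = e j" "\<And>j. n-1 < j \<Longrightarrow> j \<le> n \<Longrightarrow> lev H j = lev F j"
      using splice[OF e(1) FX] e(2) n2 by auto
    have Hn: "lev H n = lev F n" using H(3)[of n] n2 by simp
    have "f F = f H"
      by (rule connected_fixed_upper[of f n, OF f]) (use Hn FX H(1) in auto)
    also have "f H = f (swp H)" using f[of n H "swp H"] nb_n H n2 by simp
    also have "f (swp H) = f F'"
    proof (rule less.hyps)
      have "M \<noteq> lev F n" using M n2 by (auto simp: G_dim)
      then have "top2 H = M" using H(2)[of "n-1"] e(2) M Hn by (intro top2_I[OF H(1)]) auto
      then show "n - vec.dim (top2 H \<inter> lev F' n) < n - vec.dim (lev F n \<inter> lev F' n)"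
        using M G_inter_dim_less[OF X_G[OF FX] X_G[OF F(2)] False] by simp
      show "swp H \<in> X" using swp_props H by auto
    qed
    finally show ?thesis .
  qed
qed

text \<open>\<open>H.eig i + 1\<close> is the size of an \<open>i\<close>-panel, so \<open>w\<close>
  takes at each chamber its average over the panel. It is therefore constant on panels, and on
  \<open>X\<close> by connectedness.\<close>

lemma eigenvector_constant:
  assumes w: "\<And>i. 1 \<le> i \<Longrightarrow> i \<le> n \<Longrightarrow> hop i w = H.eig i *\<^sub>R w" and F: "F \<in> X" "F' \<in> X"
  shows "w $ F = w $ F'"
proof (rule chains_connected[OF _ F, of "\<lambda>F. w $ F"])
  fix i A A' assume i: "1 \<le> i" "i \<le> n" and A: "A \<in> X" and A': "A' \<in> nb i A"
  have A'X: "A' \<in> X" "agree i A A'" using nb_D A' by auto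
  have p: "(H.eig i + 1) * w $ B = (\<Sum>G\<in>insert B (nb i B). w $ G)" if "B \<in> X" for B
  proof -
    have "hop i w $ B = H.eig i * w $ B" using w[OF i] by simp
    then show ?thesis by (simp add: hop_in[OF that] nb_def algebra_simps)
  qed
  have "insert A' (nb i A') = insert A (nb i A)"
    using A'X A agree_trans agree_sym unfolding nb_def by (auto simp: agree_def)
  then have "(H.eig i + 1) * w $ A = (H.eig i + 1) * w $ A'" using p A A'X by simp
  moreover have "H.eig i + 1 > 0" by (simp add: H.eig_def add_pos_nonneg)
  ultimately show "w $ A = w $ A'" by simp
qed

text \<open>Ends of the galleries of type \<open>xs\<close> from \<open>F\<close> that move at every
  step.\<close>

fun walk :: "nat list \<Rightarrow> ('a^'d) set set \<Rightarrow> ('a^'d) set set set" where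
  "walk [] F = {F}"
| "walk (i # xs) F = (\<Union>F1\<in>nb i F. walk xs F1)"

lemma foldr_hop_zero:
  "F \<in> X \<Longrightarrow> (\<And>F'. F' \<in> walk xs F \<Longrightarrow> x $ F' = 0) \<Longrightarrow> foldr hop xs x $ F = 0"
proof (induction xs arbitrary: F)
  case (Cons i xs)
  have "foldr hop xs x $ F1 = 0" if "F1 \<in> nb i F" for F1
    using that Cons.prems nb_D by (intro Cons.IH) auto
  then show ?case by (simp add: hop_in[OF Cons.prems(1)])
qed auto

definition w0_word :: "nat list" where "w0_word = concat (replicate n [1..<Suc n])"

lemma w0_foldr: "H.w0 = foldr hop w0_word"
proof -
  have "foldr hop (concat (replicate k xs)) = foldr hop xs ^^ k" for k xs
    by (induction k) auto
  then show ?thesis unfolding w0_word_def H.w0_def H.cox_def by simp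
qed

text \<open>Hoffman's argument: \<open>ind X\<close> is an eigenvector of \<open>w0\<close> and of
  its adjoint for the same \<open>\<Lambda>\<close>, so with \<open>g\<close> the part of
  \<open>ind S\<close> orthogonal to \<open>ind X\<close> independence reads
  \<open>(a\<^sup>2 / v) * \<Lambda> = - (g \<bullet> H.w0 g)\<close>, and
  \<open>w0_norm_bound\<close> controls the right-hand side. Closure under \<open>swp\<close> puts
  \<open>g\<close> into \<open>H.V0\<close>.\<close>

theorem ratio_bound:
  assumes S: "S \<subseteq> X" and swpS: "\<And>F. F \<in> S \<Longrightarrow> swp F \<in> S"
    and indep: "\<And>F F'. F \<in> S \<Longrightarrow> F' \<in> walk w0_word F \<Longrightarrow> F' \<notin> S"
    and ne: "X \<noteq> {}"
  shows "real (card S) * (1 + real CARD('a) ^ (n-1)) \<le> real (card X)"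
proof -
  let ?q = "real CARD('a)"
  define ind where "ind A = (\<chi> F. if F \<in> A then 1 else (0 :: real))" for A :: "('a^'d) set set set"
  have ind_inner: "ind A \<bullet> x = (\<Sum>F\<in>A. x $ F)" for A x
    by (simp add: ind_def inner_vec_def if_distrib[of "\<lambda>a. a * _"] sum.If_cases cong: if_cong)
  have hop1: "hop i (ind X) = qi i *\<^sub>R ind X" if "1 \<le> i" "i \<le> n" for i
  proof -
    have "hop i (ind X) $ F = qi i * ind X $ F" for F
    proof (cases "F \<in> X")
      case True
      have "hop i (ind X) $ F = (\<Sum>F'\<in>nb i F. 1)"
        unfolding hop_in[OF True] by (intro sum.cong refl) (use nb_D in \<open>auto simp: ind_def\<close>)
      then show ?thesis using True card_nb[OF True that] by (simp add: ind_def qi_def)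
    qed (simp add: hop_out)
    then show ?thesis by (simp add: vec_eq_iff)
  qed
  have f1: "foldr hop xs (ind X) = (\<Prod>i\<leftarrow>xs. qi i) *\<^sub>R ind X" if "set xs \<subseteq> {1..n}" for xs
    using that by (induction xs) (auto simp: hop1 linear_cmul[OF linear_hop])
  have pq: "(\<Prod>i\<leftarrow>[1..<Suc n]. qi i) = ?q ^ (n-1)"
  proof -
    have "(\<Prod>i\<leftarrow>[1..<n]. qi i) = (\<Prod>i\<leftarrow>[1..<n]. ?q)"
      by (rule arg_cong[where f=prod_list], rule map_cong) (auto simp: qi_def)
    then show ?thesis using n2 by (simp add: map_replicate_const qi_def)
  qed
  have cox1: "foldr hop xs (ind X) = ?q ^ (n-1) *\<^sub>R ind X" if "xs = [1..<Suc n] \<or> xs = rev [1..<Suc n]" for xs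
  proof -
    have "set xs \<subseteq> {1..n}" using that by auto
    moreover have "(\<Prod>i\<leftarrow>xs. qi i) = ?q ^ (n-1)"
      using that pq by (auto simp only: rev_map[symmetric] prod_list.rev)
    ultimately show ?thesis using f1 by simp
  qed
  have pow1: "(f ^^ k) (ind X) = c ^ k *\<^sub>R ind X" if "f (ind X) = c *\<^sub>R ind X" "linear f" for f k c
    by (induction k) (auto simp: that linear_cmul[OF that(2)])
  define \<Lambda> where "\<Lambda> = (?q ^ (n-1)) ^ n"
  have adj1: "H.w0_adj (ind X) = \<Lambda> *\<^sub>R ind X"
    unfolding \<Lambda>_def H.w0_adj_def by (rule pow1[OF cox1 H.linear_foldr]) (auto simp del: upt_Suc)
  have w1: "H.w0 (ind X) = \<Lambda> *\<^sub>R ind X"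
    unfolding \<Lambda>_def H.w0_def H.cox_def by (rule pow1[OF cox1 H.linear_foldr]) (auto simp del: upt_Suc)
  define a v where "a = real (card S)" and "v = real (card X)"
  have v0: "v > 0" using ne by (simp add: v_def card_gt_0_iff)
  define g where "g = ind S - (a / v) *\<^sub>R ind X"
  have XX: "ind X \<bullet> ind X = v" "ind S \<bullet> ind X = a" "ind S \<bullet> ind S = a"
    unfolding ind_inner using S by (auto simp: ind_def v_def a_def subset_iff intro!: sum.cong)
  have gX: "g \<bullet> ind X = 0" using XX v0 by (simp add: g_def inner_diff_left)
  have gg: "g \<bullet> g = a - a\<^sup>2 / v"
    using XX v0 unfolding g_def
    by (simp add: inner_diff_left inner_diff_right inner_commute field_simps power2_eq_square)
  have gV: "g \<in> H.V0"
  proof (rule H.V0_I)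
    have "hop n (ind S) $ F = ind S $ F" for F
    proof (cases "F \<in> X")
      case True
      have "swp F \<in> S \<longleftrightarrow> F \<in> S" using swpS swp_props(2)[OF True] by metis
      then show ?thesis using True by (simp add: hop_n ind_def)
    next
      case False
      then show ?thesis by (simp add: hop_out qi_def)
    qed
    then have "hop n (ind S) = ind S" by (simp add: vec_eq_iff)
    moreover have "hop n (ind X) = ind X" using hop1[of n] n2 by (simp add: qi_def)
    ultimately show "hop n g = g"
      unfolding g_def by (simp add: linear_diff[OF linear_hop] linear_cmul[OF linear_hop])
    fix w assume w: "\<And>i. 1 \<le> i \<Longrightarrow> i \<le> n \<Longrightarrow> hop i w = H.eig i *\<^sub>R w"
    obtain F0 where F0: "F0 \<in> X" using ne by auto
    have wc: "w $ F = w $ F0" if "F \<in> X" for F using eigenvector_constant[OF w that F0] .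
    have "ind S \<bullet> w = a * w $ F0" unfolding ind_inner using wc S by (simp add: a_def subset_iff)
    moreover have "ind X \<bullet> w = v * w $ F0" unfolding ind_inner using wc by (simp add: v_def)
    ultimately show "g \<bullet> w = 0" using v0 by (simp add: g_def inner_diff_left)
  qed
  have "ind S \<bullet> H.w0 (ind S) = 0"
    unfolding ind_inner
  proof (rule sum.neutral, rule ballI)
    fix F assume F: "F \<in> S"
    have "foldr hop w0_word (ind S) $ F = 0"
      by (rule foldr_hop_zero) (use F S indep[OF F] in \<open>auto simp: ind_def\<close>)
    then show "H.w0 (ind S) $ F = 0" by (simp add: w0_foldr)
  qed
  moreover have "ind S = g + (a / v) *\<^sub>R ind X" by (simp add: g_def)
  moreover have "ind X \<bullet> H.w0 g = 0"
    using H.w0_adjoint[of g "ind X"] gX adj1 by (simp add: inner_commute)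
  ultimately have "g \<bullet> H.w0 g + (a / v)\<^sup>2 * \<Lambda> * v = 0"
    using gX XX(1) w1 v0
    by (simp add: linear_add[OF H.linear_w0] linear_cmul[OF H.linear_w0] inner_add_left inner_add_right
        inner_commute power2_eq_square algebra_simps)
  then have "(a\<^sup>2 / v) * \<Lambda> = - (g \<bullet> H.w0 g)" using v0 by (simp add: field_simps power2_eq_square)
  also have "\<dots> \<le> norm g * norm (H.w0 g)" using Cauchy_Schwarz_ineq2[of g "H.w0 g"] by linarith
  also have "\<dots> \<le> norm g * (?q ^ ((n-1)\<^sup>2) * norm g)"
    by (intro mult_left_mono H.w0_norm_bound gV) auto
  also have "\<dots> = ?q ^ ((n-1)\<^sup>2) * (a - a\<^sup>2 / v)"
    using gg by (simp add: power2_norm_eq_inner[symmetric] power2_eq_square)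
  \<comment> \<open>From \<open>n (n-1) = (n-1)^2 + (n-1)\<close>: the surplus
    \<open>q^(n-1)\<close> of the row sum over the norm bound is the factor in the
    conclusion.\<close>
  also have "\<Lambda> = ?q ^ ((n-1)\<^sup>2) * ?q ^ (n-1)"
  proof -
    have "(n-1) * n = (n-1)\<^sup>2 + (n-1)" using n2 by (cases n) (simp_all add: power2_eq_square)
    then show ?thesis unfolding \<Lambda>_def by (simp add: power_mult[symmetric] power_add)
  qed
  finally have "?q ^ ((n-1)\<^sup>2) * ((a\<^sup>2 / v) * ?q ^ (n-1)) \<le> ?q ^ ((n-1)\<^sup>2) * (a - a\<^sup>2 / v)"
    by (simp add: ac_simps)
  then have "(a\<^sup>2 / v) * ?q ^ (n-1) \<le> a - a\<^sup>2 / v"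
    by (rule mult_left_le_imp_le) (use card_field_gt_1[where 'a='a] in simp)
  then have "a\<^sup>2 * (1 + ?q ^ (n-1)) \<le> a * v" using v0 by (simp add: field_simps)
  then have "a * (a * (1 + ?q ^ (n-1))) \<le> a * v" by (simp add: power2_eq_square mult.assoc)
  then have "a \<noteq> 0 \<Longrightarrow> a * (1 + ?q ^ (n-1)) \<le> v"
    by (rule mult_left_le_imp_le) (simp add: a_def card_gt_0_iff)
  then show ?thesis by (cases "a = 0") (simp_all add: a_def v_def)
qed

end

section \<open>Opposite chains and hyperbolic bases\<close>

context hyperbolic_quadric
begin

lemma walk_append: "walk (xs @ ys) F = (\<Union>F1\<in>walk xs F. walk ys F1)"
  by (induction xs arbitrary: F) auto

text \<open>The effect of one pass through the Coxeter word: level \<open>j\<close> is replaced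
  while level \<open>Suc j\<close> is still that of \<open>F\<close>.\<close>

definition cstep :: "('a^'d) set set \<Rightarrow> ('a^'d) set set \<Rightarrow> bool" where
  "cstep F F' \<longleftrightarrow> F \<in> X \<and> F' \<in> X \<and> (\<forall>j. 1 \<le> j \<longrightarrow> j \<le> n \<longrightarrow> lev F' j \<noteq> lev F j) \<and>
     (\<forall>j. 1 \<le> j \<longrightarrow> j < n \<longrightarrow> lev F' j \<subseteq> lev F (Suc j))"

lemma cstep_sub: "cstep F F' \<Longrightarrow> 1 \<le> j \<Longrightarrow> j < n \<Longrightarrow> lev F' j \<subseteq> lev F (Suc j)"
  by (simp add: cstep_def)

lemma walk_upto:
  "k \<le> n \<Longrightarrow> F \<in> X \<Longrightarrow> F' \<in> walk [1..<Suc k] F \<Longrightarrow>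
    F' \<in> X \<and> (\<forall>j. k < j \<longrightarrow> j \<le> n \<longrightarrow> lev F' j = lev F j) \<and>
    (\<forall>j. 1 \<le> j \<longrightarrow> j \<le> k \<longrightarrow> lev F' j \<noteq> lev F j \<and> (j < n \<longrightarrow> lev F' j \<subseteq> lev F (Suc j)))"
proof (induction k arbitrary: F')
  case 0 then show ?case by simp
next
  case (Suc k)
  have "[1..<Suc (Suc k)] = [1..<Suc k] @ [Suc k]" by simp
  then obtain F1 where F1: "F1 \<in> walk [1..<Suc k] F" "F' \<in> nb (Suc k) F1"
    using Suc.prems(3) by (auto simp: walk_append simp del: upt_Suc)
  have IH: "F1 \<in> X" "\<And>j. k < j \<Longrightarrow> j \<le> n \<Longrightarrow> lev F1 j = lev F j"
    "\<And>j. 1 \<le> j \<Longrightarrow> j \<le> k \<Longrightarrow> lev F1 j \<noteq> lev F j \<and> (j < n \<longrightarrow> lev F1 j \<subseteq> lev F (Suc j))"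
    using Suc.IH[OF _ Suc.prems(2) F1(1)] Suc.prems(1) by auto
  have X': "F' \<in> X" "agree (Suc k) F1 F'" using nb_D[OF F1(2)] by auto
  have ne: "lev F' (Suc k) \<noteq> lev F (Suc k)" using nb_lev[OF IH(1) F1(2)] IH(2)[of "Suc k"] Suc.prems(1) by simp
  have up: "lev F' (Suc k) \<subseteq> lev F (Suc (Suc k))" if "Suc k < n"
  proof -
    have "lev F' (Suc k) \<subseteq> lev F' (Suc (Suc k))" using X_mono[OF X'(1)] that by simp
    also have "\<dots> = lev F (Suc (Suc k))"
      using agreeD[OF X'(2), of "Suc (Suc k)"] IH(2)[of "Suc (Suc k)"] that by simp
    finally show ?thesis .
  qed
  have other: "lev F' j = lev F1 j" if "j \<le> n" "j \<noteq> Suc k" for j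
    using agreeD[OF X'(2) that] by simp
  show ?case
  proof (intro conjI allI impI)
    show "F' \<in> X" by (rule X')
    show "lev F' j = lev F j" if "Suc k < j" "j \<le> n" for j
      using other[of j] IH(2)[of j] that by simp
    fix j assume j: "1 \<le> j" "j \<le> Suc k"
    show "lev F' j \<noteq> lev F j"
      using ne other[of j] IH(3)[of j] j Suc.prems(1) by (cases "j = Suc k") auto
    show "lev F' j \<subseteq> lev F (Suc j)" if "j < n"
      using up other[of j] IH(3)[of j] j that by (cases "j = Suc k") auto
  qed
qed

lemma walk_cstep: "F \<in> X \<Longrightarrow> F' \<in> walk [1..<Suc n] F \<Longrightarrow> cstep F F'"
proof -
  assume F: "F \<in> X" "F' \<in> walk [1..<Suc n] F"
  note w = walk_upto[OF order_refl F]
  show "cstep F F'" unfolding cstep_def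
  proof (intro conjI allI impI)
    fix j :: nat assume j: "1 \<le> j"
    show "j \<le> n \<Longrightarrow> lev F' j \<noteq> lev F j" using w j by simp
    show "j < n \<Longrightarrow> lev F' j \<subseteq> lev F (Suc j)" using w j by simp
  qed (use w F in simp_all)
qed

lemma walk_w0: "F \<in> X \<Longrightarrow> F' \<in> walk w0_word F \<Longrightarrow> (cstep ^^ n) F F'"
proof -
  have "(cstep ^^ k) F F'" if "F \<in> X" "F' \<in> walk (concat (replicate k [1..<Suc n])) F" for k F
    using that
  proof (induction k arbitrary: F)
    case (Suc k)
    then obtain F1 where F1: "F1 \<in> walk [1..<Suc n] F" "F' \<in> walk (concat (replicate k [1..<Suc n])) F1"
      by (auto simp: walk_append simp del: upt_Suc)
    have c: "cstep F F1" using walk_cstep Suc.prems F1 by blast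
    then have "F1 \<in> X" by (simp add: cstep_def)
    then have "(cstep ^^ k) F1 F'" using F1(2) by (rule Suc.IH)
    then show ?case using c relpowp_Suc_I2 by metis
  qed auto
  then show "F \<in> X \<Longrightarrow> F' \<in> walk w0_word F \<Longrightarrow> (cstep ^^ n) F F'" unfolding w0_word_def by blast
qed

text \<open>If the point \<open>lev F 1\<close> fell into \<open>lev F' (Suc i)\<close>, then
  \<open>lev F (Suc i)\<close>, which is spanned by \<open>lev F' i\<close> and this point, would
  equal \<open>lev F' (Suc i)\<close>, against \<open>cstep\<close>.\<close>

lemma cstep_lift:
  assumes c: "cstep F F'" and i: "1 \<le> i" "i \<le> n"
  shows "\<not> lev F 1 \<subseteq> lev F' i \<and> lev F i = vec.span (lev F' (i-1) \<union> lev F 1)"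
  using i
proof (induction i rule: dec_induct)
  case base
  have F: "F \<in> X" "F' \<in> X" using c by (auto simp: cstep_def)
  have "lev F' 1 \<noteq> lev F 1" using c n2 by (simp add: cstep_def)
  then have "\<not> lev F 1 \<subseteq> lev F' 1"
    using vec_subspace_eqI[of "lev F 1" "lev F' 1"] F X_subspace X_dim n2 by auto
  moreover have "vec.span (lev F' 0 \<union> lev F 1) = lev F 1"
    using X_0[OF F(2)] X_subspace[OF F(1), of 1] n2 by (simp add: vec.subspace_0 insert_absorb)
  ultimately show ?case by simp
next
  case (step i)
  have F: "F \<in> X" "F' \<in> X" using c by (auto simp: cstep_def)
  have IH: "\<not> lev F 1 \<subseteq> lev F' i" using step by simp
  then obtain v where v: "v \<in> lev F 1" "v \<notin> lev F' i" by auto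
  have up: "lev F' i \<subseteq> lev F (Suc i)" using c step by (simp add: cstep_def)
  have low1: "lev F 1 \<subseteq> lev F (Suc i)" using X_mono[OF F(1)] step by simp
  have sF: "vec.subspace (lev F (Suc i))" using X_subspace F step by simp
  have ins: "vec.span (insert v (lev F' i)) = lev F (Suc i)"
    by (rule span_insert_eq) (use X_subspace X_dim F step v up low1 in auto)
  have "vec.span (insert v (lev F' i)) \<subseteq> vec.span (lev F' i \<union> lev F 1)"
    using v by (intro vec.span_mono) auto
  moreover have "vec.span (lev F' i \<union> lev F 1) \<subseteq> lev F (Suc i)"
    using up low1 sF by (intro vec.span_minimal) auto
  ultimately have e: "lev F (Suc i) = vec.span (lev F' i \<union> lev F 1)" using ins by auto
  have "\<not> lev F 1 \<subseteq> lev F' (Suc i)"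
  proof
    assume a: "lev F 1 \<subseteq> lev F' (Suc i)"
    have "lev F' i \<subseteq> lev F' (Suc i)" using X_mono[OF F(2)] step by simp
    then have "lev F (Suc i) \<subseteq> lev F' (Suc i)" unfolding e
      using a X_subspace[OF F(2), of "Suc i"] step by (intro vec.span_minimal) auto
    then have "lev F (Suc i) = lev F' (Suc i)"
      using X_subspace X_dim F step by (intro vec_subspace_eqI) auto
    then show False using c step by (auto simp: cstep_def)
  qed
  then show ?case using e by simp
qed

lemma csteps_X: "(cstep ^^ k) F F' \<Longrightarrow> F \<in> X \<Longrightarrow> F' \<in> X"
proof (induction k)
  case (Suc k)
  then obtain F1 where "cstep F1 F'" by (auto elim: relpowp_Suc_E)
  then show ?case by (simp add: cstep_def)
qed simp

lemma csteps_sub: "(cstep ^^ k) F F' \<Longrightarrow> F \<in> X \<Longrightarrow> j + k \<le> n \<Longrightarrow> lev F' j \<subseteq> lev F (j + k)"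
proof (induction k arbitrary: F)
  case (Suc k)
  obtain F1 where c: "cstep F F1" "(cstep ^^ k) F1 F'" using relpowp_Suc_D2[OF Suc.prems(1)] by auto
  have F1: "F1 \<in> X" using c(1) by (simp add: cstep_def)
  have 1: "lev F' j \<subseteq> lev F1 (j + k)" using Suc.IH[OF c(2) F1] Suc.prems(3) by simp
  show ?case
  proof (cases "j + k = 0")
    case True
    then have "lev F' j = {0}" using X_0[OF csteps_X[OF Suc.prems(1,2)]] by simp
    then show ?thesis using X_subspace[of F "j + Suc k"] Suc.prems(2,3) by (simp add: vec.subspace_0)
  next
    case False
    then have "1 \<le> j + k" by linarith
    then have "lev F1 (j + k) \<subseteq> lev F (Suc (j + k))" using cstep_sub[OF c(1), of "j + k"] Suc.prems(3) by simp
    then show ?thesis using 1 by simp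
  qed
qed simp

text \<open>With \<open>p_j\<close> the point of the \<open>j\<close>-th chamber,
  \<open>lev F i\<close> is spanned by \<open>p_0, ..., p_(i-1)\<close>; the first \<open>k\<close>
  of these lie in \<open>lev F k\<close>, the others in \<open>lev F' (i-k)\<close>.\<close>

lemma csteps_span:
  "(cstep ^^ k) F F' \<Longrightarrow> F \<in> X \<Longrightarrow> k \<le> i \<Longrightarrow> i \<le> n \<Longrightarrow> lev F i \<subseteq> vec.span (lev F' (i-k) \<union> lev F k)"
proof (induction k arbitrary: F i)
  case 0
  then show ?case using vec.span_superset[of "lev F i \<union> lev F 0"] by auto
next
  case (Suc k)
  obtain F1 where c: "cstep F F1" "(cstep ^^ k) F1 F'" using relpowp_Suc_D2[OF Suc.prems(1)] by auto
  have F1: "F1 \<in> X" using c by (simp add: cstep_def)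
  let ?S = "vec.span (lev F' (i - Suc k) \<union> lev F (Suc k))"
  have "lev F1 k \<subseteq> lev F (Suc k)"
  proof (cases "k = 0")
    case True
    then show ?thesis using X_0[OF F1] X_subspace[of F "Suc k"] Suc.prems by (simp add: vec.subspace_0)
  next
    case False
    then show ?thesis using c Suc.prems by (simp add: cstep_def)
  qed
  then have "vec.span (lev F' (i - Suc k) \<union> lev F1 k) \<subseteq> ?S" by (intro vec.span_mono) auto
  moreover have "lev F1 (i-1) \<subseteq> vec.span (lev F' (i-1-k) \<union> lev F1 k)"
    using Suc.IH[OF c(2) F1, of "i-1"] Suc.prems by simp
  ultimately have 1: "lev F1 (i-1) \<subseteq> ?S" by simp
  have "lev F 1 \<subseteq> lev F (Suc k)" using X_mono Suc.prems by simp
  then have "lev F 1 \<subseteq> ?S" using vec.span_superset[of "lev F' (i - Suc k) \<union> lev F (Suc k)"] by auto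
  with 1 have "vec.span (lev F1 (i-1) \<union> lev F 1) \<subseteq> ?S" by (intro vec.span_minimal) auto
  then show ?case using cstep_lift[OF c(1), of i] Suc.prems by simp
qed

text \<open>If \<open>p\<^sub>k\<close> is the point of the \<open>k\<close>-th chamber visited, then the \<open>i\<close>-th level of that chamber is spanned
  by \<open>p\<^sub>k, \<dots>, p\<^bsub>k+i-1\<^esub>\<close>, and \<open>p\<^sub>k\<close> is perpendicular to the next \<open>n - 1\<close> points but not to \<open>p\<^bsub>k+n\<^esub>\<close>.
  The Gram matrix between the first and the last chamber is therefore triangular.\<close>

lemma csteps_opposite:
  "(cstep ^^ k) F F' \<Longrightarrow> F \<in> X \<Longrightarrow> k \<le> n \<Longrightarrow> i \<le> k \<Longrightarrow> lev F i \<inter> perp (lev F' (n - k + i)) = {0}"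
proof (induction k arbitrary: F i)
  case 0
  then show ?case using X_0 by (auto simp: perp_def)
next
  case (Suc k)
  obtain F1 where c: "cstep F F1" "(cstep ^^ k) F1 F'" using relpowp_Suc_D2[OF Suc.prems(1)] by auto
  have F1: "F1 \<in> X" using c by (simp add: cstep_def)
  have F': "F' \<in> X" using csteps_X[OF c(2) F1] .
  note F = Suc.prems(2)
  show ?case
  proof (cases "i = 0")
    case True
    then show ?thesis using X_0[OF F] by (auto simp: perp_def)
  next
    case False
    let ?r = "n - k + (i-1)"
    have r: "n - Suc k + i = ?r" "n - k \<le> ?r" "?r \<le> n" using False Suc.prems by auto
    \<comment> \<open>Provides a vector \<open>t\<close> of \<open>lev F' (n-k)\<close> that
      completes \<open>lev F1 (n-1)\<close> to \<open>lev F1 n\<close>; it detects the component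
      along the point \<open>lev F 1\<close>.\<close>
    have "\<not> lev F' (n-k) \<subseteq> lev F1 (n-1)"
    proof
      assume a: "lev F' (n-k) \<subseteq> lev F1 (n-1)"
      have "lev F1 n \<subseteq> vec.span (lev F' (n-k) \<union> lev F1 k)"
        using csteps_span[OF c(2) F1, of n] Suc.prems by simp
      also have "\<dots> \<subseteq> lev F1 (n-1)"
        using a X_mono[OF F1, of k "n-1"] X_subspace[OF F1, of "n-1"] Suc.prems
        by (intro vec.span_minimal) auto
      finally have "vec.dim (lev F1 n) \<le> vec.dim (lev F1 (n-1))" by (rule vec.dim_subset)
      then show False using X_dim[OF F1] n2 by simp
    qed
    then obtain t where t: "t \<in> lev F' (n-k)" "t \<notin> lev F1 (n-1)" by auto
    have t1: "t \<in> lev F1 n" using csteps_sub[OF c(2) F1, of "n-k"] t Suc.prems by auto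
    have span1: "vec.span (insert t (lev F1 (n-1))) = lev F1 n"
      by (rule span_insert_eq) (use X_subspace X_dim X_mono F1 t t1 n2 in auto)
    have zero: "x = 0" if x: "x \<in> lev F i" "x \<in> perp (lev F' ?r)" for x
    proof -
      have "lev F i = vec.span (lev F1 (i-1) \<union> lev F 1)"
        using cstep_lift[OF c(1), of i] False Suc.prems by simp
      then obtain y z where yz: "x = y + z" "y \<in> lev F1 (i-1)" "z \<in> lev F 1"
        using x(1) X_subspace[OF F1, of "i-1"] X_subspace[OF F, of 1] Suc.prems n2
        unfolding vec.span_Un by (auto simp: vec.span_eq_iff[THEN iffD2])
      have tr: "t \<in> lev F' ?r" using t(1) X_mono[OF F' r(2,3)] by auto
      have "i - 1 \<le> n" using Suc.prems(3,4) by simp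
      then have yn: "y \<in> lev F1 n" using yz(2) X_mono[OF F1, of "i-1" n] by auto
      have "B x t = 0" using x(2) tr by (simp add: perp_def)
      moreover have "B y t = 0" using yn t1 TS_B X_TS[OF F1, of n] by blast
      ultimately have zt: "B z t = 0" by (simp add: yz(1) B_add_left)
      \<comment> \<open>A nonzero \<open>z\<close> perpendicular to \<open>t\<close> would be
        perpendicular to all of \<open>lev F1 n\<close>, hence contained in this generator, against
        \<open>cstep_lift\<close>.\<close>
      have "z = 0"
      proof (rule ccontr)
        assume nz: "z \<noteq> 0"
        have "lev F1 (n-1) \<subseteq> lev F n" using cstep_sub[OF c(1), of "n-1"] n2 by simp
        moreover have "z \<in> lev F n" using yz(3) X_mono[OF F, of 1 n] n2 by auto
        ultimately have "z \<in> perp (insert t (lev F1 (n-1)))"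
          using zt TS_B[OF X_TS[OF F, of n]] by (auto simp: perp_def)
        then have "z \<in> perp (lev F1 n)" using perp_span span1 by metis
        then have "z \<in> lev F1 n" using G_perp X_G F1 by auto
        moreover have "vec.span {z} = lev F 1"
          by (rule vec_subspace_eqI)
            (use nz yz(3) X_subspace[OF F, of 1] X_dim[OF F, of 1] n2 vec.span_minimal[of "{z}" "lev F 1"] in auto)
        ultimately have "lev F 1 \<subseteq> lev F1 n"
          using vec.span_minimal[of "{z}" "lev F1 n"] X_subspace[OF F1, of n] by auto
        then show False using cstep_lift[OF c(1), of n] n2 by simp
      qed
      then have "x \<in> lev F1 (i-1) \<inter> perp (lev F' (n - k + (i-1)))" using x yz by simp
      moreover have "k \<le> n" "i - 1 \<le> k" using Suc.prems(3,4) by auto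
      ultimately show ?thesis using Suc.IH[OF c(2) F1, of "i-1"] by blast
    qed
    have "0 \<in> lev F i" "0 \<in> perp (lev F' ?r)"
      using X_subspace[OF F, of i] subspace_perp Suc.prems(3,4) by (simp_all add: vec.subspace_0)
    then show ?thesis unfolding r(1) using zero by blast
  qed
qed

text \<open>Opposition in the polar space at every level: no point of \<open>lev F i\<close> is
  collinear with all of \<open>lev F' i\<close>.\<close>

definition opp :: "('a^'d) set set \<Rightarrow> ('a^'d) set set \<Rightarrow> bool" where
  "opp F F' \<longleftrightarrow> F \<in> X \<and> F' \<in> X \<and> (\<forall>i\<le>n. lev F i \<inter> perp (lev F' i) = {0})"

theorem walk_opp: "F \<in> X \<Longrightarrow> F' \<in> walk w0_word F \<Longrightarrow> opp F F'"
proof -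
  assume F: "F \<in> X" and "F' \<in> walk w0_word F"
  then have c: "(cstep ^^ n) F F'" by (rule walk_w0)
  have "lev F i \<inter> perp (lev F' i) = {0}" if "i \<le> n" for i
    using csteps_opposite[OF c F order_refl that] by simp
  then show "opp F F'" unfolding opp_def using F csteps_X[OF c F] by simp
qed

lemma opp_sym:
  assumes "opp F F'"
  shows "opp F' F"
proof -
  have X: "F \<in> X" "F' \<in> X" using assms by (auto simp: opp_def)
  have "lev F' i \<inter> perp (lev F i) = {0}" if i: "i \<le> n" for i
  proof -
    let ?E = "lev F i" and ?E' = "lev F' i"
    have s: "vec.subspace ?E" "vec.subspace ?E'" using X_subspace X i by auto
    have "vec.dim (vec.span (?E \<union> perp ?E')) = 2 * n"
      using dim_span_Un_Int[OF s(1) subspace_perp, of ?E'] assms i dim_perp[OF s(2)] X_dim[of _ i] X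
      by (auto simp: opp_def)
    then have "perp (vec.span (?E \<union> perp ?E')) = {0}"
      using dim_perp[of "vec.span (?E \<union> perp ?E')"] vec.dim_eq_0[of "perp (vec.span (?E \<union> perp ?E'))"]
        vec.subspace_0[OF subspace_perp] by auto
    then show ?thesis using perp_perp[OF s(2)] by (simp add: perp_span perp_Un Int_commute)
  qed
  then show ?thesis using X by (simp add: opp_def)
qed

section \<open>Hyperbolic bases adapted to opposite chambers\<close>

abbreviation I :: "int set" where "I \<equiv> frame_indices n"

definition hbasis :: "(int \<Rightarrow> 'a^'d) \<Rightarrow> bool" where
  "hbasis U \<longleftrightarrow> (\<forall>i\<in>I. Q (U i) = 0) \<and> (\<forall>i\<in>I. \<forall>j\<in>I. B (U i) (U j) = (if j = - i then 1 else 0))"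

lemma I_iff: "i \<in> I \<longleftrightarrow> i \<noteq> 0 \<and> - int n \<le> i \<and> i \<le> int n"
  by (auto simp: frame_indices_def)

lemma finite_I: "finite I" and card_I: "card I = 2 * n" and minus_I: "i \<in> I \<Longrightarrow> - i \<in> I"
  by (auto simp: frame_indices_def)

lemma B_sum_left: "B (\<Sum>i\<in>J. c i *s U i) y = (\<Sum>i\<in>J. c i * B (U i) y)"
proof (cases "finite J")
  case True
  then show ?thesis by (induction J rule: finite_induct) (auto simp: B_add_left B_scale_left)
qed simp

lemma B_sum_right: "B y (\<Sum>i\<in>J. c i *s U i) = (\<Sum>i\<in>J. c i * B y (U i))"
  using B_sum_left[of c U J y] B_commute by simp

lemma hbasis_coeff:
  assumes "hbasis U" "i \<in> I" "J \<subseteq> I"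
  shows "B (\<Sum>j\<in>J. c j *s U j) (U (- i)) = (if i \<in> J then c i else 0)"
proof -
  have "B (\<Sum>j\<in>J. c j *s U j) (U (- i)) = (\<Sum>j\<in>J. c j * (if j = i then 1 else 0))"
    unfolding B_sum_left using assms minus_I[OF assms(2)]
    by (intro sum.cong refl) (auto simp: hbasis_def)
  also have "\<dots> = (if i \<in> J then c i else 0)"
    using finite_subset[OF assms(3) finite_I] by (simp add: if_distrib[of "\<lambda>x. _ * x"] cong: if_cong)
  finally show ?thesis .
qed

lemma hbasis_inj: assumes "hbasis U" shows "inj_on U I"
proof (rule inj_onI)
  fix i j assume ij: "i \<in> I" "j \<in> I" "U i = U j"
  have "B (U i) (U (- i)) = 1" using assms ij(1) minus_I[OF ij(1)] unfolding hbasis_def by simp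
  moreover have "B (U j) (U (- i)) = (if - i = - j then 1 else 0)"
    using assms ij(2) minus_I[OF ij(1)] unfolding hbasis_def by simp
  ultimately show "i = j" using ij(3) by (auto split: if_splits)
qed

lemma hbasis_independent:
  assumes "hbasis U"
  shows "vec.independent (U ` I)"
proof (rule vec.independent_if_scalars_zero)
  show "finite (U ` I)" using finite_I by simp
  fix f x assume s: "(\<Sum>x\<in>U ` I. f x *s x) = 0" and x: "x \<in> U ` I"
  then obtain i where i: "i \<in> I" "x = U i" by auto
  have "(\<Sum>j\<in>I. f (U j) *s U j) = 0" using s by (simp add: sum.reindex[OF hbasis_inj[OF assms]])
  then show "f x = 0" using hbasis_coeff[OF assms i(1) subset_refl, of "\<lambda>j. f (U j)"] i by simp
qed

lemma hbasis_span: assumes "hbasis U" shows "vec.span (U ` I) = UNIV"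
proof -
  have "vec.dim (vec.span (U ` I)) = 2 * n"
    using vec.dim_span_eq_card_independent[OF hbasis_independent[OF assms]]
    by (simp add: card_image[OF hbasis_inj[OF assms]] card_I)
  then show ?thesis using dim_UNIV by (intro vec_subspace_eqI) (auto simp del: vec.dim_UNIV)
qed

lemma hbasis_expand:
  assumes U: "hbasis U"
  shows "x = (\<Sum>i\<in>I. B x (U (- i)) *s U i)"
proof -
  have "x \<in> vec.span (U ` I)" using hbasis_span[OF U] by simp
  then obtain c where "x = (\<Sum>v\<in>U ` I. c v *s v)"
    using vec.span_finite[of "U ` I"] finite_I by auto
  then have x: "x = (\<Sum>i\<in>I. c (U i) *s U i)" by (simp add: sum.reindex[OF hbasis_inj[OF U]])
  have "B x (U (- i)) = c (U i)" if "i \<in> I" for i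
    using hbasis_coeff[OF U that subset_refl, of "\<lambda>i. c (U i)"] that x by simp
  then show ?thesis using x by simp
qed

lemma hbasis_mem_span:
  assumes U: "hbasis U" and J: "J \<subseteq> I"
  shows "x \<in> vec.span (U ` J) \<longleftrightarrow> (\<forall>i\<in>I - J. B x (U (- i)) = 0)"
proof
  assume "x \<in> vec.span (U ` J)"
  moreover have "vec.span (U ` J) \<subseteq> perp ((\<lambda>i. U (- i)) ` (I - J))"
  proof (rule vec.span_minimal[OF _ subspace_perp])
    have "B (U j) (U (- i)) = 0" if "j \<in> J" "i \<in> I - J" for i j
      using U J that minus_I[of i] unfolding hbasis_def by auto
    then show "U ` J \<subseteq> perp ((\<lambda>i. U (- i)) ` (I - J))" by (auto simp: perp_def)
  qed
  ultimately show "\<forall>i\<in>I - J. B x (U (- i)) = 0" by (auto simp: perp_def)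
next
  assume z: "\<forall>i\<in>I - J. B x (U (- i)) = 0"
  have "x = (\<Sum>i\<in>I. B x (U (- i)) *s U i)" by (rule hbasis_expand[OF U])
  also have "\<dots> = (\<Sum>i\<in>J. B x (U (- i)) *s U i)"
    by (rule sum.mono_neutral_right) (use z J finite_I in auto)
  also have "\<dots> \<in> vec.span (U ` J)" by (intro vec.span_sum vec.span_scale vec.span_base) auto
  finally show "x \<in> vec.span (U ` J)" .
qed

lemma hbasis_span_inter:
  assumes "hbasis U" "J \<subseteq> I" "K \<subseteq> I"
  shows "vec.span (U ` J) \<inter> vec.span (U ` K) = vec.span (U ` (J \<inter> K))"
proof -
  have JK: "J \<inter> K \<subseteq> I" using assms by auto
  show ?thesis
    by (auto simp: hbasis_mem_span[OF assms(1,2)] hbasis_mem_span[OF assms(1,3)] hbasis_mem_span[OF assms(1) JK])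
qed

lemma hbasis_dim:
  assumes "hbasis U" "J \<subseteq> I"
  shows "vec.dim (vec.span (U ` J)) = card J"
proof -
  have "vec.independent (U ` J)"
    using hbasis_independent[OF assms(1)] by (rule vec.independent_mono) (use assms in auto)
  then show ?thesis
    using vec.dim_span_eq_card_independent card_image[OF inj_on_subset[OF hbasis_inj[OF assms(1)] assms(2)]]
    by metis
qed

lemma hbasis_TS:
  assumes U: "hbasis U" and J: "J \<subseteq> I" "\<And>i. i \<in> J \<Longrightarrow> - i \<notin> J"
  shows "TS (vec.span (U ` J))"
proof -
  have fin: "finite J" using J(1) finite_I by (rule finite_subset)
  have Q0: "Q (\<Sum>i\<in>K. c i *s U i) = 0" if "K \<subseteq> J" for K c
    using finite_subset[OF that fin] that
  proof (induction K rule: finite_induct)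
    case (insert k K)
    have kJ: "k \<in> J" "k \<in> I" using insert.prems J(1) by auto
    have "B (U k) (U j) = 0" if "j \<in> K" for j
    proof -
      have "j \<in> I" "j \<noteq> - k" using that insert.prems J(1) J(2)[OF kJ(1)] by auto
      then show ?thesis using U kJ(2) unfolding hbasis_def by simp
    qed
    then have "B (c k *s U k) (\<Sum>i\<in>K. c i *s U i) = 0" by (simp add: B_scale_left B_sum_right)
    moreover have "Q (U k) = 0" using insert J(1) U unfolding hbasis_def by auto
    ultimately show ?case using insert by (simp add: Q_add Q_scale)
  qed (simp add: Q_0)
  have "Q x = 0" if "x \<in> vec.span (U ` J)" for x
  proof -
    have "x = (\<Sum>i\<in>I. B x (U (- i)) *s U i)" by (rule hbasis_expand[OF U])
    also have "\<dots> = (\<Sum>i\<in>J. B x (U (- i)) *s U i)"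
      by (rule sum.mono_neutral_right) (use that hbasis_mem_span[OF U J(1)] J finite_I in auto)
    finally show ?thesis using Q0[OF subset_refl] by metis
  qed
  then show ?thesis by (simp add: totally_singular_def)
qed

text \<open>\<open>Q\<close> is determined by the values of \<open>Q\<close> and \<open>B\<close> on
  a basis, so the linear map between the bases preserves it; a kernel vector would lie in
  \<open>perp UNIV\<close>.\<close>

lemma hbasis_isometry:
  assumes V: "hbasis V" and U: "hbasis U"
  obtains g where "Vector_Spaces.linear (*s) (*s) g" "bij g" "\<And>x. Q (g x) = Q x" "\<And>i. i \<in> I \<Longrightarrow> g (V i) = U i"
proof -
  obtain g where g: "Vector_Spaces.linear (*s) (*s) g" "\<forall>x\<in>V ` I. g x = U (inv_into I V x)"
    using vec.linear_independent_extend[OF hbasis_independent[OF V], of "\<lambda>x. U (inv_into I V x)"] by blast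
  have gV: "g (V i) = U i" if "i \<in> I" for i
    using g(2) that inv_into_f_f[OF hbasis_inj[OF V] that] by auto
  interpret g: Vector_Spaces.linear "(*s)" "(*s)" g by (rule g(1))
  have gs: "g (\<Sum>i\<in>J. c i *s V i) = (\<Sum>i\<in>J. c i *s U i)" if "J \<subseteq> I" for J c
    unfolding g.sum g.scale by (intro sum.cong refl) (use gV that in auto)
  have Qs: "Q (\<Sum>i\<in>J. c i *s U i) = Q (\<Sum>i\<in>J. c i *s V i)" if "J \<subseteq> I" for J c
    using finite_subset[OF that finite_I] that
  proof (induction J rule: finite_induct)
    case (insert k J)
    have "B (U k) (U j) = B (V k) (V j)" if "j \<in> J" for j
      using insert that U V unfolding hbasis_def by auto
    then have "B (c k *s U k) (\<Sum>i\<in>J. c i *s U i) = B (c k *s V k) (\<Sum>i\<in>J. c i *s V i)"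
      by (simp add: B_scale_left B_sum_right)
    moreover have "Q (U k) = Q (V k)" using insert U V unfolding hbasis_def by auto
    ultimately show ?case using insert by (simp add: Q_add Q_scale)
  qed simp
  have Qg: "Q (g x) = Q x" for x
    using gs[OF subset_refl] Qs[OF subset_refl] hbasis_expand[OF V, of x] by metis
  have Bg: "B (g x) (g y) = B x y" for x y
    using Qg[of "x + y"] by (simp add: polar_form_def g.add Qg)
  have "inj g"
  proof (rule injI)
    fix x y assume "g x = g y"
    then have "B (x - y) z = 0" for z using Bg[of x z] Bg[of y z] by (simp add: B_diff_left)
    then have "x - y \<in> perp UNIV" by (simp add: perp_def)
    then show "x = y" using perp_UNIV by simp
  qed
  then have "bij g" using finite_UNIV_inj_surj[of g] by (simp add: bij_def)
  then show ?thesis using that g(1) Qg gV by blast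
qed

text \<open>Dimensions alone give a nonzero \<open>u\<close> in \<open>lev F i\<close> perpendicular
  to \<open>lev F' (i-1)\<close>, and symmetrically \<open>v\<close>. If \<open>B u v = 0\<close>,
  then \<open>u\<close> would be perpendicular to all of \<open>lev F' i\<close>, against
  opposition.\<close>

lemma opp_vectors:
  assumes o: "opp F F'" and i: "1 \<le> i" "i \<le> n"
  shows "\<exists>u v. u \<in> lev F i \<and> u \<in> perp (lev F' (i-1)) \<and> v \<in> lev F' i \<and> v \<in> perp (lev F (i-1)) \<and> B u v = 1"
proof -
  have ex: "\<exists>u. u \<noteq> 0 \<and> u \<in> lev A i \<and> u \<in> perp (lev A' (i-1))" if A: "A \<in> X" "A' \<in> X" for A A'
  proof -
    let ?U = "lev A i" and ?W = "perp (lev A' (i-1))"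
    have s: "vec.subspace ?U" "vec.subspace (lev A' (i-1))" using X_subspace A i by auto
    have "vec.dim (vec.span (?U \<union> ?W)) \<le> 2 * n"
      using dim_UNIV vec.dim_subset[of "vec.span (?U \<union> ?W)" UNIV] by (simp del: vec.dim_UNIV vec.dim_span)
    moreover have "vec.dim (vec.span (?U \<union> ?W)) + vec.dim (?U \<inter> ?W) = vec.dim ?U + vec.dim ?W"
      by (rule dim_span_Un_Int[OF s(1) subspace_perp])
    moreover have "vec.dim ?W + vec.dim (lev A' (i-1)) = 2 * n" by (rule dim_perp[OF s(2)])
    moreover have "vec.dim ?U = i" "vec.dim (lev A' (i-1)) = i - 1" using X_dim A i by auto
    ultimately have "vec.dim (?U \<inter> ?W) \<noteq> 0" using i by linarith
    then have "\<not> ?U \<inter> ?W \<subseteq> {0}" unfolding vec.dim_eq_0 .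
    then show ?thesis by auto
  qed
  have X: "F \<in> X" "F' \<in> X" using o by (auto simp: opp_def)
  obtain u where u: "u \<noteq> 0" "u \<in> lev F i" "u \<in> perp (lev F' (i-1))" using ex[OF X] by auto
  obtain v where v: "v \<noteq> 0" "v \<in> lev F' i" "v \<in> perp (lev F (i-1))" using ex[OF X(2,1)] by auto
  have "v \<notin> lev F' (i-1)"
    using opp_sym[OF o] v i unfolding opp_def by (metis IntI diff_le_self le_trans singletonD)
  then have span: "vec.span (insert v (lev F' (i-1))) = lev F' i"
    using X_subspace X_dim X_mono[OF X(2), of "i-1" i] X v i by (intro span_insert_eq) auto
  have nz: "B u v \<noteq> 0"
  proof
    assume "B u v = 0"
    then have "u \<in> perp (insert v (lev F' (i-1)))" using u by (simp add: perp_def)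
    then have "u \<in> perp (lev F' i)" using span perp_span by metis
    then show False using u o i unfolding opp_def by blast
  qed
  let ?v = "inverse (B u v) *s v"
  have "?v \<in> lev F' i" using v X_subspace[OF X(2) i(2)] by (simp add: vec.subspace_scale)
  moreover have "?v \<in> perp (lev F (i-1))" using v subspace_perp by (simp add: vec.subspace_scale)
  moreover have "B u ?v = 1" using nz by (simp add: B_scale_right)
  ultimately show ?thesis using u by blast
qed

text \<open>The vectors from \<open>opp_vectors\<close> are dual to each other: for distinct
  indices, the one of smaller index lies in a level to which the other is perpendicular.\<close>

theorem opp_hbasis:
  assumes o: "opp F F'"
  obtains U where "hbasis U" "\<And>i. i \<le> n \<Longrightarrow> lev F i = vec.span (U ` {1..int i})"
    "\<And>i. i \<le> n \<Longrightarrow> lev F' i = vec.span (U ` {- int i..-1})"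
proof -
  have X: "F \<in> X" "F' \<in> X" using o by (auto simp: opp_def)
  have "\<forall>i. \<exists>u v. 1 \<le> i \<longrightarrow> i \<le> n \<longrightarrow>
     u \<in> lev F i \<and> u \<in> perp (lev F' (i-1)) \<and> v \<in> lev F' i \<and> v \<in> perp (lev F (i-1)) \<and> B u v = 1"
    using opp_vectors[OF o] by blast
  then obtain u v where uv: "\<And>i. 1 \<le> i \<Longrightarrow> i \<le> n \<Longrightarrow>
     u i \<in> lev F i \<and> u i \<in> perp (lev F' (i-1)) \<and> v i \<in> lev F' i \<and> v i \<in> perp (lev F (i-1)) \<and> B (u i) (v i) = 1"
    by metis
  define U where "U i = (if i > 0 then u (nat i) else v (nat (- i)))" for i :: int
  have uu: "B (u i) (u j) = 0" "B (v i) (v j) = 0" "Q (u i) = 0" "Q (v i) = 0"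
    if "1 \<le> i" "i \<le> n" "1 \<le> j" "j \<le> n" for i j
  proof -
    have "u i \<in> lev F n" "u j \<in> lev F n" "v i \<in> lev F' n" "v j \<in> lev F' n"
      using uv[of i] uv[of j] X_mono[OF X(1)] X_mono[OF X(2)] that by blast+
    then show "B (u i) (u j) = 0" "B (v i) (v j) = 0" "Q (u i) = 0" "Q (v i) = 0"
      using TS_B TS_Q X_TS[OF X(1), of n] X_TS[OF X(2), of n] by blast+
  qed
  have uvd: "B (u i) (v j) = (if i = j then 1 else 0)" if ij: "1 \<le> i" "i \<le> n" "1 \<le> j" "j \<le> n" for i j
  proof -
    consider "i = j" | "j < i" | "i < j" by linarith
    then show ?thesis
    proof cases
      case 1 then show ?thesis using uv ij by simp
    next
      case 2
      then have "j \<le> i - 1" "i - 1 \<le> n" using ij by auto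
      then have "v j \<in> lev F' (i-1)" using uv[of j] X_mono[OF X(2), of j "i-1"] ij by blast
      then show ?thesis using uv[of i] ij 2 by (auto simp: perp_def)
    next
      case 3
      then have "i \<le> j - 1" "j - 1 \<le> n" using ij by auto
      then have "u i \<in> lev F (j-1)" using uv[of i] X_mono[OF X(1), of i "j-1"] ij by blast
      then show ?thesis using uv[of j] ij 3 B_commute[of "u i" "v j"] by (auto simp: perp_def)
    qed
  qed
  have nat_I: "1 \<le> nat i \<and> nat i \<le> n" if "i \<in> I" "i > 0" for i using that by (auto simp: I_iff)
  have nat_I': "1 \<le> nat (- i) \<and> nat (- i) \<le> n" if "i \<in> I" "\<not> i > 0" for i using that by (auto simp: I_iff)
  have "hbasis U" unfolding hbasis_def
  proof (intro conjI ballI)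
    fix i assume i: "i \<in> I"
    show "Q (U i) = 0" using uu(3,4) nat_I[OF i] nat_I'[OF i] by (cases "i > 0") (auto simp: U_def)
    fix j assume j: "j \<in> I"
    show "B (U i) (U j) = (if j = - i then 1 else 0)"
    proof (cases "i > 0"; cases "j > 0")
      assume a: "i > 0" "j > 0"
      then show ?thesis using uu(1) nat_I[OF i] nat_I[OF j] by (simp add: U_def)
    next
      assume a: "i > 0" "\<not> j > 0"
      then show ?thesis using uvd[of "nat i" "nat (- j)"] nat_I[OF i] nat_I'[OF j] by (auto simp: U_def)
    next
      assume a: "\<not> i > 0" "j > 0"
      then show ?thesis using uvd[of "nat j" "nat (- i)"] nat_I[OF j] nat_I'[OF i]
        by (auto simp: U_def B_commute[of "v (nat (- i))"])
    next
      assume a: "\<not> i > 0" "\<not> j > 0"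
      then have "j \<noteq> - i" using i j by (auto simp: I_iff)
      then show ?thesis using a uu(2) nat_I'[OF i] nat_I'[OF j] by (simp add: U_def)
    qed
  qed
  note hb = this
  have dims: "vec.dim (vec.span (U ` {1..int i})) = i" "vec.dim (vec.span (U ` {- int i..-1})) = i" if "i \<le> n" for i
  proof -
    have "{1..int i} \<subseteq> I" "{- int i..-1} \<subseteq> I" using that by (auto simp: I_iff)
    then show "vec.dim (vec.span (U ` {1..int i})) = i" "vec.dim (vec.span (U ` {- int i..-1})) = i"
      using hbasis_dim[OF hb] by simp_all
  qed
  have "vec.span (U ` {1..int i}) = lev F i" if i: "i \<le> n" for i
  proof (rule vec_subspace_eqI)
    have "u (nat j) \<in> lev F i" if "1 \<le> j" "j \<le> int i" for j
    proof -
      have "1 \<le> nat j" "nat j \<le> n" "nat j \<le> i" using that i by auto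
      then show ?thesis using uv[of "nat j"] X_mono[OF X(1), of "nat j" i] i by blast
    qed
    then show "vec.span (U ` {1..int i}) \<subseteq> lev F i"
      using X_subspace[OF X(1) i] by (intro vec.span_minimal) (auto simp: U_def)
  qed (use X_subspace[OF X(1) i] dims(1)[OF i] X_dim[OF X(1) i] in auto)
  moreover have "vec.span (U ` {- int i..-1}) = lev F' i" if i: "i \<le> n" for i
  proof (rule vec_subspace_eqI)
    have "v (nat (- j)) \<in> lev F' i" if "- int i \<le> j" "j \<le> -1" for j
    proof -
      have "1 \<le> nat (- j)" "nat (- j) \<le> n" "nat (- j) \<le> i" using that i by auto
      then show ?thesis using uv[of "nat (- j)"] X_mono[OF X(2), of "nat (- j)" i] i by blast
    qed
    then show "vec.span (U ` {- int i..-1}) \<subseteq> lev F' i"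
      using X_subspace[OF X(2) i] by (intro vec.span_minimal) (auto simp: U_def)
  qed (use X_subspace[OF X(2) i] dims(2)[OF i] X_dim[OF X(2) i] in auto)
  ultimately show ?thesis using that hb by metis
qed

end

section \<open>The projective orthogonal group\<close>

context hyperbolic_quadric
begin

abbreviation Sim where "Sim \<equiv> similarity_group Q"

lemma lin_iff: "Vector_Spaces.linear (*s) (*s) f \<longleftrightarrow>
    (\<forall>x y. f (x + y) = f x + f y) \<and> (\<forall>c x. f (c *s x) = c *s f x)" for f :: "'a^'d \<Rightarrow> 'a^'d"
  by (simp add: Vector_Spaces.linear_iff vec.vector_space_axioms)

lemma Sim_simps: "f \<otimes>\<^bsub>Sim\<^esub> g = f \<circ> g" "\<one>\<^bsub>Sim\<^esub> = id"
  by (simp_all add: similarity_group_def)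

lemma Sim_carrier: "f \<in> carrier Sim \<longleftrightarrow> Vector_Spaces.linear (*s) (*s) f \<and> bij f \<and>
    (\<exists>c. c \<noteq> 0 \<and> (\<forall>v. Q (f v) = c * Q v))"
  by (simp add: similarity_group_def)

lemma Sim_isometry: "Vector_Spaces.linear (*s) (*s) f \<Longrightarrow> bij f \<Longrightarrow> (\<And>v. Q (f v) = Q v) \<Longrightarrow> f \<in> carrier Sim"
  unfolding Sim_carrier by (auto intro!: exI[of _ 1])

lemma Sim_group: "group Sim"
proof (rule groupI)
  fix f g assume f: "f \<in> carrier Sim" and g: "g \<in> carrier Sim"
  obtain c d where c: "c \<noteq> 0" "\<forall>v. Q (f v) = c * Q v" and d: "d \<noteq> 0" "\<forall>v. Q (g v) = d * Q v"
    using f g unfolding Sim_carrier by auto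
  have "\<exists>e. e \<noteq> 0 \<and> (\<forall>v. Q ((f \<circ> g) v) = e * Q v)"
    using c d by (intro exI[of _ "c * d"]) (simp add: mult.assoc)
  then show "f \<otimes>\<^bsub>Sim\<^esub> g \<in> carrier Sim"
    using f g unfolding Sim_carrier Sim_simps lin_iff by (simp add: bij_comp)
next
  show "\<one>\<^bsub>Sim\<^esub> \<in> carrier Sim"
    unfolding Sim_simps by (rule Sim_isometry) (auto simp: lin_iff)
next
  fix f assume f: "f \<in> carrier Sim"
  obtain c where c: "c \<noteq> 0" "\<forall>v. Q (f v) = c * Q v" using f unfolding Sim_carrier by auto
  have l: "f (x + y) = f x + f y" "f (a *s x) = a *s f x" and b: "bij f" for a x y
    using f unfolding Sim_carrier lin_iff by auto
  define h where "h = inv_into UNIV f"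
  have fh: "f (h x) = x" "h (f x) = x" for x
    using b unfolding h_def by (simp_all add: bij_is_surj surj_f_inv_f bij_is_inj)
  have "h (x + y) = h x + h y" for x y using l(1)[of "h x" "h y"] fh by metis
  moreover have "h (a *s x) = a *s h x" for a x using l(2)[of a "h x"] fh by metis
  moreover have "bij h" unfolding h_def using b by (rule bij_imp_bij_inv)
  moreover have "Q (h v) = inverse c * Q v" for v
  proof -
    have "Q v = c * Q (h v)" using c(2) fh by metis
    then show ?thesis using c(1) by simp
  qed
  then have "\<exists>e. e \<noteq> 0 \<and> (\<forall>v. Q (h v) = e * Q v)" using c(1) by (intro exI[of _ "inverse c"]) simp
  ultimately have "h \<in> carrier Sim" unfolding Sim_carrier lin_iff by simp
  moreover have "h \<otimes>\<^bsub>Sim\<^esub> f = \<one>\<^bsub>Sim\<^esub>" using fh by (auto simp: Sim_simps)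
  ultimately show "\<exists>g\<in>carrier Sim. g \<otimes>\<^bsub>Sim\<^esub> f = \<one>\<^bsub>Sim\<^esub>" by blast
qed (auto simp: Sim_simps o_assoc)

lemma scalar_map_carrier:
  assumes "c \<noteq> 0"
  shows "(*s) c \<in> carrier Sim"
proof -
  have "bij ((*s) c :: 'a^'d \<Rightarrow> 'a^'d)"
    by (rule o_bij[of "(*s) (inverse c)"]) (use assms in \<open>auto simp: fun_eq_iff\<close>)
  moreover have "\<exists>e. e \<noteq> 0 \<and> (\<forall>v. Q (c *s v) = e * Q v)"
    using assms by (intro exI[of _ "c\<^sup>2"]) (simp add: Q_scale)
  ultimately show ?thesis
    unfolding Sim_carrier lin_iff by (simp add: vec.scale_right_distrib mult.commute)
qed

lemma scalar_maps_normal: "scalar_maps \<lhd> Sim"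
proof -
  interpret Sim: group Sim by (rule Sim_group)
  show ?thesis
  proof (rule Sim.normalI)
    show "subgroup scalar_maps Sim"
    proof (rule Sim.subgroupI)
      show "scalar_maps \<subseteq> carrier Sim" using scalar_map_carrier by (auto simp: scalar_maps_def)
      show "scalar_maps \<noteq> {}" by (auto simp: scalar_maps_def intro: exI[of _ 1])
    next
      fix f :: "'a^'d \<Rightarrow> 'a^'d" assume "f \<in> scalar_maps"
      then obtain c where c: "f = (*s) c" "c \<noteq> 0" by (auto simp: scalar_maps_def)
      have "inv\<^bsub>Sim\<^esub> f = (*s) (inverse c)"
        by (rule Sim.inv_equality) (use c(2) scalar_map_carrier in \<open>simp_all add: c(1) Sim_simps o_def id_def\<close>)
      then show "inv\<^bsub>Sim\<^esub> f \<in> scalar_maps" using c by (auto simp: scalar_maps_def)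
    next
      fix f g :: "'a^'d \<Rightarrow> 'a^'d" assume "f \<in> scalar_maps" "g \<in> scalar_maps"
      then obtain c d where "f = (*s) c" "c \<noteq> 0" "g = (*s) d" "d \<noteq> 0" by (auto simp: scalar_maps_def)
      then have "f \<circ> g = (*s) (c * d)" "c * d \<noteq> 0" by (auto simp: fun_eq_iff)
      then show "f \<otimes>\<^bsub>Sim\<^esub> g \<in> scalar_maps" by (auto simp: Sim_simps scalar_maps_def)
    qed
    show "\<forall>f\<in>carrier Sim. scalar_maps #>\<^bsub>Sim\<^esub> f = f <#\<^bsub>Sim\<^esub> scalar_maps"
    proof
      fix f assume "f \<in> carrier Sim"
      then have "(*s) c \<circ> f = f \<circ> (*s) c" for c
        unfolding Sim_carrier lin_iff by (auto simp: fun_eq_iff)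
      then show "scalar_maps #>\<^bsub>Sim\<^esub> f = f <#\<^bsub>Sim\<^esub> scalar_maps"
        unfolding r_coset_def l_coset_def Sim_simps by (auto simp: scalar_maps_def)
    qed
  qed
qed

definition proj :: "('a^'d \<Rightarrow> 'a^'d) \<Rightarrow> ('a^'d \<Rightarrow> 'a^'d) set" where
  "proj f = scalar_maps #>\<^bsub>Sim\<^esub> f"

lemma PGO_group: "group (PGO Q)"
  unfolding PGO_def by (rule normal.factorgroup_is_group[OF scalar_maps_normal])

lemma proj_carrier: "f \<in> carrier Sim \<Longrightarrow> proj f \<in> carrier (PGO Q)"
  unfolding PGO_def proj_def FactGroup_def RCOSETS_def by auto

lemma proj_mult: "f \<in> carrier Sim \<Longrightarrow> g \<in> carrier Sim \<Longrightarrow> proj f \<otimes>\<^bsub>PGO Q\<^esub> proj g = proj (f \<circ> g)"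
  using normal.rcos_sum[OF scalar_maps_normal, of f g] by (simp add: PGO_def proj_def FactGroup_def Sim_simps)

lemma act_proj:
  assumes f: "f \<in> carrier Sim" and U: "vec.subspace U"
  shows "act (proj f) U = f ` U"
proof -
  have l: "c *s f u = f (c *s u)" for c u using f unfolding Sim_carrier lin_iff by auto
  have "act (proj f) U = (\<Union>c\<in>{c. c \<noteq> 0}. (\<lambda>u. f (c *s u)) ` U)"
    unfolding act_def proj_def r_coset_def Sim_simps scalar_maps_def by (auto simp: l)
  also have "\<dots> = f ` U"
  proof
    show "(\<Union>c\<in>{c. c \<noteq> 0}. (\<lambda>u. f (c *s u)) ` U) \<subseteq> f ` U" using U by (auto simp: vec.subspace_scale)
    show "f ` U \<subseteq> (\<Union>c\<in>{c. c \<noteq> 0}. (\<lambda>u. f (c *s u)) ` U)"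
    proof
      fix v assume "v \<in> f ` U"
      then show "v \<in> (\<Union>c\<in>{c. c \<noteq> 0}. (\<lambda>u. f (c *s u)) ` U)" by (intro UN_I[of 1]) auto
    qed
  qed
  finally show ?thesis .
qed

definition isom :: "('a^'d \<Rightarrow> 'a^'d) \<Rightarrow> bool" where
  "isom f \<longleftrightarrow> Vector_Spaces.linear (*s) (*s) f \<and> bij f \<and> (\<forall>v. Q (f v) = Q v)"

lemma isom_carrier: "isom f \<Longrightarrow> f \<in> carrier Sim" by (simp add: isom_def Sim_isometry)

lemma isom_comp: "isom f \<Longrightarrow> isom g \<Longrightarrow> isom (f \<circ> g)"
  unfolding isom_def lin_iff by (simp add: bij_comp)

lemma isom_subspace:
  assumes f: "isom f" and U: "vec.subspace U"
  shows "vec.subspace (f ` U)" "vec.dim (f ` U) = vec.dim U"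
proof -
  interpret f: Vector_Spaces.linear "(*s)" "(*s)" f using f by (simp add: isom_def)
  show s: "vec.subspace (f ` U)" using U by (rule f.subspace_image)
  have "card (f ` U) = card U" using f by (intro card_image) (auto simp: isom_def bij_def inj_on_def)
  then show "vec.dim (f ` U) = vec.dim U" using card_subspace[OF U] by (intro dim_eqI_card[OF s]) simp
qed

lemma isom_G: "isom f \<Longrightarrow> N \<in> G \<Longrightarrow> f ` N \<in> G"
  using isom_subspace[of f N] by (auto simp: G_iff totally_singular_def isom_def)

lemma isom_same:
  assumes f: "isom f" and G: "M \<in> G" "N \<in> G"
  shows "same (f ` M) (f ` N) \<longleftrightarrow> same M N"
proof -
  have "f ` M \<inter> f ` N = f ` (M \<inter> N)" using f image_Int[of f M N] by (simp add: isom_def bij_def)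
  then show ?thesis
    using isom_subspace[OF f, of "M \<inter> N"] G by (simp add: same_iff isom_G[OF f] vec.subspace_inter G_subspace)
qed

text \<open>Isometries permute the two classes, so a single generator decides.\<close>

lemma isom_type_preserving:
  assumes f: "isom f" and M: "M \<in> G" "same M (f ` M)"
  shows "proj f \<in> type_preserving n Q"
proof -
  have "same N (act (proj f) N)" if N: "N \<in> G" for N
  proof -
    have g: "f ` M \<in> G" "f ` N \<in> G" using isom_G f M N by auto
    have "same N (f ` N)"
      using same_cycle[OF N M(1) g(2)] same_cycle[OF M(1) g] isom_same[OF f M(1) N] M(2) same_sym by blast
    then show ?thesis using act_proj[OF isom_carrier[OF f] G_subspace[OF N]] by simp
  qed
  then show ?thesis unfolding type_preserving_def using proj_carrier[OF isom_carrier[OF f]] by blast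
qed

lemma type_preserving_same: "isom f \<Longrightarrow> proj f \<in> type_preserving n Q \<Longrightarrow> N \<in> G \<Longrightarrow> same N (f ` N)"
  using act_proj[OF isom_carrier G_subspace] unfolding type_preserving_def by fastforce

lemma polar_frame_hbasis:
  assumes e: "polar_frame n Q e"
  obtains V where "hbasis V" "\<And>i. i \<in> I \<Longrightarrow> e i = vec.span {V i}"
proof -
  have s: "TS (e i)" "vec.dim (e i) = 1" if "i \<in> I" for i
    using e that unfolding polar_frame_def singular_subspaces_def by blast+
  have coll: "TS (vec.span (e i \<union> e j)) \<longleftrightarrow> j \<noteq> - i" if "i \<in> I" "j \<in> I" for i j
    using e that unfolding polar_frame_def collinear_points_def by blast
  have "\<exists>w. e i = vec.span {w}" if i: "i \<in> I" for i
  proof -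
    have "\<not> e i \<subseteq> {0}" using s[OF i] vec.dim_eq_0[of "e i"] by auto
    then obtain w where w: "w \<in> e i" "w \<noteq> 0" by auto
    have "vec.span {w} = e i"
      by (rule vec_subspace_eqI) (use w s[OF i] TS_subspace vec.span_minimal[of "{w}" "e i"] in auto)
    then show ?thesis by auto
  qed
  then obtain w where w: "\<And>i. i \<in> I \<Longrightarrow> e i = vec.span {w i}" by metis
  have wm: "w i \<in> e i" if "i \<in> I" for i using w[OF that] by (auto intro: vec.span_base)
  have Bw: "B (w i) (w j) = 0 \<longleftrightarrow> j \<noteq> - i" if ij: "i \<in> I" "j \<in> I" for i j
  proof
    assume "B (w i) (w j) = 0"
    then have "w i \<in> perp {w j}" by (simp add: perp_def)
    then have "e i \<subseteq> perp (e j)" unfolding w[OF ij(1)] w[OF ij(2)] perp_span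
      using subspace_perp by (intro vec.span_minimal) auto
    then show "j \<noteq> - i" using TS_span_Un[OF s(1)[OF ij(1)] s(1)[OF ij(2)]] coll[OF ij] by blast
  next
    assume "j \<noteq> - i"
    then have ts: "TS (vec.span (e i \<union> e j))" using coll[OF ij] by simp
    show "B (w i) (w j) = 0"
      by (rule TS_B[OF ts]) (use wm ij in \<open>auto intro: vec.span_base\<close>)
  qed
  \<comment> \<open>Only the vectors of negative index are rescaled, so that the product of each
    pair becomes 1.\<close>
  define a where "a i = (if i > 0 then 1 else inverse (B (w (- i)) (w i)))" for i :: int
  define V where "V i = a i *s w i" for i
  have a0: "a i \<noteq> 0" if "i \<in> I" for i using Bw[OF minus_I[OF that] that] by (simp add: a_def)
  have sp: "e i = vec.span {V i}" if i: "i \<in> I" for i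
  proof -
    have "vec.span {V i} \<subseteq> e i"
      using wm[OF i] TS_subspace[OF s(1)[OF i]] unfolding V_def
      by (intro vec.span_minimal) (auto simp: vec.subspace_scale)
    moreover have "w i = inverse (a i) *s V i" using a0[OF i] by (simp add: V_def)
    then have "w i \<in> vec.span {V i}" by (metis vec.span_base vec.span_scale singletonI)
    then have "e i \<subseteq> vec.span {V i}" unfolding w[OF i] by (intro vec.span_minimal) auto
    ultimately show ?thesis by auto
  qed
  have "hbasis V" unfolding hbasis_def
  proof (intro conjI ballI)
    fix i assume i: "i \<in> I"
    show "Q (V i) = 0" using TS_Q[OF s(1)[OF i] wm[OF i]] by (simp add: V_def Q_scale)
    fix j assume j: "j \<in> I"
    show "B (V i) (V j) = (if j = - i then 1 else 0)"
    proof (cases "j = - i")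
      case False
      then show ?thesis using Bw[OF i j] by (simp add: V_def B_scale_left B_scale_right)
    next
      case True
      have "B (w i) (w j) \<noteq> 0" using Bw[OF i j] True by simp
      moreover have "i > 0 \<longleftrightarrow> \<not> j > 0" using True i by (auto simp: I_iff)
      ultimately show ?thesis using True B_commute[of "w i" "w j"]
        by (cases "i > 0") (auto simp: V_def a_def B_scale_left B_scale_right)
    qed
  qed
  then show ?thesis using that sp by blast
qed

lemma frame_span_eq:
  assumes "\<And>i. i \<in> I \<Longrightarrow> e i = vec.span {V i}" "J \<subseteq> I"
  shows "frame_span e J = vec.span (V ` J)"
  unfolding frame_span_def
proof (rule vec.span_eq[THEN iffD2], intro conjI)
  show "(\<Union>i\<in>J. e i) \<subseteq> vec.span (V ` J)"
  proof
    fix x assume "x \<in> (\<Union>i\<in>J. e i)"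
    then obtain i where i: "i \<in> J" "x \<in> vec.span {V i}" using assms by auto
    moreover have "vec.span {V i} \<subseteq> vec.span (V ` J)" using i(1) by (intro vec.span_mono) auto
    ultimately show "x \<in> vec.span (V ` J)" by auto
  qed
  show "V ` J \<subseteq> vec.span (\<Union>i\<in>J. e i)"
  proof
    fix x assume "x \<in> V ` J"
    then obtain i where i: "i \<in> J" "x = V i" by auto
    then have "x \<in> e i" using assms by (auto intro: vec.span_base)
    then show "x \<in> vec.span (\<Union>i\<in>J. e i)" using i(1) by (intro vec.span_base) auto
  qed
qed

lemma linear_image_span:
  fixes g :: "'a^'d \<Rightarrow> 'a^'d"
  assumes "Vector_Spaces.linear (*s) (*s) g" "\<And>i. i \<in> J \<Longrightarrow> g (V i) = U i"
  shows "g ` vec.span (V ` J) = vec.span (U ` J)"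
proof -
  interpret g: Vector_Spaces.linear "(*s)" "(*s)" g by (rule assms(1))
  have "g ` (V ` J) = U ` J" using assms(2) by (auto simp: image_iff)
  then show ?thesis using g.span_image[of "V ` J"] by simp
qed

text \<open>Level \<open>n-1\<close> is left out, being the intersection of the two generators; thus
  \<open>F\<close> and \<open>swp F\<close> have the same flag.\<close>

definition flag_of :: "('a^'d) set set \<Rightarrow> ('a^'d) set set" where
  "flag_of F = lev F ` {1..n-2} \<union> {lev F n, top2 F}"

lemma flag_of_swp: "F \<in> X \<Longrightarrow> flag_of (swp F) = flag_of F"
proof -
  assume F: "F \<in> X"
  have "lev (swp F) ` {1..n-2} = lev F ` {1..n-2}"
    using swp_props(4)[OF F] n2 by (intro image_cong) auto
  then show ?thesis using swp_props(2)[OF F] by (auto simp: flag_of_def)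
qed

definition pos :: "int \<Rightarrow> int set" where "pos s = {1..int n - 1} \<union> {s}"
definition neg :: "int \<Rightarrow> int set" where "neg s = {1 - int n..-1} \<union> {s}"

lemma pos_neg_I:
  assumes "s = int n \<or> s = - int n"
  shows "pos s \<subseteq> I" "neg s \<subseteq> I" "card (pos s) = n" "card (neg s) = n"
    "i \<in> pos s \<Longrightarrow> - i \<notin> pos s" "i \<in> neg s \<Longrightarrow> - i \<notin> neg s"
  using assms n2 by (auto simp: pos_def neg_def I_iff)

lemma hbasis_generators:
  assumes "hbasis U" "s = int n \<or> s = - int n"
  shows "vec.span (U ` pos s) \<in> G" "vec.span (U ` neg s) \<in> G"
  unfolding G_iff
  using hbasis_TS[OF assms(1), of "pos s"] hbasis_TS[OF assms(1), of "neg s"]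
    hbasis_dim[OF assms(1), of "pos s"] hbasis_dim[OF assms(1), of "neg s"] pos_neg_I[OF assms(2)]
  by auto

lemma hbasis_generator_adjacent:
  assumes "hbasis U"
  shows "vec.dim (vec.span (U ` pos (int n)) \<inter> vec.span (U ` pos (- int n))) = n - 1"
    "vec.dim (vec.span (U ` neg (int n)) \<inter> vec.span (U ` neg (- int n))) = n - 1"
proof -
  have "pos (int n) \<inter> pos (- int n) = {1..int n - 1}" "neg (int n) \<inter> neg (- int n) = {1 - int n..-1}"
    "{1..int n - 1} \<subseteq> I" "{1 - int n..-1} \<subseteq> I"
    using n2 by (auto simp: pos_def neg_def I_iff)
  then show "vec.dim (vec.span (U ` pos (int n)) \<inter> vec.span (U ` pos (- int n))) = n - 1"
    "vec.dim (vec.span (U ` neg (int n)) \<inter> vec.span (U ` neg (- int n))) = n - 1"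
    using hbasis_span_inter[OF assms] hbasis_dim[OF assms] pos_neg_I by (auto simp: nat_diff_distrib')
qed

text \<open>The tops enter as unordered pairs because a flag does not record which of its generators
  is level \<open>n\<close>. This leaves the freedom, used in \<open>fits_flip\<close>, to exchange
  \<open>U n\<close> and \<open>U (- n)\<close>.\<close>

definition fits :: "('a^'d) set set \<Rightarrow> ('a^'d) set set \<Rightarrow> (int \<Rightarrow> 'a^'d) \<Rightarrow> bool" where
  "fits F F' U \<longleftrightarrow> hbasis U \<and>
     (\<forall>i<n. lev F i = vec.span (U ` {1..int i}) \<and> lev F' i = vec.span (U ` {- int i..-1})) \<and>
     {lev F n, top2 F} = {vec.span (U ` pos (int n)), vec.span (U ` pos (- int n))} \<and>
     {lev F' n, top2 F'} = {vec.span (U ` neg (int n)), vec.span (U ` neg (- int n))}"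

lemma opp_fits:
  assumes o: "opp F F'"
  obtains U where "fits F F' U"
proof -
  have X: "F \<in> X" "F' \<in> X" using o by (auto simp: opp_def)
  obtain U where U: "hbasis U" "\<And>i. i \<le> n \<Longrightarrow> lev F i = vec.span (U ` {1..int i})"
    "\<And>i. i \<le> n \<Longrightarrow> lev F' i = vec.span (U ` {- int i..-1})" using opp_hbasis[OF o] by metis
  have idx: "{1..int n} = pos (int n)" "{- int n..-1} = neg (- int n)"
    "{1..int (n - 1)} \<subseteq> pos (- int n)" "{- int (n - 1)..-1} \<subseteq> neg (int n)"
    using n2 by (auto simp: pos_def neg_def)
  have top: "lev F n = vec.span (U ` pos (int n))" "lev F' n = vec.span (U ` neg (- int n))"
    using U(2,3)[of n] idx by auto
  have "top2 F = vec.span (U ` pos (- int n))"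
  proof (rule top2_I[OF X(1)])
    show "vec.span (U ` pos (- int n)) \<in> G" using hbasis_generators[OF U(1)] by simp
    show "lev F (n-1) \<subseteq> vec.span (U ` pos (- int n))"
      using U(2)[of "n-1"] idx(3) by (simp add: vec.span_mono image_mono)
    show "vec.span (U ` pos (- int n)) \<noteq> lev F n"
      using hbasis_generator_adjacent(1)[OF U(1)] top(1) X_dim[OF X(1), of n] n2 by auto
  qed
  moreover have "top2 F' = vec.span (U ` neg (int n))"
  proof (rule top2_I[OF X(2)])
    show "vec.span (U ` neg (int n)) \<in> G" using hbasis_generators[OF U(1)] by simp
    show "lev F' (n-1) \<subseteq> vec.span (U ` neg (int n))"
      using U(3)[of "n-1"] idx(4) by (simp add: vec.span_mono image_mono)
    show "vec.span (U ` neg (int n)) \<noteq> lev F' n"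
      using hbasis_generator_adjacent(2)[OF U(1)] top(2) X_dim[OF X(2), of n] n2 by auto
  qed
  ultimately have "fits F F' U" using U top unfolding fits_def by auto
  then show ?thesis by (rule that)
qed

definition flip :: "int \<Rightarrow> int" where "flip i = (if \<bar>i\<bar> = int n then - i else i)"

lemma fits_flip:
  assumes "fits F F' U"
  shows "fits F F' (U \<circ> flip)"
proof -
  have hb: "hbasis U" using assms by (simp add: fits_def)
  have hb': "hbasis (U \<circ> flip)" unfolding hbasis_def
  proof (intro conjI ballI)
    fix i assume i: "i \<in> I"
    have fI: "flip k \<in> I" if "k \<in> I" for k using that by (auto simp: flip_def I_iff)
    show "Q ((U \<circ> flip) i) = 0" using hb fI[OF i] by (simp add: hbasis_def)
    fix j assume j: "j \<in> I"
    have "flip j = - flip i \<longleftrightarrow> j = - i" by (auto simp: flip_def)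
    then show "B ((U \<circ> flip) i) ((U \<circ> flip) j) = (if j = - i then 1 else 0)"
      using hb fI[OF i] fI[OF j] by (simp add: hbasis_def)
  qed
  have small: "flip ` J = J" if "\<And>j. j \<in> J \<Longrightarrow> \<bar>j\<bar> < int n" for J
  proof -
    have "flip j = j" if "j \<in> J" for j using \<open>\<And>j. j \<in> J \<Longrightarrow> \<bar>j\<bar> < int n\<close>[OF that] by (simp add: flip_def)
    then show ?thesis by (auto simp: image_iff)
  qed
  have low_fix: "flip ` {1..int i} = {1..int i}" "flip ` {- int i..-1} = {- int i..-1}" if "i < n" for i
    by (rule small; use that in auto)+
  have "flip ` {1..int n - 1} = {1..int n - 1}" "flip ` {1 - int n..-1} = {1 - int n..-1}"
    by (rule small; auto)+
  then have top_swap: "flip ` pos s = pos (- s)" "flip ` neg s = neg (- s)" if "s = int n \<or> s = - int n" for s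
    using that by (auto simp: pos_def neg_def image_Un flip_def[of "int n"] flip_def[of "- int n"])
  have comp: "(U \<circ> flip) ` J = U ` (flip ` J)" for J by (simp only: image_comp)
  have swap: "flip ` pos (int n) = pos (- int n)" "flip ` pos (- int n) = pos (int n)"
    "flip ` neg (int n) = neg (- int n)" "flip ` neg (- int n) = neg (int n)"
    using top_swap[of "int n"] top_swap[of "- int n"] by simp_all
  show ?thesis unfolding fits_def comp swap
  proof (intro conjI allI impI)
    show "lev F i = vec.span (U ` flip ` {1..int i})" "lev F' i = vec.span (U ` flip ` {- int i..-1})"
      if "i < n" for i using assms low_fix[OF that] that by (simp_all add: fits_def)
    show "{lev F n, top2 F} = {vec.span (U ` pos (- int n)), vec.span (U ` pos (int n))}"
      "{lev F' n, top2 F'} = {vec.span (U ` neg (- int n)), vec.span (U ` neg (int n))}"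
      using assms by (simp_all add: fits_def insert_commute)
  qed (rule hb')
qed

lemma longest_image:
  "longest_element n ` {1..int i} = {- int i..-1}" if "i < n"
proof -
  have "longest_element n j = - j" if "\<bar>j\<bar> < int n" for j using that by (simp add: longest_element_def)
  then have "longest_element n ` {1..int i} = uminus ` {1..int i}" using that by (intro image_cong) auto
  then show ?thesis by simp
qed

text \<open>The parity of \<open>n\<close> decides which generator goes where, but in both cases the
  pair with index sets \<open>pos n\<close>, \<open>pos (- n)\<close> goes to the pair with
  \<open>neg n\<close>, \<open>neg (- n)\<close>.\<close>

lemma longest_pos:
  "longest_element n ` pos s = neg (if odd n then s else - s)" if "s = int n \<or> s = - int n"
proof -
  have "longest_element n ` {1..int n - 1} = {1 - int n..-1}"
    using longest_image[of "n-1"] n2 by (simp add: of_nat_diff)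
  moreover have "longest_element n s = (if odd n then s else - s)"
    using that by (auto simp: longest_element_def)
  ultimately show ?thesis by (simp add: pos_def neg_def image_Un)
qed

text \<open>A hyperbolic basis adapted to both chambers is unique up to scalars and up to exchanging the vectors
  with indices \<open>n\<close> and \<open>-n\<close>; that exchange fixes both flags but swaps the classes of generators, so
  one of the two choices yields a type-preserving isometry \<open>g\<close>.  As \<open>w\<close> is an involution, \<open>h = g w\<close>
  gives \<open>h\<^sup>-\<^sup>1 g = w\<close>.\<close>

theorem opp_opposite:
  assumes o: "opp F F'" and e: "polar_frame n Q e"
  shows "opposite n Q e (flag_of F) (flag_of F')"
proof -
  let ?L = "longest_element n"
  obtain V where V: "hbasis V" "\<And>i. i \<in> I \<Longrightarrow> e i = vec.span {V i}" using polar_frame_hbasis[OF e] by metis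
  let ?M = "vec.span (V ` pos (int n))"
  have M: "?M \<in> G" using hbasis_generators[OF V(1)] by simp
  have iso: "\<exists>g. isom g \<and> (\<forall>i\<in>I. g (V i) = U i)" if "hbasis U" for U
    using hbasis_isometry[OF V(1) that] unfolding isom_def by metis
  have img: "g ` vec.span (V ` J) = vec.span (U ` J)"
    if "isom g" "\<forall>i\<in>I. g (V i) = U i" "J \<subseteq> I" for g U J
    using that by (intro linear_image_span) (auto simp: isom_def)
  have "\<exists>U g. fits F F' U \<and> isom g \<and> (\<forall>i\<in>I. g (V i) = U i) \<and> proj g \<in> type_preserving n Q"
  proof -
    obtain U where U: "fits F F' U" using opp_fits[OF o] by metis
    note U' = fits_flip[OF U]
    have hb: "hbasis U" "hbasis (U \<circ> flip)" using U U' by (auto simp: fits_def)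
    obtain g where g: "isom g" "\<forall>i\<in>I. g (V i) = U i" using iso[OF hb(1)] by auto
    obtain g' where g': "isom g'" "\<forall>i\<in>I. g' (V i) = (U \<circ> flip) i" using iso[OF hb(2)] by auto
    have pI: "pos (int n) \<subseteq> I" "pos (- int n) \<subseteq> I" using pos_neg_I by auto
    have gM: "g ` ?M = vec.span (U ` pos (int n))" by (rule img[OF g pI(1)])
    have "flip ` pos (int n) = pos (- int n)" using n2
      by (auto simp: pos_def flip_def image_iff)
    then have "(U \<circ> flip) ` pos (int n) = U ` pos (- int n)" by (simp only: image_comp[symmetric])
    then have g'M: "g' ` ?M = vec.span (U ` pos (- int n))" using img[OF g' pI(1)] by simp
    have "\<not> same (g ` ?M) (g' ` ?M)"
      unfolding gM g'M using hbasis_generator_adjacent(1)[OF hb(1)] hbasis_generators[OF hb(1)]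
      by (intro adjacent_not_same) auto
    then have "same ?M (g ` ?M) \<or> same ?M (g' ` ?M)"
      using same_cycle[OF M isom_G[OF g(1) M] isom_G[OF g'(1) M]] by blast
    then show ?thesis
      using isom_type_preserving[OF g(1) M] isom_type_preserving[OF g'(1) M] U U' g g' by blast
  qed
  then obtain U g where U: "fits F F' U" and g: "isom g" "\<forall>i\<in>I. g (V i) = U i" "proj g \<in> type_preserving n Q"
    by auto
  have LI: "?L i \<in> I" if "i \<in> I" for i using that by (auto simp: longest_element_def I_iff)
  have LL: "?L (?L i) = i" for i by (simp add: longest_element_def)
  have "hbasis (V \<circ> ?L)" unfolding hbasis_def
  proof (intro conjI ballI)
    fix i assume i: "i \<in> I"
    show "Q ((V \<circ> ?L) i) = 0" using V(1) LI[OF i] by (simp add: hbasis_def)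
    fix j assume j: "j \<in> I"
    have "?L j = - ?L i \<longleftrightarrow> j = - i" by (auto simp: longest_element_def)
    then show "B ((V \<circ> ?L) i) ((V \<circ> ?L) j) = (if j = - i then 1 else 0)"
      using V(1) LI[OF i] LI[OF j] by (simp add: hbasis_def)
  qed
  then obtain w where w: "isom w" "\<forall>i\<in>I. w (V i) = (V \<circ> ?L) i" using iso by blast
  have ww: "w \<circ> w = id"
  proof
    fix x
    interpret w: Vector_Spaces.linear "(*s)" "(*s)" w using w(1) by (simp add: isom_def)
    have "w (w (\<Sum>i\<in>I. c i *s V i)) = (\<Sum>i\<in>I. c i *s V i)" for c
      unfolding w.sum w.scale by (intro sum.cong refl) (use w(2) LI LL in simp)
    then show "(w \<circ> w) x = id x" using hbasis_expand[OF V(1), of x] by (metis comp_apply id_apply)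
  qed
  have wJ: "w ` vec.span (V ` J) = vec.span (V ` (?L ` J))" if "J \<subseteq> I" for J
    using img[OF w that] by (simp add: image_comp)
  \<comment> \<open>The intersection has dimension 1 for odd \<open>n\<close> and 0 for even
    \<open>n\<close>, always of the parity of \<open>n\<close>: fixing \<open>n\<close> and
    \<open>-n\<close> for odd \<open>n\<close> is what keeps the longest element
    type-preserving.\<close>
  have wM: "same ?M (w ` ?M)"
  proof -
    have p: "pos (int n) \<subseteq> I" using pos_neg_I by auto
    have nI: "neg (if odd n then int n else - int n) \<subseteq> I" using pos_neg_I by auto
    have "w ` ?M = vec.span (V ` neg (if odd n then int n else - int n))"
      using wJ[OF p] longest_pos[of "int n"] by simp
    then have "vec.dim (?M \<inter> w ` ?M) = card (pos (int n) \<inter> neg (if odd n then int n else - int n))"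
      using hbasis_span_inter[OF V(1) p nI] hbasis_dim[OF V(1), of "pos (int n) \<inter> neg (if odd n then int n else - int n)"] p
      by (metis inf.coboundedI1)
    also have "pos (int n) \<inter> neg (if odd n then int n else - int n) = (if odd n then {int n} else {})"
      using n2 by (auto simp: pos_def neg_def)
    finally show ?thesis using same_iff[OF M isom_G[OF w(1) M]] by simp
  qed
  have wt: "proj w \<in> type_preserving n Q" by (rule isom_type_preserving[OF w(1) M wM])
  define h where "h = g \<circ> w"
  have h: "isom h" unfolding h_def using g w isom_comp by blast
  have "same (w ` ?M) (g ` (w ` ?M))" by (rule type_preserving_same[OF g(1,3) isom_G[OF w(1) M]])
  then have "same ?M (h ` ?M)" unfolding h_def image_comp[symmetric] by (rule same_trans[OF wM])
  then have ht: "proj h \<in> type_preserving n Q" by (rule isom_type_preserving[OF h M])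
  have actg: "act (proj f) (frame_span e J) = f ` vec.span (V ` J)" if "isom f" "J \<subseteq> I" for f J
    using act_proj[OF isom_carrier[OF that(1)], of "vec.span (V ` J)"] frame_span_eq[of e V J] V(2) that(2) by simp
  have hJ: "h ` vec.span (V ` J) = vec.span (U ` (?L ` J))" if "J \<subseteq> I" for J
  proof -
    have "?L ` J \<subseteq> I" using that LI by auto
    then show ?thesis
      unfolding h_def image_comp[symmetric] wJ[OF that] by (rule img[OF g(1,2)])
  qed
  have i_I: "{1..int i} \<subseteq> I" if "i \<le> n" for i using that by (auto simp: I_iff)
  have base: "act_flag P (base_flag n e) = (\<lambda>i. act P (frame_span e {1..int i})) ` {1..n-2} \<union>
     {act P (frame_span e (pos (int n))), act P (frame_span e (pos (- int n)))}" for P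
    unfolding act_flag_def base_flag_def pos_def by (simp add: image_Un image_image)
  have pI: "pos (int n) \<subseteq> I" "pos (- int n) \<subseteq> I" using pos_neg_I by auto
  have f1: "flag_of F = act_flag (proj g) (base_flag n e)"
  proof -
    have "(\<lambda>i. act (proj g) (frame_span e {1..int i})) ` {1..n-2} = lev F ` {1..n-2}"
      using U actg[OF g(1) i_I] img[OF g(1,2) i_I] by (intro image_cong) (auto simp: fits_def)
    then show ?thesis
      unfolding base flag_of_def actg[OF g(1) pI(1)] actg[OF g(1) pI(2)] img[OF g(1,2) pI(1)] img[OF g(1,2) pI(2)]
      using U by (simp add: fits_def)
  qed
  have f2: "flag_of F' = act_flag (proj h) (base_flag n e)"
  proof -
    have "(\<lambda>i. act (proj h) (frame_span e {1..int i})) ` {1..n-2} = lev F' ` {1..n-2}"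
      using U actg[OF h i_I] hJ[OF i_I] longest_image n2 by (intro image_cong) (auto simp: fits_def)
    moreover have "{vec.span (U ` (?L ` pos (int n))), vec.span (U ` (?L ` pos (- int n)))} = {lev F' n, top2 F'}"
      using U longest_pos[of "int n"] longest_pos[of "- int n"] by (cases "odd n") (auto simp: fits_def insert_commute)
    ultimately show ?thesis
      unfolding base flag_of_def actg[OF h pI(1)] actg[OF h pI(2)] hJ[OF pI(1)] hJ[OF pI(2)] by simp
  qed
  have we: "act (proj w) (e i) = e (?L i)" if i: "i \<in> I" for i
  proof -
    have iI: "{i} \<subseteq> I" using i by simp
    have "act (proj w) (e i) = w ` vec.span {V i}"
      using act_proj[OF isom_carrier[OF w(1)], of "e i"] V(2)[OF i] by simp
    then show ?thesis using wJ[OF iI] V(2)[OF LI[OF i]] by simp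
  qed
  have "inv\<^bsub>PGO Q\<^esub> (proj h) \<otimes>\<^bsub>PGO Q\<^esub> proj g = proj w"
  proof -
    interpret P: group "PGO Q" by (rule PGO_group)
    note c = isom_carrier[OF g(1)] isom_carrier[OF w(1)] isom_carrier[OF h]
    note pc = proj_carrier[OF c(1)] proj_carrier[OF c(2)] proj_carrier[OF c(3)]
    have "proj h \<otimes>\<^bsub>PGO Q\<^esub> proj w = proj g"
      using proj_mult[OF c(3,2)] ww by (simp add: h_def comp_assoc)
    then show ?thesis using P.inv_solve_left[OF pc(2) pc(3) pc(1)] by simp
  qed
  then have "double_coset n Q e (inv\<^bsub>PGO Q\<^esub> (proj h) \<otimes>\<^bsub>PGO Q\<^esub> proj g) = double_coset n Q e (proj w)"
    by simp
  then show ?thesis unfolding opposite_def using g(3) ht wt f1 f2 we by blast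
qed

end

section \<open>Maximal flags\<close>

context hyperbolic_quadric
begin

lemma X_nonempty: "X \<noteq> {}"
proof -
  obtain M where "M \<in> G" using G_nonempty by auto
  then obtain e where "good n e" using exists_good[of M n] by (auto simp: G_iff)
  then show ?thesis using chains_I by blast
qed

text \<open>The members \<open>M\<close> and \<open>N\<close> from the two classes are incident, so
  \<open>M \<inter> N\<close> has dimension \<open>n-1\<close> and supplies the level that flags
  lack. The incidences with smaller members are inclusions, whose direction the dimensions
  determine.\<close>

theorem maximal_flag_of_chain:
  assumes Fl: "Fl \<in> maximal_flags n Q"
  shows "\<exists>F\<in>X. flag_of F = Fl"
proof -
  have sub: "Fl \<subseteq> \<Union>(oriflamme_types n Q)" and inc: "\<And>U V. U \<in> Fl \<Longrightarrow> V \<in> Fl \<Longrightarrow> U \<noteq> V \<Longrightarrow> incident n Q U V"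
    and ex: "\<And>T. T \<in> oriflamme_types n Q \<Longrightarrow> \<exists>!U. U \<in> Fl \<inter> T"
    using Fl by (auto simp: maximal_flags_def oriflamme_elements_def pairwise_def)
  obtain F0 where F0: "F0 \<in> X" using X_nonempty by auto
  define M0 N0 where "M0 = lev F0 n" and "N0 = top2 F0"
  have MN0: "M0 \<in> G" "N0 \<in> G" "\<not> same M0 N0"
    using X_G[OF F0] swp_props(6)[OF F0] top_not_same[OF F0] by (auto simp: M0_def N0_def)
  let ?cl = "\<lambda>M. same_class n Q `` {M}"
  have cl: "?cl M \<in> oriflamme_types n Q" if "M \<in> G" for M
    using that by (auto simp: oriflamme_types_def intro: quotientI)
  have classes: "T = ?cl M0 \<or> T = ?cl N0" if "T \<in> G // same_class n Q" for T
  proof -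
    obtain L where L: "L \<in> G" "T = ?cl L" using \<open>T \<in> G // same_class n Q\<close> by (auto elim: quotientE)
    have "same M0 L \<or> same N0 L" using same_cycle[OF MN0(1,2) L(1)] MN0(3) by blast
    then show ?thesis using L(2) equiv_class_eq[OF equiv_same_class] by blast
  qed
  obtain M where M: "M \<in> Fl" "same M0 M" "\<And>U. U \<in> Fl \<Longrightarrow> same M0 U \<Longrightarrow> U = M"
    using ex[OF cl[OF MN0(1)]] by auto
  obtain N where N: "N \<in> Fl" "same N0 N" "\<And>U. U \<in> Fl \<Longrightarrow> same N0 U \<Longrightarrow> U = N"
    using ex[OF cl[OF MN0(2)]] by auto
  have G: "M \<in> G" "N \<in> G" using same_G[OF M(2)] same_G[OF N(2)] by simp_all
  have nMN: "\<not> same M N" using M(2) N(2) MN0(3) same_trans same_sym by blast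
  have "M \<noteq> N" using nMN same_refl G by auto
  then have d: "vec.dim (M \<inter> N) = n - 1" using inc[OF M(1) N(1)] G nMN by (simp add: incident_def)
  have "\<forall>i. \<exists>U. i \<in> {1..n-2} \<longrightarrow> U \<in> Fl \<and> TS U \<and> vec.dim U = i \<and> (\<forall>V\<in>Fl. TS V \<and> vec.dim V = i \<longrightarrow> V = U)"
  proof (intro allI)
    fix i
    have "i \<in> {1..n-2} \<Longrightarrow> \<exists>!U. U \<in> Fl \<inter> singular_subspaces Q i"
      by (rule ex) (simp add: oriflamme_types_def)
    then show "\<exists>U. i \<in> {1..n-2} \<longrightarrow> U \<in> Fl \<and> TS U \<and> vec.dim U = i \<and> (\<forall>V\<in>Fl. TS V \<and> vec.dim V = i \<longrightarrow> V = U)"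
      unfolding singular_subspaces_def by blast
  qed
  then obtain E where E: "\<And>i. 1 \<le> i \<Longrightarrow> i \<le> n-2 \<Longrightarrow> E i \<in> Fl \<and> TS (E i) \<and> vec.dim (E i) = i"
    "\<And>i V. 1 \<le> i \<Longrightarrow> i \<le> n-2 \<Longrightarrow> V \<in> Fl \<Longrightarrow> TS V \<Longrightarrow> vec.dim V = i \<Longrightarrow> V = E i"
    by (metis atLeastAtMost_iff)
  have contain: "E i \<subseteq> V" if i: "1 \<le> i" "i \<le> n-2" and V: "V \<in> Fl" "i < vec.dim V" for i V
  proof -
    have "E i \<notin> G" using E(1)[OF i] i by (auto simp: G_iff)
    moreover have "E i \<noteq> V" using V E(1)[OF i] by auto
    ultimately have "E i \<subseteq> V \<or> V \<subseteq> E i" using inc[of "E i" V] E(1)[OF i] V(1) by (simp add: incident_def)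
    then show ?thesis using vec.dim_subset[of V "E i"] E(1)[OF i] V(2) by auto
  qed
  define e where "e i = (if i = 0 then {0} else if i \<le> n-2 then E i else if i = n-1 then M \<inter> N else M)" for i
  have "good n e" unfolding good_def
  proof (intro conjI allI impI)
    fix i
    show "i \<le> n \<Longrightarrow> TS (e i)" using E(1)[of i] TS_0 TS_inter[OF G] G_TS[OF G(1)] by (simp add: e_def)
    show "i \<le> n \<Longrightarrow> vec.dim (e i) = i" using E(1)[of i] d G_dim[OF G(1)] by (auto simp: e_def)
    assume i: "i < n"
    consider "i = 0" | "1 \<le> i" "Suc i \<le> n-2" | "1 \<le> i" "i = n-2" | "i = n-1" using i by linarith
    then show "e i \<subseteq> e (Suc i)"
    proof cases
      case 1
      have "0 \<in> e (Suc 0)"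
        using E(1)[of 1] TS_inter[OF G] G_TS[OF G(1)] by (auto simp: e_def TS_subspace vec.subspace_0)
      then show ?thesis using 1 by (simp add: e_def)
    next
      case 2 then show ?thesis using contain[of i "E (Suc i)"] E(1)[of "Suc i"] by (simp add: e_def)
    next
      case 3
      then have "E i \<subseteq> M" "E i \<subseteq> N" using contain[of i] M(1) N(1) G_dim G n2 by auto
      then show ?thesis using 3 n2 by (auto simp: e_def)
    next
      case 4 then show ?thesis using n2 by (auto simp: e_def)
    qed
  qed
  note ge = this
  let ?F = "e ` {0..n}"
  have X: "?F \<in> X" by (rule chains_I[OF ge])
  have L: "lev ?F i = e i" if "i \<le> n" for i by (rule lev_image[OF ge that])
  have Ln: "lev ?F n = M" "lev ?F (n-1) = M \<inter> N" using L[of n] L[of "n-1"] n2 by (auto simp: e_def)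
  have "top2 ?F = N" by (rule top2_I[OF X]) (use G Ln \<open>M \<noteq> N\<close> in auto)
  moreover have "lev ?F ` {1..n-2} = E ` {1..n-2}" using L by (intro image_cong) (auto simp: e_def)
  ultimately have "flag_of ?F = E ` {1..n-2} \<union> {M, N}" using Ln by (simp add: flag_of_def)
  moreover have "E ` {1..n-2} \<union> {M, N} = Fl"
  proof
    show "E ` {1..n-2} \<union> {M, N} \<subseteq> Fl" using E(1) M(1) N(1) by auto
    show "Fl \<subseteq> E ` {1..n-2} \<union> {M, N}"
    proof
      fix U assume U: "U \<in> Fl"
      then obtain T where T: "T \<in> oriflamme_types n Q" "U \<in> T" using sub by auto
      then consider i where "i \<in> {1..n-2}" "T = singular_subspaces Q i" | "T \<in> G // same_class n Q"
        by (auto simp: oriflamme_types_def)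
      then show "U \<in> E ` {1..n-2} \<union> {M, N}"
      proof cases
        case 1 then show ?thesis using E(2)[of i U] U T by (auto simp: singular_subspaces_def)
      next
        case 2 then show ?thesis using classes[OF 2] T(2) U M(3) N(3) by auto
      qed
    qed
  qed
  ultimately show ?thesis using X by auto
qed

text \<open>\<open>S\<close> consists of the chambers over \<open>C\<close>. Each fibre contains
  some \<open>F\<close> together with \<open>swp F\<close>, which yields both the factor 2 and the
  closure under \<open>swp\<close> required by \<open>ratio_bound\<close>.\<close>

theorem EKR_bound:
  assumes n3: "n \<ge> 3" and e: "polar_frame n Q e" and C: "EKR_set n Q e C"
  shows "2 * real (card C) * (1 + real CARD('a) ^ (n-1)) \<le> real (card X)"
proof -
  define S where "S = {F\<in>X. flag_of F \<in> C}"
  have CM: "C \<subseteq> maximal_flags n Q" and pw: "pairwise (\<lambda>F1 F2. \<not> opposite n Q e F1 F2) C"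
    using C by (auto simp: EKR_set_def)
  have im: "flag_of ` S = C" using maximal_flag_of_chain CM by (fastforce simp: S_def)
  have "2 \<le> card {F\<in>S. flag_of F = c}" if c: "c \<in> C" for c
  proof -
    obtain F where F: "F \<in> S" "flag_of F = c" using im c by auto
    then have FX: "F \<in> X" by (simp add: S_def)
    have "{F, swp F} \<subseteq> {F\<in>S. flag_of F = c}"
      using F swp_props(1)[OF FX] flag_of_swp[OF FX] by (auto simp: S_def)
    then have "card {F, swp F} \<le> card {F\<in>S. flag_of F = c}" by (intro card_mono) auto
    then show ?thesis using swp_props(3)[OF FX] by auto
  qed
  then have "(\<Sum>c\<in>C. 2) \<le> (\<Sum>c\<in>C. card {F\<in>S. flag_of F = c})" by (rule sum_mono)
  also have "\<dots> = card S" using card_eq_sum_fibres[of S flag_of] im by simp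
  finally have "2 * card C \<le> card S" by simp
  then have two: "2 * real (card C) \<le> real (card S)" by linarith
  have "real (card S) * (1 + real CARD('a) ^ (n-1)) \<le> real (card X)"
  proof (rule ratio_bound[OF _ _ _ X_nonempty])
    show "S \<subseteq> X" by (auto simp: S_def)
    show "swp F \<in> S" if "F \<in> S" for F using that swp_props(1) flag_of_swp by (simp add: S_def)
    show "F' \<notin> S" if F: "F \<in> S" "F' \<in> walk w0_word F" for F F'
    proof
      assume F': "F' \<in> S"
      have FX: "F \<in> X" "F' \<in> X" using F F' by (auto simp: S_def)
      have o: "opp F F'" by (rule walk_opp[OF FX(1) F(2)])
      \<comment> \<open>As \<open>n \<ge> 3\<close>, the point of a chamber belongs to its flag and
        is its only member of dimension 1.\<close>
      have point: "{U\<in>flag_of A. vec.dim U = 1} = {lev A 1}" if "A \<in> X" for A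
        using that X_dim[OF that] swp_props(6)[OF that] n3 by (auto simp: flag_of_def G_dim)
      \<comment> \<open>\<open>pairwise\<close> says nothing about equal flags, so opposite chambers
        must be shown to have different ones: a point is not opposite to itself.\<close>
      have "flag_of F \<noteq> flag_of F'"
      proof
        assume "flag_of F = flag_of F'"
        then have eq: "lev F 1 = lev F' 1" using point[OF FX(1)] point[OF FX(2)] by simp
        have "lev F 1 \<subseteq> perp (lev F 1)" using TS_perp X_TS FX n2 by simp
        then have "lev F 1 \<subseteq> {0}" using o eq n2 unfolding opp_def by (metis Int_absorb2 One_nat_def Suc_leD numeral_2_eq_2 subset_refl)
        then show False using X_dim[OF FX(1), of 1] vec.dim_eq_0[of "lev F 1"] n2 by simp
      qed
      then show False using pw opp_opposite[OF o e] F F' by (auto simp: pairwise_def S_def)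
    qed
  qed
  moreover have "2 * real (card C) * (1 + real CARD('a) ^ (n-1)) \<le> real (card S) * (1 + real CARD('a) ^ (n-1))"
    using two by (intro mult_right_mono) auto
  ultimately show ?thesis by linarith
qed

lemma card_X: "real (card X) = (\<Prod>k=1..n. q_number CARD('a) k * (real CARD('a) ^ (k-1) + 1))"
proof -
  have "real (residue_points m) = q_number CARD('a) m * (real CARD('a) ^ (m-1) + 1)" for m
  proof -
    have "real (\<Sum>i<m. CARD('a) ^ i) = (real CARD('a) ^ m - 1) / (real CARD('a) - 1)"
      using card_field_gt_1[where 'a='a] by (simp add: geometric_sum)
    then show ?thesis
      by (simp only: residue_points_def q_number_def of_nat_mult of_nat_add of_nat_power of_nat_1)
  qed
  then have "real (card X) = (\<Prod>j<n. q_number CARD('a) (n-j) * (real CARD('a) ^ (n-j-1) + 1))"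
    by (simp add: card_chains)
  also have "\<dots> = (\<Prod>k=1..n. q_number CARD('a) k * (real CARD('a) ^ (k-1) + 1))"
    by (rule prod.reindex_bij_witness[where i = "\<lambda>k. n - k" and j = "\<lambda>j. n - j"]) auto
  finally show ?thesis .
qed

end

theorem theorem3p24:
  fixes Q :: "'a::{field,finite}^'d \<Rightarrow> 'a"
    and e :: "int \<Rightarrow> ('a^'d) set"
    and C :: "('a^'d) set set set"
    and n q :: nat
  assumes "n \<ge> 4"
    and "CARD('a) = q"
    and "hyperbolic_form n Q"
    and "polar_frame n Q e"
    and "EKR_set n Q e C"
  shows "real (card C) \<le>
           (\<Prod>i=1..n-1. (real q ^ i + 1)) * (\<Prod>k=1..n. q_number q k) / (1 + real q ^ (n - 1)) \<and>
         (\<Prod>i=1..n-1. (real q ^ i + 1)) * (\<Prod>k=1..n. q_number q k) / (1 + real q ^ (n - 1)) =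
           (\<Prod>i=1..n-2. (real q ^ i + 1)) * (\<Prod>k=1..n. q_number q k)"
proof
  interpret hyperbolic_quadric Q n using assms by unfold_locales auto
  let ?P = "\<Prod>k=1..n. q_number q k"
  have pos: "1 + real q ^ (n-1) > 0" by (simp add: add_pos_nonneg)
  \<comment> \<open>After the index shift the first factor is \<open>q^0 + 1 = 2\<close>, the number
    of generators on a space of dimension \<open>n-1\<close>; it cancels the 2 in
    \<open>EKR_bound\<close>.\<close>
  have "(\<Prod>k=1..n. real q ^ (k-1) + 1) = (\<Prod>k=0..n-1. real q ^ k + 1)"
    by (rule prod.reindex_bij_witness[where i = Suc and j = "\<lambda>k. k - 1"]) (use assms(1) in auto)
  also have "\<dots> = 2 * (\<Prod>k=1..n-1. real q ^ k + 1)"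
    by (simp add: prod.atLeast_Suc_atMost)
  finally have "real (card (chains n)) = 2 * ((\<Prod>i=1..n-1. (real q ^ i + 1)) * ?P)"
    unfolding card_X assms(2) prod.distrib by simp
  moreover have "2 * real (card C) * (1 + real q ^ (n-1)) \<le> real (card (chains n))"
    using EKR_bound[OF _ assms(4,5)] assms(1,2) by simp
  ultimately have "real (card C) * (1 + real q ^ (n-1)) \<le> (\<Prod>i=1..n-1. (real q ^ i + 1)) * ?P" by simp
  then show "real (card C) \<le> (\<Prod>i=1..n-1. (real q ^ i + 1)) * ?P / (1 + real q ^ (n - 1))"
    using pos by (simp add: pos_le_divide_eq)
  have "n - 1 = Suc (n - 2)" using assms(1) by simp
  then have "(\<Prod>i=1..n-1. (real q ^ i + 1)) = (\<Prod>i=1..n-2. (real q ^ i + 1)) * (1 + real q ^ (n-1))"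
    by (simp add: add.commute)
  then show "(\<Prod>i=1..n-1. (real q ^ i + 1)) * ?P / (1 + real q ^ (n - 1)) = (\<Prod>i=1..n-2. (real q ^ i + 1)) * ?P"
    using pos by simp
qed

end
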